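(* Let $M$ be a compact connected Kähler manifold without boundary with $C_1(M)\le0$, and let $\Omega$ be a Kähler class on $M$; assume that either $C_1(M)=0$ in $H^2(M,\mathbb{R})$ and $\Omega$ is arbitrary, or $C_1(M)<0$ and $\Omega=-2\pi C_1(M)$. Then the Kähler-Einstein metric in $\Omega$ is unique: if $\omega_0,\omega_1\in\Omega$ are Kähler-Einstein metrics, then $\omega_0=\omega_1$.
   Context: A Kähler metric $\omega$ is Kähler-Einstein if its Ricci form satisfies $\rho(\omega)=\lambda\omega$ for a real constant $\lambda$, where $\rho(\omega)=-i\partial\bar\partial\log\det g$ represents $2\pi C_1(M)$. $C_1(M)<0$ means that $-C_1(M)$ contains a Kähler form. *)

theory Defs
  imports "HOL-Analysis.Analysis"
begin

text \<open>
  A complex manifold of dimension \<open>CARD('n)\<close> is a topological space \<open>X\<close> with a holomorphic atlas \<open>A\<close>.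
  The atlas need not be maximal: any atlas determines the complex structure, and a tensor field
  is determined by its expressions in the charts of any atlas.
\<close>

section \<open>Complex manifolds\<close>

text \<open>
  A chart is a pair of a domain and a coordinate map; the values of the coordinate map outside
  the domain are irrelevant.
\<close>

type_synonym ('a, 'n) chart = "'a set \<times> ('a \<Rightarrow> complex ^ 'n)"

definition chart_image :: "('a, 'n::finite) chart \<Rightarrow> (complex ^ 'n) set" where
  "chart_image c = snd c ` fst c"

definition transition ::
    "('a, 'n::finite) chart \<Rightarrow> ('a, 'n) chart \<Rightarrow> complex ^ 'n \<Rightarrow> complex ^ 'n" where
  "transition c c' = snd c' \<circ> inv_into (fst c) (snd c)"

definition overlap :: "('a, 'n::finite) chart \<Rightarrow> ('a, 'n) chart \<Rightarrow> (complex ^ 'n) set" where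
  "overlap c c' = snd c ` (fst c \<inter> fst c')"

definition holomorphic_map_on ::
    "(complex ^ 'n::finite \<Rightarrow> complex ^ 'm::finite) \<Rightarrow> (complex ^ 'n) set \<Rightarrow> bool" where
  "holomorphic_map_on f S \<longleftrightarrow>
     (\<forall>z\<in>S. \<exists>D. (f has_derivative D) (at z) \<and> (\<forall>a u. D (a *s u) = a *s D u))"

definition complex_manifold :: "'a topology \<Rightarrow> ('a, 'n::finite) chart set \<Rightarrow> bool" where
  "complex_manifold X A \<longleftrightarrow>
     Hausdorff_space X \<and>
     (\<exists>\<B>. countable \<B> \<and> openin X = arbitrary union_of (\<lambda>V. V \<in> \<B>)) \<and>
     (\<Union>c\<in>A. fst c) = topspace X \<and>
     (\<forall>c\<in>A. openin X (fst c) \<and> open (chart_image c) \<and>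
        homeomorphic_map (subtopology X (fst c)) (top_of_set (chart_image c)) (snd c)) \<and>
     (\<forall>c\<in>A. \<forall>c'\<in>A. holomorphic_map_on (transition c c') (overlap c c'))"

section \<open>Differential forms\<close>

text \<open>\<open>C\<^sup>k\<close> and smooth functions on an open set; the derivatives are real Frechet derivatives.\<close>

fun Ck_on :: "nat \<Rightarrow> ('v::real_normed_vector \<Rightarrow> 'w::real_normed_vector) \<Rightarrow> 'v set \<Rightarrow> bool" where
  "Ck_on 0 f S \<longleftrightarrow> continuous_on S f"
| "Ck_on (Suc k) f S \<longleftrightarrow>
     (\<forall>x\<in>S. f differentiable at x) \<and> (\<forall>v. Ck_on k (\<lambda>x. frechet_derivative f (at x) v) S)"

definition smooth_on :: "('v::real_normed_vector \<Rightarrow> 'w::real_normed_vector) \<Rightarrow> 'v set \<Rightarrow> bool" where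
  "smooth_on f S \<longleftrightarrow> (\<forall>k. Ck_on k f S)"

text \<open>
  A real form assigns to a chart \<open>c\<close> and a point \<open>z\<close> of its image a real-valued alternating real
  multilinear map on \<open>\<complex>\<^sup>n\<close>, the tangent space in the coordinates \<open>c\<close>; the expressions in different
  charts are related by pullback.  Forms vanish off the atlas, so that equality of forms
  is equality of functions.
\<close>

type_synonym ('a, 'n) form1 =
  "('a, 'n) chart \<Rightarrow> complex ^ 'n \<Rightarrow> complex ^ 'n \<Rightarrow> real"

type_synonym ('a, 'n) form2 =
  "('a, 'n) chart \<Rightarrow> complex ^ 'n \<Rightarrow> complex ^ 'n \<Rightarrow> complex ^ 'n \<Rightarrow> real"

definition in_atlas :: "('a, 'n::finite) chart set \<Rightarrow> ('a, 'n) chart \<Rightarrow> complex ^ 'n \<Rightarrow> bool" where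
  "in_atlas A c z \<longleftrightarrow> c \<in> A \<and> z \<in> chart_image c"

definition one_form :: "('a, 'n::finite) chart set \<Rightarrow> ('a, 'n) form1 \<Rightarrow> bool" where
  "one_form A \<eta> \<longleftrightarrow>
     (\<forall>c z. in_atlas A c z \<longrightarrow> linear (\<eta> c z)) \<and>
     (\<forall>c\<in>A. \<forall>u. smooth_on (\<lambda>z. \<eta> c z u) (chart_image c)) \<and>
     (\<forall>c\<in>A. \<forall>c'\<in>A. \<forall>z\<in>overlap c c'. \<forall>u.
        \<eta> c z u =
        \<eta> c' (transition c c' z) (frechet_derivative (transition c c') (at z) u)) \<and>
     (\<forall>c z u. \<not> in_atlas A c z \<longrightarrow> \<eta> c z u = 0)"

definition two_form :: "('a, 'n::finite) chart set \<Rightarrow> ('a, 'n) form2 \<Rightarrow> bool" where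
  "two_form A \<alpha> \<longleftrightarrow>
     (\<forall>c z. in_atlas A c z \<longrightarrow> bilinear (\<alpha> c z) \<and> (\<forall>u. \<alpha> c z u u = 0)) \<and>
     (\<forall>c\<in>A. \<forall>u v. smooth_on (\<lambda>z. \<alpha> c z u v) (chart_image c)) \<and>
     (\<forall>c\<in>A. \<forall>c'\<in>A. \<forall>z\<in>overlap c c'. \<forall>u v.
        \<alpha> c z u v =
        \<alpha> c' (transition c c' z)
          (frechet_derivative (transition c c') (at z) u)
          (frechet_derivative (transition c c') (at z) v)) \<and>
     (\<forall>c z u v. \<not> in_atlas A c z \<longrightarrow> \<alpha> c z u v = 0)"

text \<open>The formula for \<open>d\<eta>\<close> on constant vector fields, whose bracket vanishes.\<close>

definition ext_deriv1 :: "('a, 'n::finite) chart set \<Rightarrow> ('a, 'n) form1 \<Rightarrow> ('a, 'n) form2" where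
  "ext_deriv1 A \<eta> = (\<lambda>c z u v.
     if in_atlas A c z
     then frechet_derivative (\<lambda>y. \<eta> c y v) (at z) u - frechet_derivative (\<lambda>y. \<eta> c y u) (at z) v
     else 0)"

definition closed_form2 :: "('a, 'n::finite) chart set \<Rightarrow> ('a, 'n) form2 \<Rightarrow> bool" where
  "closed_form2 A \<alpha> \<longleftrightarrow> two_form A \<alpha> \<and>
     (\<forall>c z u v w. in_atlas A c z \<longrightarrow>
        frechet_derivative (\<lambda>y. \<alpha> c y v w) (at z) u
        - frechet_derivative (\<lambda>y. \<alpha> c y u w) (at z) v
        + frechet_derivative (\<lambda>y. \<alpha> c y u v) (at z) w = 0)"

definition zero_form2 :: "('a, 'n::finite) form2" where
  "zero_form2 = (\<lambda>c z u v. 0)"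

definition scale_form2 :: "real \<Rightarrow> ('a, 'n::finite) form2 \<Rightarrow> ('a, 'n) form2" where
  "scale_form2 r \<alpha> = (\<lambda>c z u v. r * \<alpha> c z u v)"

section \<open>Second de Rham cohomology\<close>

definition cohomologous ::
    "('a, 'n::finite) chart set \<Rightarrow> ('a, 'n) form2 \<Rightarrow> ('a, 'n) form2 \<Rightarrow> bool" where
  "cohomologous A \<alpha> \<beta> \<longleftrightarrow>
     (\<exists>\<eta>. one_form A \<eta> \<and> (\<forall>c z u v. \<alpha> c z u v - \<beta> c z u v = ext_deriv1 A \<eta> c z u v))"

text \<open>A class in \<open>H\<^sup>2(M, \<real>)\<close> is the set of all closed real 2-forms representing it.\<close>

definition dR_class :: "('a, 'n::finite) chart set \<Rightarrow> ('a, 'n) form2 \<Rightarrow> ('a, 'n) form2 set" where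
  "dR_class A \<alpha> = {\<beta>. closed_form2 A \<beta> \<and> cohomologous A \<beta> \<alpha>}"

definition scale_class ::
    "('a, 'n::finite) chart set \<Rightarrow> real \<Rightarrow> ('a, 'n) form2 set \<Rightarrow> ('a, 'n) form2 set" where
  "scale_class A r C = (\<Union>\<alpha>\<in>C. dR_class A (scale_form2 r \<alpha>))"

section \<open>Kaehler metrics\<close>

text \<open>
  Metrics are identified with their fundamental forms, \<open>\<omega>(u, v) = g(Ju, v)\<close> where \<open>J\<close> is
  multiplication by \<open>\<i>\<close>; hence \<open>g(u, u) = \<omega>(u, Ju)\<close>.  Invariance under \<open>J\<close> says that a real
  2-form is of type (1,1).
\<close>

definition type_11 :: "('a, 'n::finite) chart set \<Rightarrow> ('a, 'n) form2 \<Rightarrow> bool" where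
  "type_11 A \<alpha> \<longleftrightarrow>
     (\<forall>c z u v. in_atlas A c z \<longrightarrow> \<alpha> c z (\<i> *s u) (\<i> *s v) = \<alpha> c z u v)"

definition hermitian_form :: "('a, 'n::finite) chart set \<Rightarrow> ('a, 'n) form2 \<Rightarrow> bool" where
  "hermitian_form A \<omega> \<longleftrightarrow> two_form A \<omega> \<and> type_11 A \<omega> \<and>
     (\<forall>c z u. in_atlas A c z \<and> u \<noteq> 0 \<longrightarrow> \<omega> c z u (\<i> *s u) > 0)"

definition kahler_form :: "('a, 'n::finite) chart set \<Rightarrow> ('a, 'n) form2 \<Rightarrow> bool" where
  "kahler_form A \<omega> \<longleftrightarrow> hermitian_form A \<omega> \<and> closed_form2 A \<omega>"

definition kahler_manifold :: "'a topology \<Rightarrow> ('a, 'n::finite) chart set \<Rightarrow> bool" where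
  "kahler_manifold X A \<longleftrightarrow> complex_manifold X A \<and> (\<exists>\<omega>. kahler_form A \<omega>)"

definition kahler_class :: "('a, 'n::finite) chart set \<Rightarrow> ('a, 'n) form2 set \<Rightarrow> bool" where
  "kahler_class A \<Omega> \<longleftrightarrow> (\<exists>\<omega>. kahler_form A \<omega> \<and> \<Omega> = dR_class A \<omega>)"

section \<open>Ricci form and first Chern class\<close>

text \<open>
  The matrix \<open>g\<^sub>j\<^sub>k\<close> with \<open>\<omega> = \<i> \<Sum>\<^sub>j\<^sub>k g\<^sub>j\<^sub>k dz\<^sub>j \<and> d(cnj z\<^sub>k)\<close>, obtained by evaluating the complex bilinear
  extension of \<open>\<omega>\<close> on \<open>\<partial>/\<partial>z\<^sub>j = (e\<^sub>j - \<i> J e\<^sub>j)/2\<close> and \<open>\<partial>/\<partial>(cnj z\<^sub>k) = (e\<^sub>k + \<i> J e\<^sub>k)/2\<close>.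
  The common alternative normalisation with \<open>\<i>/2\<close> in place of \<open>\<i>\<close> rescales \<open>g\<close> by a constant and
  gives the same Ricci form.
\<close>

definition metric_matrix ::
    "('a, 'n::finite) form2 \<Rightarrow> ('a, 'n) chart \<Rightarrow> complex ^ 'n \<Rightarrow> complex ^ 'n ^ 'n" where
  "metric_matrix \<omega> c z = (\<chi> j k.
     (complex_of_real (\<omega> c z (axis j 1) (axis k \<i>))
      - \<i> * complex_of_real (\<omega> c z (axis j 1) (axis k 1))) / 2)"

definition wirtinger :: "'n::finite \<Rightarrow> (complex ^ 'n \<Rightarrow> complex) \<Rightarrow> complex ^ 'n \<Rightarrow> complex" where
  "wirtinger j f z =
     (frechet_derivative f (at z) (axis j 1) - \<i> * frechet_derivative f (at z) (axis j \<i>)) / 2"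

definition wirtinger_bar :: "'n::finite \<Rightarrow> (complex ^ 'n \<Rightarrow> complex) \<Rightarrow> complex ^ 'n \<Rightarrow> complex" where
  "wirtinger_bar k f z =
     (frechet_derivative f (at z) (axis k 1) + \<i> * frechet_derivative f (at z) (axis k \<i>)) / 2"

text \<open>
  The 2-form \<open>\<i> \<partial> \<partial>bar f = \<i> \<Sum>\<^sub>j\<^sub>k (\<partial>\<^sup>2f / \<partial>z\<^sub>j \<partial>(cnj z\<^sub>k)) dz\<^sub>j \<and> d(cnj z\<^sub>k)\<close> evaluated on \<open>u\<close> and \<open>v\<close>.
  For real \<open>f\<close> the sum is real.
\<close>

definition i_ddbar ::
    "(complex ^ 'n::finite \<Rightarrow> real) \<Rightarrow> complex ^ 'n \<Rightarrow> complex ^ 'n \<Rightarrow> complex ^ 'n \<Rightarrow> real" where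
  "i_ddbar f z u v =
     Re (\<i> * (\<Sum>j\<in>UNIV. \<Sum>k\<in>UNIV.
       wirtinger j (wirtinger_bar k (\<lambda>y. complex_of_real (f y))) z
       * (u $ j * cnj (v $ k) - v $ j * cnj (u $ k))))"

text \<open>
  The matrix of a Hermitian metric is positive definite Hermitian, so its determinant is a
  positive real number and taking the real part loses nothing.
\<close>

definition ricci_form ::
    "('a, 'n::finite) chart set \<Rightarrow> ('a, 'n) form2 \<Rightarrow> ('a, 'n) form2" where
  "ricci_form A \<omega> = (\<lambda>c z u v.
     if in_atlas A c z
     then - i_ddbar (\<lambda>y. ln (Re (det (metric_matrix \<omega> c y)))) z u v
     else 0)"

definition kahler_einstein :: "('a, 'n::finite) chart set \<Rightarrow> ('a, 'n) form2 \<Rightarrow> bool" where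
  "kahler_einstein A \<omega> \<longleftrightarrow>
     kahler_form A \<omega> \<and> (\<exists>l::real. ricci_form A \<omega> = scale_form2 l \<omega>)"

text \<open>
  The real first Chern class by Chern-Weil theory: \<open>ricci_form A h\<close> is the curvature form of the
  metric induced by a Hermitian metric \<open>h\<close> on the anticanonical bundle, and it represents
  \<open>2\<pi> C\<^sub>1(M)\<close>.  The union is over all \<open>h\<close>, but all of them contribute the same class, because
  \<open>log det h - log det h'\<close> is a global function.
\<close>

definition chern1 :: "('a, 'n::finite) chart set \<Rightarrow> ('a, 'n) form2 set" where
  "chern1 A =
     (\<Union>h\<in>{h. hermitian_form A h}. dR_class A (scale_form2 (1 / (2 * pi)) (ricci_form A h)))"

definition chern1_zero :: "('a, 'n::finite) chart set \<Rightarrow> bool" where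
  "chern1_zero A \<longleftrightarrow> chern1 A = dR_class A zero_form2"

definition chern1_negative :: "('a, 'n::finite) chart set \<Rightarrow> bool" where
  "chern1_negative A \<longleftrightarrow> (\<exists>\<omega>\<in>scale_class A (-1) (chern1 A). kahler_form A \<omega>)"

text \<open>\<open>C\<^sub>1(M) \<le> 0\<close>: the class \<open>- C\<^sub>1(M)\<close> contains a semipositive closed real (1,1)-form.\<close>

definition chern1_nonpositive :: "('a, 'n::finite) chart set \<Rightarrow> bool" where
  "chern1_nonpositive A \<longleftrightarrow>
     (\<exists>\<alpha>\<in>scale_class A (-1) (chern1 A). type_11 A \<alpha> \<and>
        (\<forall>c z u. in_atlas A c z \<longrightarrow> \<alpha> c z u (\<i> *s u) \<ge> 0))"

end

theory Submission
  imports Defs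
begin

text \<open>
  The proof avoids both the \<open>\<partial>\<partial>bar\<close>-lemma and integration of differential forms.  Its only global
  input is the divergence theorem in the following form: if \<open>\<omega>\<close> is Kaehler, \<open>\<eta>\<close> is a \<open>C\<^sup>1\<close> one-form
  and the \<open>\<omega>\<close>-trace of \<open>d\<eta>\<close> is nonnegative, then it vanishes.  Indeed \<open>d\<omega> = 0\<close> makes the trace the
  divergence of the vector field dual to \<open>\<eta>\<close>.

  Since \<open>\<omega>\<close> itself has positive trace, no nonzero multiple of it is exact; this determines the
  Einstein constant: \<open>l = 0\<close> if \<open>C\<^sub>1 = 0\<close> and \<open>l = -1\<close> if the class is \<open>-2\<pi> C\<^sub>1\<close>.  For two Einstein forms
  with the same \<open>l \<le> 0\<close> and \<open>\<omega>' - \<omega> = d\<eta>\<close> put \<open>F = log (det g' / det g)\<close>.  Then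
  \<open>\<i>\<partial>\<partial>bar F = -l (\<omega>' - \<omega>)\<close>, and diagonalising \<open>\<omega>'\<close> with respect to \<open>\<omega>\<close> gives
  \<open>tr (\<omega>' - \<omega>) = \<Sum>\<^sub>j (\<mu>\<^sub>j - 1) \<ge> \<Sum>\<^sub>j log \<mu>\<^sub>j = F\<close>.  With \<open>G = max(0, F)\<^sup>2\<close> the form \<open>G d\<^sup>cF\<close> has
  nonnegative trace, so \<open>dF = 0\<close> where \<open>F > 0\<close>; hence \<open>d(G \<eta>) = G (\<omega>' - \<omega>)\<close>, whose trace is at least
  \<open>G F\<close>, and \<open>F \<le> 0\<close>.  By symmetry \<open>F = 0\<close>, so \<open>d\<eta>\<close> has nonnegative trace, all \<open>\<mu>\<^sub>j - 1 - log \<mu>\<^sub>j\<close> vanish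
  and \<open>\<omega>' = \<omega>\<close>.
\<close>

section \<open>Functions of class \<open>C\<^sup>k\<close>\<close>

text \<open>The trace of \<open>d\<eta>\<close> becomes a divergence through Liouville's theorem:
  the Hamiltonian field of each coordinate preserves the density
  \<open>sqrt \<bar>det W\<bar>\<close>, so that in the divergence of the dual field only
  derivatives of \<open>\<eta>\<close> survive.

  The obstacle is the case \<open>l = 0\<close>. There the trace of \<open>d d\<^sup>cF\<close> is
  zero, and \<open>F\<close> by itself is only forced to be locally constant; its value has to come
  from the cohomology class, and multiplying \<open>\<eta>\<close> by a function of \<open>F\<close>
  is what couples the two. Both steps are run for every \<open>l \<le> 0\<close>: a negative
  \<open>l\<close> merely adds a nonnegative term to the first trace.

  The estimate of the trace by \<open>F\<close> has a useful sign only where \<open>F > 0\<close>.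
  The weight must therefore vanish for \<open>F \<le> 0\<close>, it must be nonnegative and
  nondecreasing in \<open>F\<close>, so that the gradient term has a sign, and it must be of class
  C^1, so that products with it can be differentiated. The squared positive part has all of these
  properties, and its limited regularity is the reason for a divergence theorem about C^1
  forms.\<close>

lemma frechet_derivative_cong_open:
  assumes "open S" "x \<in> S" "\<And>y. y \<in> S \<Longrightarrow> f y = g y"
  shows "f differentiable at x \<longleftrightarrow> g differentiable at x"
    and "frechet_derivative f (at x) = frechet_derivative g (at x)"
proof -
  have "\<And>D. (f has_derivative D) (at x) \<longleftrightarrow> (g has_derivative D) (at x)"
    using assms by (metis has_derivative_transform_within_open)
  then show "f differentiable at x \<longleftrightarrow> g differentiable at x"
    and "frechet_derivative f (at x) = frechet_derivative g (at x)"
    by (simp_all add: differentiable_def frechet_derivative_def)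
qed

lemma Ck_on_cong:
  assumes "open S" "\<And>y. y \<in> S \<Longrightarrow> f y = g y"
  shows "Ck_on k f S \<longleftrightarrow> Ck_on k g S"
  using assms
proof (induction k arbitrary: f g)
  case 0
  then show ?case by (simp cong: continuous_on_cong)
next
  case (Suc k)
  have 1: "f differentiable at x \<longleftrightarrow> g differentiable at x"
          "frechet_derivative f (at x) = frechet_derivative g (at x)" if "x \<in> S" for x
    using frechet_derivative_cong_open[OF Suc.prems(1) that Suc.prems(2)] by auto
  have "Ck_on k (\<lambda>x. frechet_derivative f (at x) v) S \<longleftrightarrow> Ck_on k (\<lambda>x. frechet_derivative g (at x) v) S" for v
    by (rule Suc.IH[OF Suc.prems(1)]) (simp add: 1)
  then show ?case using 1 by auto
qed

lemma Ck_on_imp_continuous_on: "Ck_on k f S \<Longrightarrow> continuous_on S f"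
  by (cases k) (auto intro!: continuous_at_imp_continuous_on differentiable_imp_continuous_within)

lemma Ck_on_SucD: "Ck_on (Suc k) f S \<Longrightarrow> Ck_on k f S"
proof (induction k arbitrary: f)
  case 0
  then show ?case using Ck_on_imp_continuous_on[OF 0] by simp
next
  case (Suc k)
  then show ?case by simp
qed

lemma Ck_on_differentiable: "Ck_on (Suc k) f S \<Longrightarrow> x \<in> S \<Longrightarrow> f differentiable at x"
  by simp

lemma Ck_on_frechet: "Ck_on (Suc k) f S \<Longrightarrow> Ck_on k (\<lambda>x. frechet_derivative f (at x) v) S"
  by simp

text \<open>\<open>Ck_on\<close> speaks of \<open>frechet_derivative\<close>, while algebraic
  operations come with explicit derivative formulas. Uniqueness of derivatives on the open set lets
  such a formula take its place in the recursion.\<close>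

lemma Ck_on_SucI:
  assumes "open S" "\<And>x. x \<in> S \<Longrightarrow> (f has_derivative f' x) (at x)"
    and "\<And>v. Ck_on k (\<lambda>x. f' x v) S"
  shows "Ck_on (Suc k) f S"
proof -
  have "frechet_derivative f (at x) = f' x" if "x \<in> S" for x
    using assms(2)[OF that] frechet_derivative_at by metis
  then have "Ck_on k (\<lambda>x. frechet_derivative f (at x) v) S" for v
    using Ck_on_cong[OF assms(1), of "\<lambda>x. frechet_derivative f (at x) v" "\<lambda>x. f' x v"] assms(3) by auto
  then show ?thesis using assms(2) by (auto simp: differentiable_def)
qed

lemma Ck_on_has_derivative:
  "Ck_on (Suc k) f S \<Longrightarrow> x \<in> S \<Longrightarrow> (f has_derivative frechet_derivative f (at x)) (at x)"
  using frechet_derivative_works by auto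

lemma Ck_on_const: "open S \<Longrightarrow> Ck_on k (\<lambda>x. c) S"
proof (induction k arbitrary: c)
  case (Suc k)
  show ?case
    by (rule Ck_on_SucI[where f' = "\<lambda>x v. 0"]) (use Suc in auto)
qed auto

lemma Ck_on_bounded_linear:
  assumes "open S" "bounded_linear h" "Ck_on k f S"
  shows "Ck_on k (\<lambda>x. h (f x)) S"
  using assms(3)
proof (induction k arbitrary: f)
  case 0
  then show ?case using assms(2) by (auto intro: bounded_linear.continuous_on)
next
  case (Suc k)
  show ?case
  proof (rule Ck_on_SucI[OF assms(1), where f' = "\<lambda>x v. h (frechet_derivative f (at x) v)"])
    show "((\<lambda>x. h (f x)) has_derivative (\<lambda>v. h (frechet_derivative f (at x) v))) (at x)" if "x \<in> S" for x
      by (rule bounded_linear.has_derivative[OF assms(2) Ck_on_has_derivative[OF Suc.prems that]])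
    show "Ck_on k (\<lambda>x. h (frechet_derivative f (at x) v)) S" for v
      using Suc by simp
  qed
qed

lemma Ck_on_add:
  assumes "open S" "Ck_on k f S" "Ck_on k g S"
  shows "Ck_on k (\<lambda>x. f x + g x) S"
  using assms(2,3)
proof (induction k arbitrary: f g)
  case 0
  then show ?case by (auto intro: continuous_intros)
next
  case (Suc k)
  show ?case
  proof (rule Ck_on_SucI[OF assms(1), where
        f' = "\<lambda>x v. frechet_derivative f (at x) v + frechet_derivative g (at x) v"])
    show "((\<lambda>x. f x + g x) has_derivative
      (\<lambda>v. frechet_derivative f (at x) v + frechet_derivative g (at x) v)) (at x)" if "x \<in> S" for x
      by (intro has_derivative_add Ck_on_has_derivative[OF Suc.prems(1) that] Ck_on_has_derivative[OF Suc.prems(2) that])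
    show "Ck_on k (\<lambda>x. frechet_derivative f (at x) v + frechet_derivative g (at x) v) S" for v
      using Suc by simp
  qed
qed

lemma Ck_on_sum:
  assumes "open S" "\<And>i. i \<in> I \<Longrightarrow> Ck_on k (f i) S"
  shows "Ck_on k (\<lambda>x. \<Sum>i\<in>I. f i x) S"
  using assms(2)
  by (induction I rule: infinite_finite_induct)
    (auto simp: assms(1) Ck_on_const simp del: Ck_on.simps intro!: Ck_on_add)

lemma Ck_on_mult:
  fixes f g :: "'v::real_normed_vector \<Rightarrow> 'w::real_normed_algebra"
  assumes "open S" "Ck_on k f S" "Ck_on k g S"
  shows "Ck_on k (\<lambda>x. f x * g x) S"
  using assms(2,3)
proof (induction k arbitrary: f g)
  case 0
  then show ?case by (auto intro: continuous_intros)
next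
  case (Suc k)
  show ?case
  proof (rule Ck_on_SucI[OF assms(1), where
        f' = "\<lambda>x v. f x * frechet_derivative g (at x) v + frechet_derivative f (at x) v * g x"])
    show "((\<lambda>x. f x * g x) has_derivative
      (\<lambda>v. f x * frechet_derivative g (at x) v + frechet_derivative f (at x) v * g x)) (at x)" if "x \<in> S" for x
      by (intro has_derivative_mult Ck_on_has_derivative[OF Suc.prems(1) that] Ck_on_has_derivative[OF Suc.prems(2) that])
    show "Ck_on k (\<lambda>x. f x * frechet_derivative g (at x) v + frechet_derivative f (at x) v * g x) S" for v
      by (intro Ck_on_add Suc.IH Ck_on_frechet assms(1) Suc.prems Ck_on_SucD[OF Suc.prems(1)] Ck_on_SucD[OF Suc.prems(2)])
  qed
qed

lemma Ck_on_minus: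
  assumes "open S" "Ck_on k f S"
  shows "Ck_on k (\<lambda>x. - f x) S"
  using Ck_on_bounded_linear[OF assms(1) bounded_linear_minus[OF bounded_linear_ident] assms(2)] .

lemma Ck_on_diff:
  assumes "open S" "Ck_on k f S" "Ck_on k g S"
  shows "Ck_on k (\<lambda>x. f x - g x) S"
  using Ck_on_add[OF assms(1,2) Ck_on_minus[OF assms(1,3)]] by simp

lemma Ck_on_cmult:
  fixes f :: "'v::real_normed_vector \<Rightarrow> 'w::real_normed_algebra"
  assumes "open S" "Ck_on k f S"
  shows "Ck_on k (\<lambda>x. c * f x) S"
  by (rule Ck_on_mult[OF assms(1) Ck_on_const[OF assms(1)] assms(2)])

lemma Ck_on_prod:
  fixes f :: "'i \<Rightarrow> 'v::real_normed_vector \<Rightarrow> 'w::{real_normed_algebra,comm_ring_1}"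
  assumes "open S" "\<And>i. i \<in> I \<Longrightarrow> Ck_on k (f i) S"
  shows "Ck_on k (\<lambda>x. \<Prod>i\<in>I. f i x) S"
  using assms(2)
  by (induction I rule: infinite_finite_induct)
    (auto simp: assms(1) Ck_on_const simp del: Ck_on.simps intro!: Ck_on_mult)

lemma Ck_on_det:
  fixes M :: "'v::real_normed_vector \<Rightarrow> ('w::{real_normed_algebra,comm_ring_1}) ^ 'n ^ 'n"
  assumes "open S" "\<And>i j. Ck_on k (\<lambda>x. M x $ i $ j) S"
  shows "Ck_on k (\<lambda>x. det (M x)) S"
  unfolding det_def by (intro Ck_on_sum Ck_on_cmult Ck_on_prod assms)

text \<open>Regularity of the outer derivative is asked only after composition with
  \<open>f\<close>. In this form the rule feeds inductions in which \<open>g'\<close> is built from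
  \<open>g\<close> itself, as for \<open>inverse\<close>, and it covers outer functions of limited
  regularity such as the squared positive part.\<close>

lemma Ck_on_compose_real:
  fixes f :: "'v::real_normed_vector \<Rightarrow> real"
  assumes "open S" "\<And>x. x \<in> S \<Longrightarrow> (g has_real_derivative g' (f x)) (at (f x))"
    and "Ck_on (Suc k) f S" "Ck_on k (\<lambda>x. g' (f x)) S"
  shows "Ck_on (Suc k) (\<lambda>x. g (f x)) S"
proof (rule Ck_on_SucI[OF assms(1), where f' = "\<lambda>x v. g' (f x) * frechet_derivative f (at x) v"])
  show "((\<lambda>x. g (f x)) has_derivative (\<lambda>v. g' (f x) * frechet_derivative f (at x) v)) (at x)"
    if "x \<in> S" for x
    using has_derivative_compose[OF Ck_on_has_derivative[OF assms(3) that]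
        assms(2)[OF that, unfolded has_field_derivative_def]] by simp
  show "Ck_on k (\<lambda>x. g' (f x) * frechet_derivative f (at x) v) S" for v
    by (intro Ck_on_mult assms(1,4) Ck_on_frechet[OF assms(3)])
qed

lemma Ck_on_inverse:
  fixes f :: "'v::real_normed_vector \<Rightarrow> real"
  assumes "open S" "Ck_on k f S" "\<And>x. x \<in> S \<Longrightarrow> f x \<noteq> 0"
  shows "Ck_on k (\<lambda>x. inverse (f x)) S"
  using assms(2)
proof (induction k)
  case 0
  then show ?case using assms(3) by (auto intro: continuous_intros)
next
  case (Suc k)
  show ?case
  proof (rule Ck_on_compose_real[OF assms(1), where f = f and g = inverse and g' = "\<lambda>y. - (inverse y * inverse y)"])
    show "(inverse has_real_derivative - (inverse (f x) * inverse (f x))) (at (f x))" if "x \<in> S" for x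
      using DERIV_inverse[OF assms(3)[OF that]] by (simp only: power2_eq_square numeral_2_eq_2[symmetric])
    show "Ck_on k (\<lambda>x. - (inverse (f x) * inverse (f x))) S"
      by (intro Ck_on_minus Ck_on_mult assms(1) Suc.IH[OF Ck_on_SucD[OF Suc.prems]])
  qed (rule Suc.prems)
qed

lemma Ck_on_ln:
  fixes f :: "'v::real_normed_vector \<Rightarrow> real"
  assumes "open S" "Ck_on k f S" "\<And>x. x \<in> S \<Longrightarrow> f x > 0"
  shows "Ck_on k (\<lambda>x. ln (f x)) S"
proof (cases k)
  case 0
  then show ?thesis using assms by (fastforce intro!: continuous_intros)
next
  case (Suc l)
  show ?thesis unfolding Suc
  proof (rule Ck_on_compose_real[OF assms(1), where f = f and g = ln and g' = inverse])
    show "(ln has_real_derivative inverse (f x)) (at (f x))" if "x \<in> S" for x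
      using DERIV_ln assms(3) that by blast
    show "Ck_on l (\<lambda>x. inverse (f x)) S"
      using Ck_on_inverse[OF assms(1) Ck_on_SucD[OF assms(2)[unfolded Suc]]] assms(3) by force
  qed (use assms Suc in simp)
qed

lemma Ck_on_compose_linear:
  fixes L :: "'u::real_normed_vector \<Rightarrow> 'v::real_normed_vector"
  assumes "open S" "open T" "bounded_linear L" "L ` T \<subseteq> S" "Ck_on k f S"
  shows "Ck_on k (\<lambda>x. f (L x)) T"
  using assms(5)
proof (induction k arbitrary: f)
  case 0
  then show ?case
    using assms(3,4) continuous_on_compose2[OF _ linear_continuous_on[OF assms(3)]] by fastforce
next
  case (Suc k)
  show ?case
  proof (rule Ck_on_SucI[OF assms(2), where f' = "\<lambda>x v. frechet_derivative f (at (L x)) (L v)"])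
    fix x assume "x \<in> T"
    then have "L x \<in> S" using assms(4) by auto
    then show "((\<lambda>x. f (L x)) has_derivative (\<lambda>v. frechet_derivative f (at (L x)) (L v))) (at x)"
      using has_derivative_compose[OF bounded_linear_imp_has_derivative[OF assms(3)]
          Ck_on_has_derivative[OF Suc.prems]] by simp
  next
    show "Ck_on k (\<lambda>x. frechet_derivative f (at (L x)) (L v)) T" for v
      using Suc.IH[of "\<lambda>y. frechet_derivative f (at y) (L v)"] Suc.prems by simp
  qed
qed

text \<open>Linearity in \<open>v\<close> holds at all points near \<open>z\<close> and so survives
  differentiation in the base point; linearity in \<open>u\<close> is that of a derivative. Applied
  to a one-form and, with \<open>h\<close> a first derivative, to the Hessian.\<close>

lemma bilinear_frechet_derivative:
  fixes h :: "'v::real_normed_vector \<Rightarrow> 'v \<Rightarrow> real"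
  assumes "open S" "z \<in> S" "\<And>y. y \<in> S \<Longrightarrow> linear (h y)" "\<And>v. (\<lambda>y. h y v) differentiable at z"
  shows "bilinear (\<lambda>u v. frechet_derivative (\<lambda>y. h y v) (at z) u)"
proof -
  note der = assms(4)[THEN frechet_derivative_works[THEN iffD1]]
  let ?d = "\<lambda>u v. frechet_derivative (\<lambda>y. h y v) (at z) u"
  have "?d u (v + v') = ?d u v + ?d u v'" for u v v'
  proof -
    have "((\<lambda>y. h y (v + v')) has_derivative (\<lambda>u. ?d u v + ?d u v')) (at z)"
      by (rule has_derivative_transform_within_open[OF has_derivative_add[OF der der] assms(1,2)])
        (simp add: linear_add assms(3))
    from fun_cong[OF frechet_derivative_at[OF this], of u] show ?thesis by simp
  qed
  moreover have "?d u (r *\<^sub>R v) = r *\<^sub>R ?d u v" for u v r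
  proof -
    have "((\<lambda>y. h y (r *\<^sub>R v)) has_derivative (\<lambda>u. r * ?d u v)) (at z)"
      by (rule has_derivative_transform_within_open[OF has_derivative_mult_right[OF der] assms(1,2)])
        (simp add: linear_scale assms(3))
    from fun_cong[OF frechet_derivative_at[OF this], of u] show ?thesis by simp
  qed
  moreover have "linear (\<lambda>u. ?d u v)" for v by (rule has_derivative_linear[OF der])
  ultimately show ?thesis unfolding bilinear_def by (auto intro: linearI)
qed

section \<open>The symplectic divergence identity\<close>

text \<open>A permutation other than the identity moves at least two indices. Deleting one factor
  from its product therefore leaves another off-diagonal entry of the unit matrix, so only the
  identity permutation contributes.\<close>

lemma has_derivative_det_at_one:
  fixes N :: "'v::real_normed_vector \<Rightarrow> real ^ 'n ^ 'n"
  assumes "\<And>i j. ((\<lambda>x. N x $ i $ j) has_derivative (\<lambda>v. N' v $ i $ j)) (at x)" and "N x = mat 1"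
  shows "((\<lambda>x. det (N x)) has_derivative (\<lambda>v. trace (N' v))) (at x)"
proof -
  let ?D = "\<lambda>v. \<Sum>p | p permutes (UNIV::'n set). of_int (sign p) *
      (\<Sum>i\<in>UNIV. N' v $ i $ p i * (\<Prod>j\<in>UNIV - {i}. N x $ j $ p j))"
  have D: "((\<lambda>x. det (N x)) has_derivative ?D) (at x)"
    unfolding det_def
    by (intro has_derivative_sum has_derivative_mult_right has_derivative_prod assms(1))
  have "(\<Sum>i\<in>UNIV. N' v $ i $ p i * (\<Prod>j\<in>UNIV - {i}. N x $ j $ p j)) = (if p = id then trace (N' v) else 0)"
    if "p permutes UNIV" for p v
  proof (cases "p = id")
    case True
    then show ?thesis by (simp add: assms(2) mat_def trace_def)
  next
    case False
    have "(\<Prod>j\<in>UNIV - {i}. N x $ j $ p j) = 0" for i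
    proof -
      obtain k where k: "p k \<noteq> k" using False by (metis eq_id_iff)
      have "inj p" using that permutes_inj by auto
      then have "p (p k) \<noteq> p k" using k by (metis injD)
      then obtain j where "j \<noteq> i" "p j \<noteq> j" using k by metis
      then show ?thesis
        by (intro prod_zero bexI[of _ j]) (auto simp: assms(2) mat_def)
    qed
    then show ?thesis using False by (simp only: mult_zero_right sum.neutral_const if_False)
  qed
  then have "?D v = (\<Sum>p | p permutes (UNIV::'n set). if p = id then trace (N' v) else 0)" for v
    by (intro sum.cong) auto
  also have "\<dots> v = trace (N' v)" for v
    by (simp add: sum.delta permutes_id finite_permutations)
  finally show ?thesis using D by presburger
qed

text \<open>Jacobi's formula, reduced to the unit matrix by the constant left factor
  \<open>Q\<close>: \<open>det (M y) = det (M x) * det (Q ** M y)\<close>.\<close>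

lemma has_derivative_det:
  fixes M :: "'v::real_normed_vector \<Rightarrow> real ^ 'n ^ 'n"
  assumes "\<And>i j. ((\<lambda>x. M x $ i $ j) has_derivative (\<lambda>v. M' v $ i $ j)) (at x)"
    and "Q ** M x = mat 1"
  shows "((\<lambda>x. det (M x)) has_derivative (\<lambda>v. det (M x) * trace (Q ** M' v))) (at x)"
proof -
  have "det Q * det (M x) = 1"
    using assms(2) by (metis det_I det_mul)
  then have "det (M y) = det (M x) * det (Q ** M y)" for y
    by (simp add: det_mul algebra_simps)
  then have eq: "(\<lambda>y. det (M y)) = (\<lambda>y. det (M x) * det (Q ** M y))" by blast
  have "((\<lambda>x. det (Q ** M x)) has_derivative (\<lambda>v. trace (Q ** M' v))) (at x)"
    by (rule has_derivative_det_at_one)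
      (auto simp: matrix_matrix_mult_def assms(2)[unfolded matrix_matrix_mult_def]
        intro!: has_derivative_sum has_derivative_mult_right assms(1))
  from has_derivative_mult_right[OF this, of "det (M x)"] show ?thesis
    unfolding eq[symmetric] .
qed

text \<open>Here \<open>w a b c\<close> stands for the derivative of \<open>W $ b $ c\<close> in
  direction \<open>a\<close>, and \<open>Q\<close> for the inverse of \<open>W\<close>. Divided by
  the density, the divergence of column \<open>b\<close> of density times \<open>Q\<close> has one
  part from the square root of the determinant and one from the inverse; closedness makes them
  cancel.\<close>

lemma closed_form_inverse_divergence:
  fixes Q :: "real ^ 'm ^ 'm" and w :: "'m::finite \<Rightarrow> 'm \<Rightarrow> 'm \<Rightarrow> real"
  assumes Q: "\<And>a b. Q $ a $ b = - Q $ b $ a"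
    and anti: "\<And>a b c. w a b c = - w a c b"
    and cyc: "\<And>a b c. w a b c + w b c a + w c a b = 0"
  shows "(\<Sum>a\<in>UNIV. (\<Sum>d\<in>UNIV. \<Sum>c\<in>UNIV. Q $ d $ c * w a c d) / 2 * Q $ a $ b
            - (\<Sum>c\<in>UNIV. \<Sum>d\<in>UNIV. Q $ a $ c * w a c d * Q $ d $ b)) = 0"
proof -
  \<comment> \<open>Contraction of \<open>Q\<close> with the first two indices of \<open>w\<close>.
    Antisymmetrising and using \<open>cyc\<close> moves the differentiated index out of the
    contraction, which yields the relation \<open>R\<close>; the factor 2 there cancels the 1/2 that
    stems from the square root.\<close>
  define S where "S d = (\<Sum>a\<in>UNIV. \<Sum>c\<in>UNIV. Q $ a $ c * w a c d)" for d
  have S2: "S d = - (\<Sum>a\<in>UNIV. \<Sum>c\<in>UNIV. Q $ a $ c * w c a d)" for d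
    unfolding S_def by (subst sum.swap) (subst Q, simp add: sum_negf)
  have "2 * S d = (\<Sum>a\<in>UNIV. \<Sum>c\<in>UNIV. Q $ a $ c * (w a c d - w c a d))" for d
    using S2[of d] unfolding S_def by (simp add: sum_subtractf algebra_simps)
  also have "\<dots> d = (\<Sum>a\<in>UNIV. \<Sum>c\<in>UNIV. Q $ a $ c * (- w d a c))" for d
    by (intro sum.cong refl arg_cong2[where f = "(*)"]) (use anti cyc in \<open>smt (verit)\<close>)
  also have "\<dots> d = (\<Sum>a\<in>UNIV. \<Sum>c\<in>UNIV. Q $ c $ a * w d a c)" for d
    by (intro sum.cong refl) (subst Q, simp)
  finally have R: "(\<Sum>d'\<in>UNIV. \<Sum>c\<in>UNIV. Q $ d' $ c * w a c d') = 2 * S a" for a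
    by (subst sum.swap) simp
  have "(\<Sum>a\<in>UNIV. \<Sum>c\<in>UNIV. \<Sum>d\<in>UNIV. Q $ a $ c * w a c d * Q $ d $ b)
      = (\<Sum>d\<in>UNIV. \<Sum>a\<in>UNIV. \<Sum>c\<in>UNIV. Q $ a $ c * w a c d * Q $ d $ b)"
  proof -
    have "(\<Sum>a\<in>UNIV. \<Sum>c\<in>UNIV. \<Sum>d\<in>UNIV. Q $ a $ c * w a c d * Q $ d $ b)
      = (\<Sum>a\<in>UNIV. \<Sum>d\<in>UNIV. \<Sum>c\<in>UNIV. Q $ a $ c * w a c d * Q $ d $ b)"
      by (intro sum.cong refl sum.swap)
    then show ?thesis by (simp only: sum.swap[of "\<lambda>a d. \<Sum>c\<in>UNIV. Q $ a $ c * w a c d * Q $ d $ b"])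
  qed
  also have "\<dots> = (\<Sum>d\<in>UNIV. S d * Q $ d $ b)"
    unfolding S_def by (simp add: sum_distrib_right)
  finally show ?thesis by (simp add: sum_subtractf R)
qed

lemma matrix_mul_neg:
  fixes A :: "real ^ 'm ^ 'm"
  shows "A ** (- B) = - (A ** B)" "(- A) ** B = - (A ** B)"
  by (simp_all add: matrix_matrix_mult_def vec_eq_iff sum_negf)

lemma matrix_inv_props:
  fixes W :: "real ^ 'm ^ 'm"
  assumes "det W \<noteq> 0"
  shows "W ** matrix_inv W = mat 1" "matrix_inv W ** W = mat 1"
proof -
  have "\<exists>A'. W ** A' = mat 1 \<and> A' ** W = mat 1"
    using assms invertible_det_nz[of W] unfolding invertible_def by blast
  from someI_ex[OF this] show "W ** matrix_inv W = mat 1" "matrix_inv W ** W = mat 1"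
    unfolding matrix_inv_def by auto
qed

lemma matrix_inv_antisym:
  fixes W :: "real ^ 'm ^ 'm"
  assumes "det W \<noteq> 0" "\<And>a b. W $ a $ b = - W $ b $ a"
  shows "matrix_inv W $ a $ b = - matrix_inv W $ b $ a"
proof -
  let ?Q = "matrix_inv W"
  have "transpose W = - W"
    unfolding vec_eq_iff transpose_def vec_lambda_beta uminus_vec_def using assms(2) by blast
  moreover have "transpose ?Q ** transpose W = mat 1"
    using arg_cong[OF matrix_inv_props(1)[OF assms(1)], of transpose]
    by (simp only: matrix_transpose_mul transpose_mat)
  ultimately have "- (transpose ?Q ** W) = mat 1" by (simp add: matrix_mul_neg)
  then have 1: "transpose ?Q ** W = - mat 1" by (metis minus_minus)
  have "transpose ?Q = transpose ?Q ** (W ** ?Q)" by (simp add: matrix_inv_props assms(1))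
  also have "\<dots> = - ?Q" unfolding matrix_mul_assoc 1 by (simp add: matrix_mul_neg)
  finally have "transpose ?Q $ b $ a = (- ?Q) $ b $ a" by simp
  then show ?thesis by (simp add: transpose_def)
qed

text \<open>By Cramer's rule each entry of the inverse is a quotient of determinants:
  \<open>?C x\<close> is \<open>W x\<close> with column \<open>a\<close> replaced by basis vector
  \<open>b\<close>.\<close>

lemma Ck_on_matrix_inv:
  fixes W :: "'v::real_normed_vector \<Rightarrow> real ^ 'm ^ 'm"
  assumes "open S" "\<And>a b. Ck_on k (\<lambda>x. W x $ a $ b) S" "\<And>x. x \<in> S \<Longrightarrow> det (W x) \<noteq> 0"
  shows "Ck_on k (\<lambda>x. matrix_inv (W x) $ a $ b) S"
proof -
  let ?C = "\<lambda>x. \<chi> i j. if j = a then (axis b 1 :: real ^ 'm) $ i else W x $ i $ j"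
  have "matrix_inv (W x) $ a $ b = det (?C x) * inverse (det (W x))" if "x \<in> S" for x
  proof -
    have "W x *v (matrix_inv (W x) *v axis b 1) = axis b 1"
      using matrix_inv_props[OF assms(3)[OF that]]
      by (simp add: matrix_vector_mul_assoc)
    then have "matrix_inv (W x) *v axis b 1 = (\<chi> k. det (\<chi> i j. if j = k then (axis b 1 :: real ^ 'm) $ i else W x $ i $ j) / det (W x))"
      using cramer[OF assms(3)[OF that]] by blast
    moreover have "(matrix_inv (W x) *v axis b 1) $ a = matrix_inv (W x) $ a $ b"
      by (simp add: matrix_vector_mult_basis column_def)
    ultimately show ?thesis by (simp add: field_simps)
  qed
  moreover have "Ck_on k (\<lambda>x. det (?C x) * inverse (det (W x))) S"
  proof (intro Ck_on_mult Ck_on_inverse Ck_on_det assms)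
    show "Ck_on k (\<lambda>x. ?C x $ i $ j) S" for i j
      by (cases "j = a") (simp_all add: Ck_on_const assms)
  qed
  ultimately show ?thesis
    using Ck_on_cong[OF assms(1), of "\<lambda>x. matrix_inv (W x) $ a $ b" "\<lambda>x. det (?C x) * inverse (det (W x))"] by blast
qed

text \<open>The closed form is the same for both signs of \<open>y\<close>, and its denominator
  cancels against the factor \<open>det (W x)\<close> in Jacobi's formula.\<close>

lemma DERIV_sqrt_abs:
  assumes "y \<noteq> 0"
  shows "((\<lambda>y. sqrt \<bar>y\<bar>) has_real_derivative sqrt \<bar>y\<bar> / (2 * y)) (at y)"
proof (cases "y > 0")
  case True
  have "(sqrt has_real_derivative sqrt \<bar>y\<bar> / (2 * y)) (at y)"
  proof (rule DERIV_cong[OF DERIV_real_sqrt[OF True]])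
    show "inverse (sqrt y) / 2 = sqrt \<bar>y\<bar> / (2 * y)"
      using True real_sqrt_mult_self[of y] by (simp add: field_simps)
  qed
  then show ?thesis
    by (rule has_field_derivative_transform_within_open[where S = "{0<..}"]) (use True in auto)
next
  case False
  then have y: "y < 0" using assms by simp
  have "((\<lambda>y. sqrt (- y)) has_real_derivative (inverse (sqrt (- y)) / 2) * (-1)) (at y)"
    by (rule DERIV_chain'[where f = uminus]) (use y DERIV_real_sqrt[of "-y"] in \<open>auto intro!: derivative_eq_intros\<close>)
  moreover have "(inverse (sqrt (- y)) / 2) * (-1) = sqrt \<bar>y\<bar> / (2 * y)"
    using y real_sqrt_mult_self[of "-y"] by (simp add: field_simps)
  ultimately have "((\<lambda>y. sqrt (- y)) has_real_derivative sqrt \<bar>y\<bar> / (2 * y)) (at y)" by simp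
  then show ?thesis
    by (rule has_field_derivative_transform_within_open[where S = "{..<0}"]) (use y in auto)
qed

section \<open>Symplectic forms in real coordinates\<close>

locale closed_nondegenerate =
  fixes S :: "(real ^ 'm) set" and W :: "real ^ 'm \<Rightarrow> real ^ 'm ^ 'm"
  assumes open_S: "open S"
    and W_C1: "\<And>a b. Ck_on 1 (\<lambda>x. W x $ a $ b) S"
    and W_anti: "\<And>x a b. x \<in> S \<Longrightarrow> W x $ a $ b = - W x $ b $ a"
    and W_nondeg: "\<And>x. x \<in> S \<Longrightarrow> det (W x) \<noteq> 0"
    and W_closed: "\<And>x a b c. x \<in> S \<Longrightarrow>
      frechet_derivative (\<lambda>x. W x $ b $ c) (at x) (axis a 1)
      + frechet_derivative (\<lambda>x. W x $ c $ a) (at x) (axis b 1)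
      + frechet_derivative (\<lambda>x. W x $ a $ b) (at x) (axis c 1) = 0"
begin

text \<open>On \<open>S\<close> this is, up to sign, the Pfaffian of \<open>W x\<close>, that is,
  the Liouville density of the symplectic form.\<close>

definition dens :: "real ^ 'm \<Rightarrow> real" where "dens x = sqrt \<bar>det (W x)\<bar>"

definition Q :: "real ^ 'm \<Rightarrow> real ^ 'm ^ 'm" where "Q x = matrix_inv (W x)"

lemma W_Suc: "Ck_on (Suc 0) (\<lambda>x. W x $ a $ b) S"
  using W_C1 by simp

lemma Q_C1: "Ck_on (Suc 0) (\<lambda>x. Q x $ a $ b) S"
  unfolding Q_def by (rule Ck_on_matrix_inv[OF open_S W_Suc W_nondeg])

lemma dens_C1: "Ck_on (Suc 0) dens S"
proof -
  have c: "continuous_on S (\<lambda>x. det (W x))"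
    by (rule Ck_on_imp_continuous_on[OF Ck_on_det[OF open_S W_Suc]])
  have "Ck_on (Suc 0) (\<lambda>x. sqrt \<bar>det (W x)\<bar>) S"
    by (rule Ck_on_compose_real[OF open_S DERIV_sqrt_abs[OF W_nondeg] Ck_on_det[OF open_S W_Suc]])
      (auto intro!: continuous_intros c simp: W_nondeg)
  then show ?thesis by (simp add: dens_def[abs_def])
qed

definition W' :: "real ^ 'm \<Rightarrow> real ^ 'm \<Rightarrow> real ^ 'm ^ 'm" where
  "W' x v = (\<chi> a b. frechet_derivative (\<lambda>x. W x $ a $ b) (at x) v)"

lemma dens_derivative:
  assumes "x \<in> S"
  shows "(dens has_derivative (\<lambda>v. dens x / 2 * trace (Q x ** W' x v))) (at x)"
proof -
  have "((\<lambda>x. det (W x)) has_derivative (\<lambda>v. det (W x) * trace (Q x ** W' x v))) (at x)"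
    by (rule has_derivative_det)
      (use Ck_on_has_derivative[OF W_Suc assms] matrix_inv_props(2)[OF W_nondeg[OF assms]]
        in \<open>auto simp: W'_def Q_def\<close>)
  from has_derivative_compose[OF this DERIV_sqrt_abs[OF W_nondeg[OF assms], unfolded has_field_derivative_def]]
  have "((\<lambda>x. sqrt \<bar>det (W x)\<bar>) has_derivative
     (\<lambda>v. sqrt \<bar>det (W x)\<bar> / (2 * det (W x)) * (det (W x) * trace (Q x ** W' x v)))) (at x)" by simp
  then show ?thesis using W_nondeg[OF assms] by (simp add: dens_def[abs_def])
qed

text \<open>Read off from the vanishing derivative of the constant \<open>W x ** Q x\<close>,
  multiplied by \<open>Q x\<close> on the left.\<close>

lemma Q_derivative:
  assumes "x \<in> S"
  shows "frechet_derivative (\<lambda>x. Q x $ a $ b) (at x) v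
    = - (\<Sum>c\<in>UNIV. \<Sum>d\<in>UNIV. Q x $ a $ c * W' x v $ c $ d * Q x $ d $ b)"
proof -
  define Q' where "Q' = (\<chi> a b. frechet_derivative (\<lambda>x. Q x $ a $ b) (at x) v)"
  have "(W' x v ** Q x) $ c $ b + (W x ** Q') $ c $ b = 0" for c b
  proof -
    have "((\<lambda>x. \<Sum>d\<in>UNIV. W x $ c $ d * Q x $ d $ b) has_derivative
        (\<lambda>v. \<Sum>d\<in>UNIV. W x $ c $ d * frechet_derivative (\<lambda>x. Q x $ d $ b) (at x) v
             + frechet_derivative (\<lambda>x. W x $ c $ d) (at x) v * Q x $ d $ b)) (at x)"
      by (intro has_derivative_sum has_derivative_mult Ck_on_has_derivative[OF W_Suc assms]
          Ck_on_has_derivative[OF Q_C1 assms])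
    moreover have "((\<lambda>x. \<Sum>d\<in>UNIV. W x $ c $ d * Q x $ d $ b) has_derivative (\<lambda>v. 0)) (at x)"
    proof (rule has_derivative_transform_within_open[OF has_derivative_const open_S assms])
      show "(mat 1 :: real ^ 'm ^ 'm) $ c $ b = (\<Sum>d\<in>UNIV. W y $ c $ d * Q y $ d $ b)" if "y \<in> S" for y
        using matrix_inv_props(1)[OF W_nondeg[OF that]]
        by (simp add: vec_eq_iff matrix_matrix_mult_def Q_def)
    qed
    ultimately have "(\<lambda>v. \<Sum>d\<in>UNIV. W x $ c $ d * frechet_derivative (\<lambda>x. Q x $ d $ b) (at x) v
             + frechet_derivative (\<lambda>x. W x $ c $ d) (at x) v * Q x $ d $ b) = (\<lambda>v. 0)"
      by (rule has_derivative_unique)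
    from fun_cong[OF this, of v] show ?thesis
      by (simp add: matrix_matrix_mult_def W'_def Q'_def sum.distrib)
  qed
  then have "W' x v ** Q x + W x ** Q' = 0" by (simp add: vec_eq_iff)
  then have "W x ** Q' = - (W' x v ** Q x)" by (metis add_eq_0_iff)
  then have "Q x ** (W x ** Q') = - (Q x ** (W' x v ** Q x))" by (simp add: matrix_mul_neg)
  then have "Q' = - (Q x ** (W' x v ** Q x))"
    using matrix_inv_props(2)[OF W_nondeg[OF assms]] by (simp add: matrix_mul_assoc Q_def)
  then have "Q' $ a $ b = - (Q x ** (W' x v ** Q x)) $ a $ b" by simp
  then show ?thesis
    by (simp add: Q'_def matrix_matrix_mult_def sum_distrib_left mult.assoc)
qed

lemma Q_anti: "x \<in> S \<Longrightarrow> Q x $ a $ b = - Q x $ b $ a"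
  unfolding Q_def by (rule matrix_inv_antisym[OF W_nondeg W_anti])

text \<open>Liouville's theorem for the coordinate function \<open>b\<close>: its Hamiltonian field
  is, up to sign, column \<open>b\<close> of \<open>Q\<close>, and Hamiltonian flows preserve the
  Liouville density.\<close>

lemma dens_Q_divergence_free:
  assumes x: "x \<in> S"
  shows "(\<Sum>a\<in>UNIV. frechet_derivative (\<lambda>x. dens x * Q x $ a $ b) (at x) (axis a 1)) = 0"
proof -
  define w where "w a b c = W' x (axis a 1) $ b $ c" for a b c
  have anti: "w a b c = - w a c b" for a b c
  proof -
    have "((\<lambda>x. - W x $ c $ b) has_derivative (\<lambda>v. - frechet_derivative (\<lambda>x. W x $ c $ b) (at x) v)) (at x)"
      by (intro has_derivative_minus Ck_on_has_derivative[OF W_Suc x])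
    then have "((\<lambda>x. W x $ b $ c) has_derivative (\<lambda>v. - frechet_derivative (\<lambda>x. W x $ c $ b) (at x) v)) (at x)"
      by (rule has_derivative_transform_within_open[OF _ open_S x]) (rule W_anti[symmetric])
    from frechet_derivative_at[OF this] show ?thesis
      unfolding w_def W'_def by (metis (no_types, lifting) vec_lambda_beta)
  qed
  have cyc: "w a b c + w b c a + w c a b = 0" for a b c
    using W_closed[OF x, of b c a] by (simp add: w_def W'_def)
  have "frechet_derivative (\<lambda>x. dens x * Q x $ a $ b) (at x) (axis a 1)
     = dens x * ((\<Sum>d\<in>UNIV. \<Sum>c\<in>UNIV. Q x $ d $ c * w a c d) / 2 * Q x $ a $ b
          - (\<Sum>c\<in>UNIV. \<Sum>d\<in>UNIV. Q x $ a $ c * w a c d * Q x $ d $ b))" for a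
  proof -
    have "((\<lambda>x. dens x * Q x $ a $ b) has_derivative
      (\<lambda>v. dens x * frechet_derivative (\<lambda>x. Q x $ a $ b) (at x) v
        + (dens x / 2 * trace (Q x ** W' x v)) * Q x $ a $ b)) (at x)"
      by (intro has_derivative_mult dens_derivative x Ck_on_has_derivative[OF Q_C1 x])
    from frechet_derivative_at[OF this, symmetric] show ?thesis
      by (simp add: Q_derivative[OF x] trace_def matrix_matrix_mult_def w_def algebra_simps)
  qed
  then show ?thesis
    using closed_form_inverse_divergence[of "Q x" w b, OF Q_anti[OF x] anti cyc]
    by (simp add: sum_distrib_left[symmetric])
qed

text \<open>By \<open>dens_Q_divergence_free\<close> the product rule leaves only derivatives of
  \<open>\<eta>\<close>. As \<open>Q\<close> is antisymmetric, the remaining double sum depends on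
  \<open>d\<eta>\<close> alone.\<close>

lemma divergence_formula:
  fixes \<eta> :: "real ^ 'm \<Rightarrow> real ^ 'm"
  assumes "\<And>b. Ck_on 1 (\<lambda>x. \<eta> x $ b) S"
  shows "Ck_on 1 (\<lambda>x. dens x * (Q x *v \<eta> x) $ a) S"
    and "x \<in> S \<Longrightarrow> (\<Sum>a\<in>UNIV. frechet_derivative (\<lambda>x. dens x * (Q x *v \<eta> x) $ a) (at x) (axis a 1))
       = dens x * (\<Sum>a\<in>UNIV. \<Sum>b\<in>UNIV. Q x $ a $ b * frechet_derivative (\<lambda>x. \<eta> x $ b) (at x) (axis a 1))"
proof -
  have \<eta>: "Ck_on (Suc 0) (\<lambda>x. \<eta> x $ b) S" for b using assms by simp
  have eq: "(\<lambda>x. dens x * (Q x *v \<eta> x) $ a) = (\<lambda>x. \<Sum>b\<in>UNIV. dens x * Q x $ a $ b * \<eta> x $ b)" for a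
    by (simp add: matrix_vector_mult_def sum_distrib_left mult.assoc)
  have PQ: "Ck_on (Suc 0) (\<lambda>x. dens x * Q x $ a $ b) S" for a b
    by (intro Ck_on_mult open_S dens_C1 Q_C1)
  have "Ck_on (Suc 0) (\<lambda>x. dens x * (Q x *v \<eta> x) $ a) S"
    unfolding eq by (intro Ck_on_sum Ck_on_mult[OF open_S PQ \<eta>] open_S)
  then show "Ck_on 1 (\<lambda>x. dens x * (Q x *v \<eta> x) $ a) S" by simp
  assume x: "x \<in> S"
  have "frechet_derivative (\<lambda>x. dens x * (Q x *v \<eta> x) $ a) (at x) (axis a 1)
    = (\<Sum>b\<in>UNIV. dens x * Q x $ a $ b * frechet_derivative (\<lambda>x. \<eta> x $ b) (at x) (axis a 1)
       + frechet_derivative (\<lambda>x. dens x * Q x $ a $ b) (at x) (axis a 1) * \<eta> x $ b)" for a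
  proof -
    have "((\<lambda>x. \<Sum>b\<in>UNIV. dens x * Q x $ a $ b * \<eta> x $ b) has_derivative
      (\<lambda>v. \<Sum>b\<in>UNIV. dens x * Q x $ a $ b * frechet_derivative (\<lambda>x. \<eta> x $ b) (at x) v
       + frechet_derivative (\<lambda>x. dens x * Q x $ a $ b) (at x) v * \<eta> x $ b)) (at x)"
      by (intro has_derivative_sum has_derivative_mult Ck_on_has_derivative[OF PQ x] Ck_on_has_derivative[OF \<eta> x])
    from frechet_derivative_at[OF this, symmetric] show ?thesis
      unfolding eq by simp
  qed
  then have "(\<Sum>a\<in>UNIV. frechet_derivative (\<lambda>x. dens x * (Q x *v \<eta> x) $ a) (at x) (axis a 1))
    = (\<Sum>a\<in>UNIV. \<Sum>b\<in>UNIV. dens x * Q x $ a $ b * frechet_derivative (\<lambda>x. \<eta> x $ b) (at x) (axis a 1))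
     + (\<Sum>a\<in>UNIV. \<Sum>b\<in>UNIV. frechet_derivative (\<lambda>x. dens x * Q x $ a $ b) (at x) (axis a 1) * \<eta> x $ b)"
    by (simp add: sum.distrib)
  also have "(\<Sum>a\<in>UNIV. \<Sum>b\<in>UNIV. frechet_derivative (\<lambda>x. dens x * Q x $ a $ b) (at x) (axis a 1) * \<eta> x $ b)
    = (\<Sum>b\<in>UNIV. (\<Sum>a\<in>UNIV. frechet_derivative (\<lambda>x. dens x * Q x $ a $ b) (at x) (axis a 1)) * \<eta> x $ b)"
    by (subst sum.swap) (simp add: sum_distrib_right)
  also have "\<dots> = 0" using dens_Q_divergence_free[OF x] by simp
  finally show "(\<Sum>a\<in>UNIV. frechet_derivative (\<lambda>x. dens x * (Q x *v \<eta> x) $ a) (at x) (axis a 1))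
       = dens x * (\<Sum>a\<in>UNIV. \<Sum>b\<in>UNIV. Q x $ a $ b * frechet_derivative (\<lambda>x. \<eta> x $ b) (at x) (axis a 1))"
    by (simp add: sum_distrib_left mult.assoc)
qed

end

section \<open>Integration in coordinates\<close>

text \<open>Difference quotients have integral zero by translation invariance. The mean value
  theorem bounds them by \<open>B\<close>, so dominated convergence carries the zero over to the
  derivative. Boundedness of the derivative is what \<open>tame\<close> functions will
  provide.\<close>

lemma integral_derivative_compact_support:
  fixes f :: "'a::euclidean_space \<Rightarrow> real"
  assumes der: "\<And>x. (f has_derivative f' x) (at x)"
    and K: "compact K" "\<And>x. x \<notin> K \<Longrightarrow> f x = 0"
    and B: "\<And>x. \<bar>f' x v\<bar> \<le> B"
  shows "integrable lborel (\<lambda>x. f' x v)" "integral\<^sup>L lborel (\<lambda>x. f' x v) = 0"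
proof -
  define g where "g n x = (f (x + (1 / real (Suc n)) *\<^sub>R v) - f x) * real (Suc n)" for n x
  have cont: "continuous_on UNIV f"
    using der by (intro continuous_at_imp_continuous_on) (auto intro: has_derivative_continuous)
  have meas [measurable]: "f \<in> borel_measurable borel"
    using cont by (rule borel_measurable_continuous_onI)
  have int_f: "integrable lborel f"
  proof -
    have "integrable lborel (\<lambda>x. indicator K x *\<^sub>R f x)"
      by (rule borel_integrable_compact[OF K(1)]) (use cont continuous_on_subset in blast)
    moreover have "(\<lambda>x. indicator K x *\<^sub>R f x) = f"
      using K(2) by (intro ext) (auto simp: indicator_def)
    ultimately show ?thesis by simp
  qed
  have shift: "integrable lborel (\<lambda>x. f (x + c))" "integral\<^sup>L lborel (\<lambda>x. f (x + c)) = integral\<^sup>L lborel f" for c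
  proof -
    have "integrable (distr lborel borel ((+) c)) f" using int_f by (simp add: lborel_distr_plus)
    then show "integrable lborel (\<lambda>x. f (x + c))"
      by (subst (asm) integrable_distr_eq) (auto simp: add.commute)
    have "integral\<^sup>L (distr lborel borel ((+) c)) f = integral\<^sup>L lborel f" by (simp add: lborel_distr_plus)
    then show "integral\<^sup>L lborel (\<lambda>x. f (x + c)) = integral\<^sup>L lborel f"
      by (subst (asm) integral_distr) (auto simp: add.commute)
  qed
  have g_int: "integral\<^sup>L lborel (g n) = 0" for n
    unfolding g_def by (simp add: shift int_f)
  have line: "((\<lambda>s. f (x + s *\<^sub>R v)) has_real_derivative f' (x + s *\<^sub>R v) v) (at s)" for x s
  proof -
    have "((\<lambda>s. f (x + s *\<^sub>R v)) has_derivative (\<lambda>h. f' (x + s *\<^sub>R v) (h *\<^sub>R v))) (at s)"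
      by (rule has_derivative_compose[OF _ der]) (auto intro!: derivative_eq_intros)
    moreover have "(\<lambda>h. f' (x + s *\<^sub>R v) (h *\<^sub>R v)) = (*) (f' (x + s *\<^sub>R v) v)"
      using has_derivative_linear[OF der, of "x + s *\<^sub>R v"] by (auto simp: linear_scale)
    ultimately show ?thesis by (simp add: has_field_derivative_def)
  qed
  have lim: "(\<lambda>n. g n x) \<longlonglongrightarrow> f' x v" for x
  proof -
    have "((\<lambda>h. (f (x + h *\<^sub>R v) - f x) / h) \<longlongrightarrow> f' x v) (at 0)"
      using line[of x 0] by (simp add: DERIV_def)
    then have "(\<lambda>n. (f (x + (1 / real (Suc n)) *\<^sub>R v) - f x) / (1 / real (Suc n))) \<longlonglongrightarrow> f' x v"
      by (rule filterlim_compose)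
        (use LIMSEQ_inverse_real_of_nat in \<open>auto simp: filterlim_at inverse_eq_divide eventually_sequentially\<close>)
    then show ?thesis by (simp add: g_def)
  qed
  have gB: "\<bar>g n x\<bar> \<le> B" for n x
  proof -
    have "\<exists>z>0. z < 1 / real (Suc n) \<and> f (x + (1 / real (Suc n)) *\<^sub>R v) - f (x + 0 *\<^sub>R v)
        = (1 / real (Suc n) - 0) * f' (x + z *\<^sub>R v) v"
      by (rule MVT2) (use line in auto)
    then obtain z where "f (x + (1 / real (Suc n)) *\<^sub>R v) - f x = 1 / real (Suc n) * f' (x + z *\<^sub>R v) v" by auto
    then have "g n x = f' (x + z *\<^sub>R v) v" unfolding g_def by (simp add: field_simps)
    then show ?thesis using B by simp
  qed
  \<comment> \<open>The increments have length at most \<open>norm v\<close>, so one ball contains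
    the supports of all quotients and carries the dominating function.\<close>
  obtain R where R: "K \<subseteq> cball 0 R" 
    using compact_imp_bounded[OF K(1)] by (auto simp: bounded_pos subset_iff)
  have gsupp: "g n x = 0" if "x \<notin> cball 0 (R + norm v)" for n x
  proof -
    have "norm x > R + norm v" using that by simp
    moreover have "norm x \<le> norm (x + (1 / real (Suc n)) *\<^sub>R v) + norm ((1 / real (Suc n)) *\<^sub>R v)"
      by (metis add_diff_cancel_right' norm_triangle_ineq4)
    moreover have "norm ((1 / real (Suc n)) *\<^sub>R v) \<le> norm v"
      by (simp add: divide_le_eq algebra_simps)
    ultimately have "norm (x + (1 / real (Suc n)) *\<^sub>R v) > R" "norm x > R"
      using norm_ge_zero[of v] by linarith+
    then have "x + (1 / real (Suc n)) *\<^sub>R v \<notin> K" "x \<notin> K" using R by auto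
    then show ?thesis using K(2) by (simp add: g_def)
  qed
  have w: "integrable lborel (\<lambda>x. indicator (cball 0 (R + norm v)) x *\<^sub>R B)"
    by (rule borel_integrable_compact) auto
  have bound: "norm (g n x) \<le> indicator (cball 0 (R + norm v)) x *\<^sub>R B" for n x
    using gB gsupp by (auto simp: indicator_def)
  have f'_meas: "(\<lambda>x. f' x v) \<in> borel_measurable lborel"
    by (rule borel_measurable_LIMSEQ_real[OF lim]) (simp add: g_def)
  have gm: "g n \<in> borel_measurable lborel" for n unfolding g_def by measurable
  show "integrable lborel (\<lambda>x. f' x v)"
    by (rule integrable_dominated_convergence[where s = g, OF f'_meas gm w]) (use lim bound in auto)
  have "(\<lambda>n. integral\<^sup>L lborel (g n)) \<longlonglongrightarrow> integral\<^sup>L lborel (\<lambda>x. f' x v)"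
    by (rule integral_dominated_convergence[where s = g, OF f'_meas gm w]) (use lim bound in auto)
  then show "integral\<^sup>L lborel (\<lambda>x. f' x v) = 0"
    by (simp add: g_int LIMSEQ_const_iff)
qed

text \<open>\<open>F\<close> is the pullback of \<open>f\<close> with the Jacobian included, and
  both are extended by zero; this is the form in which chart expressions of a function on the
  manifold occur. \<open>vec\<close> passes to \<open>real ^ 1\<close>, where the change of
  variables theorem for vector-valued functions applies.\<close>

lemma lebesgue_change_of_variables:
  fixes f F :: "real ^ 'm::{finite,wellorder} \<Rightarrow> real" and g :: "real ^ 'm::_ \<Rightarrow> real ^ 'm::_"
  assumes S: "S \<in> sets lebesgue"
    and der: "\<And>x. x \<in> S \<Longrightarrow> (g has_derivative g' x) (at x)" and inj: "inj_on g S"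
    and F: "\<And>x. x \<in> S \<Longrightarrow> F x = \<bar>det (matrix (g' x))\<bar> * f (g x)" "\<And>x. x \<notin> S \<Longrightarrow> F x = 0"
    and f: "\<And>y. y \<notin> g ` S \<Longrightarrow> f y = 0"
    and int: "integrable lebesgue F"
  shows "integrable lebesgue f" "integral\<^sup>L lebesgue f = integral\<^sup>L lebesgue F"
proof -
  let ?G = "\<lambda>x. \<bar>det (matrix (g' x))\<bar> *\<^sub>R (vec (f (g x)) :: real ^ 1)"
  have eqF: "(\<lambda>x. indicator S x *\<^sub>R (\<bar>det (matrix (g' x))\<bar> * f (g x))) = F"
    using F by (auto simp: indicator_def)
  have eqf: "(\<lambda>x. indicator (g ` S) x *\<^sub>R f x) = f"
    using f by (intro ext) (auto simp: indicator_def)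
  have F_abs: "(\<lambda>x. \<bar>det (matrix (g' x))\<bar> * f (g x)) absolutely_integrable_on S"
    using int eqF unfolding set_integrable_def by simp
  then have "?G absolutely_integrable_on S"
    by (simp add: absolutely_integrable_on_1_iff)
  moreover note has_absolute_integral_change_of_variables[OF S has_derivative_at_withinI[OF der] inj,
      where f = "\<lambda>y. vec (f y) :: real ^ 1" and b = "integral S ?G"]
  ultimately have "(\<lambda>y. vec (f y) :: real ^ 1) absolutely_integrable_on g ` S"
    and eq: "integral (g ` S) (\<lambda>y. vec (f y) :: real ^ 1) = integral S ?G" by auto
  then have f_abs: "f absolutely_integrable_on g ` S" by (simp add: absolutely_integrable_on_1_iff)
  then show "integrable lebesgue f" unfolding set_integrable_def eqf .
  have "integral (g ` S) f = integral S (\<lambda>x. \<bar>det (matrix (g' x))\<bar> * f (g x))"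
    using eq by (simp add: integral_on_1_eq vec_eq_iff)
  then show "integral\<^sup>L lebesgue f = integral\<^sup>L lebesgue F"
    using set_lebesgue_integral_eq_integral(2)[OF f_abs] set_lebesgue_integral_eq_integral(2)[OF F_abs]
    unfolding set_lebesgue_integral_def eqF eqf by simp
qed

text \<open>The points of \<open>S\<close> with \<open>f x \<noteq> 0\<close> form a set that is
  open by continuity and negligible by the integral, hence empty.\<close>

lemma lebesgue_integral_zero_nonneg_continuous:
  fixes f :: "'a::euclidean_space \<Rightarrow> real"
  assumes "integrable lebesgue f" "integral\<^sup>L lebesgue f = 0" "\<And>x. f x \<ge> 0"
    and "open S" "continuous_on S f" "x \<in> S"
  shows "f x = 0"
proof -
  have "AE x in lebesgue. f x = 0"
    using integral_nonneg_eq_0_iff_AE[OF assms(1)] assms(2,3) by auto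
  moreover have "{x. f x \<noteq> 0} \<in> sets lebesgue"
    using measurable_sets[OF borel_measurable_integrable[OF assms(1)], of "- {0}"]
    by (simp add: vimage_def)
  ultimately have "{x. f x \<noteq> 0} \<in> null_sets lebesgue"
    using AE_iff_null_sets[of "{x. f x \<noteq> 0}" lebesgue] by simp
  then have "negligible {x \<in> S. f x \<noteq> 0}"
    using negligible_iff_null_sets negligible_subset by (metis (mono_tags, lifting) mem_Collect_eq subsetI)
  moreover have "open {x \<in> S. f x \<noteq> 0}"
  proof -
    have "{x \<in> S. f x \<noteq> 0} = S \<inter> f -` (- {0})" by auto
    then show ?thesis using continuous_open_preimage[OF assms(5,4) open_Compl[OF closed_singleton]] by simp
  qed
  ultimately have "{x \<in> S. f x \<noteq> 0} = {}" using open_not_negligible by blast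
  then show ?thesis using assms(6) by auto
qed

section \<open>A divergence theorem on compact manifolds\<close>

text \<open>At 0 the difference quotient is bounded by \<open>\<bar>h\<bar>\<close>. Squaring turns
  the positive part into a C^1 function, which serves both the bump functions and the weight
  \<open>G\<close>.\<close>

lemma DERIV_max_sq: "((\<lambda>t. (max 0 t)\<^sup>2) has_real_derivative 2 * max 0 t) (at (t::real))"
proof (cases "t = 0")
  case True
  have "((\<lambda>t. (max 0 t)\<^sup>2) has_real_derivative 0) (at (0::real))"
    unfolding DERIV_def
  proof (rule Lim_null_comparison)
    show "\<forall>\<^sub>F h in at 0. norm (((max 0 (0 + h))\<^sup>2 - (max 0 0)\<^sup>2) / h) \<le> \<bar>h\<bar>" for h :: real
      by (intro always_eventually) (auto simp: max_def power2_eq_square)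
    show "((\<lambda>h::real. \<bar>h\<bar>) \<longlongrightarrow> 0) (at 0)"
      using tendsto_rabs_zero tendsto_ident_at by blast
  qed
  then show ?thesis using True by simp
next
  case False
  show ?thesis
  proof (cases "t > 0")
    case True
    have "((\<lambda>t. t\<^sup>2) has_real_derivative 2 * max 0 t) (at t)"
      using True by (auto intro!: derivative_eq_intros)
    then show ?thesis
      by (rule has_field_derivative_transform_within_open[where S = "{0<..}"]) (use True in auto)
  next
    case f: False
    have "((\<lambda>t. 0) has_real_derivative 2 * max 0 t) (at t)"
      using f by (auto intro!: derivative_eq_intros)
    then show ?thesis
      by (rule has_field_derivative_transform_within_open[where S = "{..<0}"]) (use f False in auto)
  qed
qed

text \<open>The complex structure is forgotten: \<open>\<theta> i\<close> inverts the chart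
  \<open>\<phi> i\<close>, \<open>J i j\<close> is the derivative of a transition map,
  \<open>P\<close> is a density and \<open>V\<close> a vector field, each given by chart
  expressions. Regularity is imposed on the product of \<open>P\<close> and \<open>V\<close>,
  because this is what the divergence differentiates. The index type is well-ordered for the change
  of variables theorem.\<close>

locale volume_atlas =
  fixes X :: "'x topology" and I :: "'i set" and D :: "'i \<Rightarrow> 'x set"
    and \<phi> :: "'i \<Rightarrow> 'x \<Rightarrow> real ^ 'm::{finite,wellorder}"
    and \<theta> :: "'i \<Rightarrow> real ^ 'm::_ \<Rightarrow> 'x"
    and J :: "'i \<Rightarrow> 'i \<Rightarrow> real ^ 'm::_ \<Rightarrow> real ^ 'm::_ \<Rightarrow> real ^ 'm::_"
    and P :: "'i \<Rightarrow> real ^ 'm::_ \<Rightarrow> real"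
    and V :: "'i \<Rightarrow> real ^ 'm::_ \<Rightarrow> real ^ 'm::_"
  assumes Hausdorff: "Hausdorff_space X" and compact_X: "compact_space X"
    and open_D: "\<And>i. i \<in> I \<Longrightarrow> openin X (D i)"
    and open_img: "\<And>i. i \<in> I \<Longrightarrow> open (\<phi> i ` D i)"
    and cover: "topspace X = (\<Union>i\<in>I. D i)"
    and homeo: "\<And>i. i \<in> I \<Longrightarrow>
      homeomorphic_maps (subtopology X (D i)) (top_of_set (\<phi> i ` D i)) (\<phi> i) (\<theta> i)"
    and transition_derivative: "\<And>i j x. i \<in> I \<Longrightarrow> j \<in> I \<Longrightarrow> x \<in> D i \<Longrightarrow> x \<in> D j \<Longrightarrow>
      ((\<lambda>z. \<phi> j (\<theta> i z)) has_derivative J i j (\<phi> i x)) (at (\<phi> i x))"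
    and transition_bounded: "\<And>i j K L. i \<in> I \<Longrightarrow> j \<in> I \<Longrightarrow> compact K \<Longrightarrow> K \<subseteq> \<phi> i ` D i \<Longrightarrow>
      compact L \<Longrightarrow> L \<subseteq> \<phi> j ` D j \<Longrightarrow>
      \<exists>B. \<forall>x u. x \<in> D i \<longrightarrow> x \<in> D j \<longrightarrow> \<phi> i x \<in> K \<longrightarrow> \<phi> j x \<in> L \<longrightarrow> norm (J i j (\<phi> i x) u) \<le> B * norm u"
    and density_transition: "\<And>i j x. i \<in> I \<Longrightarrow> j \<in> I \<Longrightarrow> x \<in> D i \<Longrightarrow> x \<in> D j \<Longrightarrow>
      P i (\<phi> i x) = \<bar>det (matrix (J i j (\<phi> i x)))\<bar> * P j (\<phi> j x)"
    and field_transition: "\<And>i j x. i \<in> I \<Longrightarrow> j \<in> I \<Longrightarrow> x \<in> D i \<Longrightarrow> x \<in> D j \<Longrightarrow>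
      V j (\<phi> j x) = J i j (\<phi> i x) (V i (\<phi> i x))"
    and field_C1: "\<And>i a. i \<in> I \<Longrightarrow> Ck_on 1 (\<lambda>z. P i z * V i z $ a) (\<phi> i ` D i)"
begin

definition img :: "'i \<Rightarrow> (real ^ 'm::_) set" where "img i = \<phi> i ` D i"

definition divergence :: "'i \<Rightarrow> real ^ 'm::_ \<Rightarrow> real" where
  "divergence i z = (\<Sum>a\<in>UNIV. frechet_derivative (\<lambda>z. P i z * V i z $ a) (at z) (axis a 1))"

lemma open_img': "i \<in> I \<Longrightarrow> open (img i)"
  using open_img by (simp add: img_def)

lemma D_subset: "i \<in> I \<Longrightarrow> D i \<subseteq> topspace X"
  using cover by auto

lemma theta_phi: "i \<in> I \<Longrightarrow> x \<in> D i \<Longrightarrow> \<theta> i (\<phi> i x) = x"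
  using homeo[of i] D_subset[of i] by (auto simp: homeomorphic_maps_def)

lemma phi_in_img: "x \<in> D i \<Longrightarrow> \<phi> i x \<in> img i"
  by (simp add: img_def)

lemma imgE:
  assumes "i \<in> I" "z \<in> img i"
  obtains x where "x \<in> D i" "z = \<phi> i x" "\<theta> i z = x"
  using assms theta_phi by (auto simp: img_def)

lemma continuous_theta: "i \<in> I \<Longrightarrow> continuous_map (top_of_set (img i)) X (\<theta> i)"
  using homeo[of i] unfolding homeomorphic_maps_def img_def
  by (auto intro: continuous_map_into_fulltopology)

lemma open_image:
  assumes "i \<in> I" "openin X U"
  shows "open (\<phi> i ` (D i \<inter> U))"
proof -
  have "openin (top_of_set (img i)) {z \<in> topspace (top_of_set (img i)). \<theta> i z \<in> U}"
    by (rule openin_continuous_map_preimage[OF continuous_theta[OF assms(1)] assms(2)])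
  then have "open {z \<in> img i. \<theta> i z \<in> U}"
    using open_img'[OF assms(1)] by (simp add: openin_open_eq)
  moreover have "{z \<in> img i. \<theta> i z \<in> U} = \<phi> i ` (D i \<inter> U)"
    using theta_phi[OF assms(1)] by (auto simp: img_def)
  ultimately show ?thesis by simp
qed

lemma closed_image:
  assumes "i \<in> I" "compact K" "K \<subseteq> img i"
  shows "closedin X (\<theta> i ` K)"
proof -
  have "compactin (top_of_set (img i)) K"
    using assms(2,3) by (simp add: compactin_subtopology)
  then have "compactin X (\<theta> i ` K)"
    using continuous_theta[OF assms(1)] image_compactin by blast
  then show ?thesis using Hausdorff compactin_imp_closedin by blast
qed

definition dif :: "('x \<Rightarrow> real) \<Rightarrow> 'i \<Rightarrow> real ^ 'm::_ \<Rightarrow> real ^ 'm::_ \<Rightarrow> real" where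
  "dif \<rho> i z = frechet_derivative (\<lambda>z. \<rho> (\<theta> i z)) (at z)"

text \<open>The transition maps of a holomorphic atlas are only given to be differentiable.  Local boundedness
  of the derivative, which dominated convergence needs, therefore stands in for \<open>C\<^sup>1\<close>.\<close>

definition tame :: "('x \<Rightarrow> real) \<Rightarrow> bool" where
  "tame \<rho> \<longleftrightarrow> (\<forall>i\<in>I. (\<forall>z\<in>img i. (\<lambda>z. \<rho> (\<theta> i z)) differentiable at z) \<and>
     (\<forall>K. compact K \<longrightarrow> K \<subseteq> img i \<longrightarrow> (\<exists>B. \<forall>z\<in>K. \<forall>u. \<bar>dif \<rho> i z u\<bar> \<le> B * norm u)))"

lemma tame_has_derivative:
  "tame \<rho> \<Longrightarrow> i \<in> I \<Longrightarrow> z \<in> img i \<Longrightarrow> ((\<lambda>z. \<rho> (\<theta> i z)) has_derivative dif \<rho> i z) (at z)"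
  unfolding tame_def dif_def using frechet_derivative_works by blast

lemma tame_bounded:
  assumes "tame \<rho>" "i \<in> I" "compact K" "K \<subseteq> img i"
  obtains B where "B \<ge> 0" "\<And>z u. z \<in> K \<Longrightarrow> \<bar>dif \<rho> i z u\<bar> \<le> B * norm u"
proof -
  obtain B where B: "\<And>z u. z \<in> K \<Longrightarrow> \<bar>dif \<rho> i z u\<bar> \<le> B * norm u"
    using bspec[OF assms(1)[unfolded tame_def] assms(2), THEN conjunct2, rule_format, OF assms(3,4)] by metis
  show thesis
  proof (rule that[of "\<bar>B\<bar>"])
    show "\<bar>dif \<rho> i z u\<bar> \<le> \<bar>B\<bar> * norm u" if "z \<in> K" for z u
      using B[OF that, of u] mult_right_mono[OF abs_ge_self[of B] norm_ge_zero[of u]] by linarith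
  qed simp
qed

lemma tame_continuous_on: "tame \<rho> \<Longrightarrow> i \<in> I \<Longrightarrow> continuous_on (img i) (\<lambda>z. \<rho> (\<theta> i z))"
  by (intro continuous_at_imp_continuous_on ballI)
    (metis tame_has_derivative has_derivative_continuous)

lemma tameI:
  assumes "\<And>i z. i \<in> I \<Longrightarrow> z \<in> img i \<Longrightarrow> ((\<lambda>z. \<rho> (\<theta> i z)) has_derivative d i z) (at z)"
    and "\<And>i K. i \<in> I \<Longrightarrow> compact K \<Longrightarrow> K \<subseteq> img i \<Longrightarrow> \<exists>B. \<forall>z\<in>K. \<forall>u. \<bar>d i z u\<bar> \<le> B * norm u"
  shows "tame \<rho>"
proof -
  have "dif \<rho> i z = d i z" if "i \<in> I" "z \<in> img i" for i z
    using frechet_derivative_at[OF assms(1)[OF that]] by (simp add: dif_def)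
  then show ?thesis
    using assms unfolding tame_def differentiable_def by (metis subsetD)
qed

lemma dif_eqI:
  "((\<lambda>z. \<rho> (\<theta> i z)) has_derivative d) (at z) \<Longrightarrow> dif \<rho> i z = d"
  using frechet_derivative_at by (metis dif_def)

lemma tame_sum:
  assumes "finite F" "\<And>k. k \<in> F \<Longrightarrow> tame (\<rho> k)"
  shows "tame (\<lambda>x. \<Sum>k\<in>F. \<rho> k x)"
    and "i \<in> I \<Longrightarrow> z \<in> img i \<Longrightarrow> dif (\<lambda>x. \<Sum>k\<in>F. \<rho> k x) i z u = (\<Sum>k\<in>F. dif (\<rho> k) i z u)"
proof -
  have d: "((\<lambda>z. \<Sum>k\<in>F. \<rho> k (\<theta> i z)) has_derivative (\<lambda>u. \<Sum>k\<in>F. dif (\<rho> k) i z u)) (at z)"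
    if "i \<in> I" "z \<in> img i" for i z
    by (intro has_derivative_sum tame_has_derivative assms that)
  then show "i \<in> I \<Longrightarrow> z \<in> img i \<Longrightarrow> dif (\<lambda>x. \<Sum>k\<in>F. \<rho> k x) i z u = (\<Sum>k\<in>F. dif (\<rho> k) i z u)"
    using dif_eqI[of "\<lambda>x. \<Sum>k\<in>F. \<rho> k x"] by metis
  show "tame (\<lambda>x. \<Sum>k\<in>F. \<rho> k x)"
  proof (rule tameI[OF d])
    fix i K assume iK: "i \<in> I" "compact K" "K \<subseteq> img i"
    then have "\<forall>k\<in>F. \<exists>B. \<forall>z\<in>K. \<forall>u. \<bar>dif (\<rho> k) i z u\<bar> \<le> B * norm u"
      using assms(2) unfolding tame_def by blast
    then obtain B where B: "\<And>k z u. k \<in> F \<Longrightarrow> z \<in> K \<Longrightarrow> \<bar>dif (\<rho> k) i z u\<bar> \<le> B k * norm u"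
      by metis
    have "\<bar>\<Sum>k\<in>F. dif (\<rho> k) i z u\<bar> \<le> (\<Sum>k\<in>F. B k) * norm u" if "z \<in> K" for z u
      unfolding sum_distrib_right by (rule order_trans[OF sum_abs sum_mono]) (use B that in auto)
    then show "\<exists>B. \<forall>z\<in>K. \<forall>u. \<bar>\<Sum>k\<in>F. dif (\<rho> k) i z u\<bar> \<le> B * norm u" by blast
  qed
qed

text \<open>For the normalisation of bump functions to a partition of unity. On a compact set the
  denominator is bounded below by its positive minimum \<open>m\<close>.\<close>

lemma tame_divide:
  assumes "tame \<psi>" "tame s" "\<And>x. x \<in> topspace X \<Longrightarrow> s x > 0"
  shows "tame (\<lambda>x. \<psi> x / s x)"
proof (rule tameI)
  fix i z assume iz: "i \<in> I" "z \<in> img i"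
  have pos: "s (\<theta> i z) > 0" if "i \<in> I" "z \<in> img i" for i z
    using imgE[OF that] D_subset[OF that(1)] assms(3) by blast
  show "((\<lambda>z. \<psi> (\<theta> i z) / s (\<theta> i z)) has_derivative
     (\<lambda>u. (dif \<psi> i z u * s (\<theta> i z) - \<psi> (\<theta> i z) * dif s i z u) / (s (\<theta> i z) * s (\<theta> i z)))) (at z)"
    using pos[OF iz] by (intro has_derivative_divide' tame_has_derivative assms iz) simp
next
  fix i K assume iK: "i \<in> I" "compact K" "K \<subseteq> img i"
  show "\<exists>B. \<forall>z\<in>K. \<forall>u. \<bar>(dif \<psi> i z u * s (\<theta> i z) - \<psi> (\<theta> i z) * dif s i z u) / (s (\<theta> i z) * s (\<theta> i z))\<bar> \<le> B * norm u"
  proof (cases "K = {}")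
    case False
    have pos: "s (\<theta> i z) > 0" if "z \<in> K" for z
      using imgE[OF iK(1), of z] iK(3) that D_subset[OF iK(1)] assms(3) by blast
    have c\<psi>: "continuous_on K (\<lambda>z. \<bar>\<psi> (\<theta> i z)\<bar>)" and cs: "continuous_on K (\<lambda>z. s (\<theta> i z))"
      using tame_continuous_on[OF assms(1) iK(1)] tame_continuous_on[OF assms(2) iK(1)] iK(3)
      by (auto intro!: continuous_intros elim: continuous_on_subset)
    obtain A where A: "\<And>z. z \<in> K \<Longrightarrow> \<bar>\<psi> (\<theta> i z)\<bar> \<le> A"
      using continuous_attains_sup[OF iK(2) False c\<psi>] by blast
    obtain C where C: "\<And>z. z \<in> K \<Longrightarrow> s (\<theta> i z) \<le> C"
      using continuous_attains_sup[OF iK(2) False cs] by blast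
    obtain z0 where z0: "z0 \<in> K" "\<And>z. z \<in> K \<Longrightarrow> s (\<theta> i z0) \<le> s (\<theta> i z)"
      using continuous_attains_inf[OF iK(2) False cs] by blast
    obtain B1 where B1: "B1 \<ge> 0" "\<And>z u. z \<in> K \<Longrightarrow> \<bar>dif \<psi> i z u\<bar> \<le> B1 * norm u"
      using tame_bounded[OF assms(1) iK] by metis
    obtain B2 where B2: "B2 \<ge> 0" "\<And>z u. z \<in> K \<Longrightarrow> \<bar>dif s i z u\<bar> \<le> B2 * norm u"
      using tame_bounded[OF assms(2) iK] by metis
    define m where "m = s (\<theta> i z0)"
    have m: "m > 0" using pos z0 m_def by auto
    have "\<bar>(dif \<psi> i z u * s (\<theta> i z) - \<psi> (\<theta> i z) * dif s i z u) / (s (\<theta> i z) * s (\<theta> i z))\<bar>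
       \<le> ((B1 * C + A * B2) / (m * m)) * norm u" if z: "z \<in> K" for z u
    proof -
      have "\<bar>dif \<psi> i z u * s (\<theta> i z) - \<psi> (\<theta> i z) * dif s i z u\<bar>
          \<le> \<bar>dif \<psi> i z u\<bar> * s (\<theta> i z) + \<bar>\<psi> (\<theta> i z)\<bar> * \<bar>dif s i z u\<bar>"
        using pos[OF z] by (metis abs_mult abs_of_pos abs_triangle_ineq4)
      also have "\<dots> \<le> (B1 * norm u) * C + A * (B2 * norm u)"
        using pos[OF z] C[OF z] A[OF z] B1(1) B1(2)[OF z, of u] B2(1) B2(2)[OF z, of u]
        by (intro add_mono mult_mono) auto
      finally have num: "\<bar>dif \<psi> i z u * s (\<theta> i z) - \<psi> (\<theta> i z) * dif s i z u\<bar> \<le> (B1 * C + A * B2) * norm u"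
        by (simp add: algebra_simps)
      have "m * m \<le> s (\<theta> i z) * s (\<theta> i z)"
        using z0(2)[OF z] m by (intro mult_mono) (auto simp: m_def)
      then have "\<bar>dif \<psi> i z u * s (\<theta> i z) - \<psi> (\<theta> i z) * dif s i z u\<bar> / (s (\<theta> i z) * s (\<theta> i z))
          \<le> ((B1 * C + A * B2) * norm u) / (m * m)"
        using m num by (intro frac_le) auto
      then show ?thesis using pos[OF z] by (simp add: abs_mult)
    qed
    then show ?thesis by blast
  qed auto
qed

lemma dif_eq_0:
  assumes "i \<in> I" "x \<in> D i" "openin X U" "x \<in> U" "\<And>y. y \<in> U \<Longrightarrow> \<rho> y = 0"
  shows "((\<lambda>z. \<rho> (\<theta> i z)) has_derivative (\<lambda>u. 0)) (at (\<phi> i x))"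
  by (rule has_derivative_transform_within_open[OF has_derivative_const[of 0] open_image[OF assms(1,3)]])
    (use assms theta_phi in auto)

lemma dif_transition:
  assumes "tame \<rho>" "i \<in> I" "j \<in> I" "x \<in> D i" "x \<in> D j"
  shows "dif \<rho> i (\<phi> i x) u = dif \<rho> j (\<phi> j x) (J i j (\<phi> i x) u)"
proof -
  have tp: "\<phi> j (\<theta> i (\<phi> i x)) = \<phi> j x" using theta_phi assms by simp
  have "((\<lambda>z. \<rho> (\<theta> j (\<phi> j (\<theta> i z)))) has_derivative (\<lambda>u. dif \<rho> j (\<phi> j x) (J i j (\<phi> i x) u))) (at (\<phi> i x))"
    by (rule has_derivative_compose[OF transition_derivative[OF assms(2-5)], unfolded tp])
      (rule tame_has_derivative[OF assms(1,3) phi_in_img[OF assms(5)]])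
  then have "((\<lambda>z. \<rho> (\<theta> i z)) has_derivative (\<lambda>u. dif \<rho> j (\<phi> j x) (J i j (\<phi> i x) u))) (at (\<phi> i x))"
    by (rule has_derivative_transform_within_open[OF _ open_image[OF assms(2) open_D[OF assms(3)]]])
      (use assms theta_phi in auto)
  from dif_eqI[OF this] show ?thesis by simp
qed

text \<open>Supported in the closed ball of radius \<open>r\<close> about \<open>a\<close>. Squaring
  the positive part of the quadratic polynomial makes the gradient vanish on the bounding sphere, so
  the extension by zero is of class C^1 in the chart.\<close>

definition bump :: "'i \<Rightarrow> real ^ 'm::_ \<Rightarrow> real \<Rightarrow> 'x \<Rightarrow> real" where
  "bump i a r x = (if x \<in> D i then (max 0 (r\<^sup>2 - (\<phi> i x - a) \<bullet> (\<phi> i x - a)))\<^sup>2 else 0)"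

lemma bump_support: "bump i a r x \<noteq> 0 \<Longrightarrow> r \<ge> 0 \<Longrightarrow> x \<in> D i \<and> \<phi> i x \<in> cball a r"
proof (simp add: bump_def split: if_splits)
  assume "max 0 (r\<^sup>2 - (\<phi> i x - a) \<bullet> (\<phi> i x - a)) \<noteq> 0" "0 \<le> r"
  then have "(norm (\<phi> i x - a))\<^sup>2 \<le> r\<^sup>2" by (auto simp: max_def power2_norm_eq_inner split: if_splits)
  then have "norm (\<phi> i x - a) \<le> r" using \<open>0 \<le> r\<close> by (rule power2_le_imp_le)
  then show "dist a (\<phi> i x) \<le> r" by (simp add: dist_norm norm_minus_commute)
qed

text \<open>Inside \<open>D i\<close> this is the chain rule. Elsewhere the support, the image of a
  compact ball, is closed in the Hausdorff space \<open>X\<close>, so the bump is zero near the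
  point. The local bounds come from \<open>transition_bounded\<close>, applied with the ball as
  second compact set.\<close>

lemma tame_bump:
  assumes i: "i \<in> I" and r: "r > 0" and ball: "cball a r \<subseteq> img i"
  shows "tame (bump i a r)"
proof -
  define q where "q z u = - 4 * max 0 (r\<^sup>2 - (z - a) \<bullet> (z - a)) * ((z - a) \<bullet> u)" for z u
  have q_der: "((\<lambda>z. (max 0 (r\<^sup>2 - (z - a) \<bullet> (z - a)))\<^sup>2) has_derivative q z) (at z)" for z
  proof -
    have "((\<lambda>z. r\<^sup>2 - (z - a) \<bullet> (z - a)) has_derivative (\<lambda>u. - 2 * ((z - a) \<bullet> u))) (at z)"
      by (auto intro!: derivative_eq_intros simp: inner_commute)
    from has_derivative_compose[OF this DERIV_max_sq[unfolded has_field_derivative_def]]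
    show ?thesis by (simp add: q_def[abs_def] algebra_simps)
  qed
  have q0: "q z u = 0" if "z \<notin> cball a r" for z u
  proof -
    have "norm (z - a) > r" using that by (simp add: dist_norm norm_minus_commute)
    then have "r\<^sup>2 < (norm (z - a))\<^sup>2" using r by (intro power_strict_mono) auto
    then show ?thesis by (simp add: q_def power2_norm_eq_inner)
  qed
  have qB: "\<bar>q z u\<bar> \<le> 4 * r\<^sup>2 * r * norm u" for z u
  proof (cases "z \<in> cball a r")
    case True
    have "\<bar>(z - a) \<bullet> u\<bar> \<le> norm (z - a) * norm u" by (rule Cauchy_Schwarz_ineq2)
    also have "\<dots> \<le> r * norm u"
      using True by (intro mult_right_mono) (auto simp: dist_norm norm_minus_commute)
    finally have 1: "\<bar>(z - a) \<bullet> u\<bar> \<le> r * norm u" .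
    have 2: "\<bar>max 0 (r\<^sup>2 - (z - a) \<bullet> (z - a))\<bar> \<le> r\<^sup>2" by auto
    have "\<bar>q z u\<bar> = 4 * (\<bar>max 0 (r\<^sup>2 - (z - a) \<bullet> (z - a))\<bar> * \<bar>(z - a) \<bullet> u\<bar>)"
      by (simp add: q_def abs_mult)
    also have "\<dots> \<le> 4 * (r\<^sup>2 * (r * norm u))"
      using 1 2 by (intro mult_left_mono mult_mono) auto
    finally show ?thesis by (simp add: mult.assoc)
  next
    case False
    then show ?thesis using q0 r by simp
  qed
  define d where "d j z u = (if \<theta> j z \<in> D i then q (\<phi> i (\<theta> j z)) (J j i z u) else 0)" for j z u
  show ?thesis
  proof (rule tameI)
    fix j z assume j: "j \<in> I" and z: "z \<in> img j"
    obtain x where x: "x \<in> D j" "z = \<phi> j x" "\<theta> j z = x" using imgE[OF j z] by blast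
    show "((\<lambda>z. bump i a r (\<theta> j z)) has_derivative d j z) (at z)"
    proof (cases "x \<in> D i")
      case True
      have tp: "\<phi> i (\<theta> j (\<phi> j x)) = \<phi> i x" using theta_phi[OF j x(1)] by simp
      have "((\<lambda>z. (max 0 (r\<^sup>2 - (\<phi> i (\<theta> j z) - a) \<bullet> (\<phi> i (\<theta> j z) - a)))\<^sup>2) has_derivative
          (\<lambda>u. q (\<phi> i x) (J j i (\<phi> j x) u))) (at (\<phi> j x))"
        using has_derivative_compose[OF transition_derivative[OF j i x(1) True] q_der] unfolding tp .
      then have "((\<lambda>z. bump i a r (\<theta> j z)) has_derivative (\<lambda>u. q (\<phi> i x) (J j i (\<phi> j x) u))) (at (\<phi> j x))"
        by (rule has_derivative_transform_within_open[OF _ open_image[OF j open_D[OF i]]])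
          (use x True theta_phi[OF j] in \<open>auto simp: bump_def\<close>)
      moreover have "d j z = (\<lambda>u. q (\<phi> i x) (J j i (\<phi> j x) u))"
        using x True by (auto simp: d_def)
      ultimately show ?thesis using x(2) by simp
    next
      case False
      have op: "openin X (topspace X - \<theta> i ` cball a r)"
        using closed_image[OF i compact_cball ball] by (simp add: openin_diff)
      have "\<theta> i ` cball a r \<subseteq> D i" using ball i by (auto elim!: imgE[OF i] dest: subsetD)
      then have "x \<in> topspace X - \<theta> i ` cball a r" using False x D_subset[OF j] by auto
      moreover have "bump i a r y = 0" if "y \<in> topspace X - \<theta> i ` cball a r" for y
        using bump_support[of i a r y] that r theta_phi[OF i, of y] by (metis DiffD2 image_eqI less_imp_le)
      ultimately have "((\<lambda>z. bump i a r (\<theta> j z)) has_derivative (\<lambda>u. 0)) (at (\<phi> j x))"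
        by (intro dif_eq_0[OF j x(1) op])
      then show ?thesis using x False by (simp add: d_def[abs_def])
    qed
  next
    fix j K assume j: "j \<in> I" and K: "compact K" "K \<subseteq> img j"
    obtain B where B: "\<And>x u. x \<in> D j \<Longrightarrow> x \<in> D i \<Longrightarrow> \<phi> j x \<in> K \<Longrightarrow> \<phi> i x \<in> cball a r \<Longrightarrow> norm (J j i (\<phi> j x) u) \<le> B * norm u"
      using transition_bounded[OF j i K(1) K(2)[unfolded img_def] compact_cball ball[unfolded img_def]] by blast
    have "\<bar>d j z u\<bar> \<le> (4 * r\<^sup>2 * r * \<bar>B\<bar>) * norm u" if z: "z \<in> K" for z u
    proof -
      obtain x where x: "x \<in> D j" "z = \<phi> j x" "\<theta> j z = x" using imgE[OF j, of z] K z by blast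
      show ?thesis
      proof (cases "x \<in> D i \<and> \<phi> i x \<in> cball a r")
        case True
        have "norm (J j i z u) \<le> \<bar>B\<bar> * norm u"
          using B[of x u] True x z mult_right_mono[OF abs_ge_self[of B] norm_ge_zero[of u]] by fastforce
        then have "4 * r\<^sup>2 * r * norm (J j i z u) \<le> 4 * r\<^sup>2 * r * (\<bar>B\<bar> * norm u)"
          using r by (intro mult_left_mono) auto
        moreover have "\<bar>d j z u\<bar> \<le> 4 * r\<^sup>2 * r * norm (J j i z u)"
          using qB True x by (simp add: d_def)
        ultimately show ?thesis by (simp add: mult.assoc)
      next
        case False
        then have "d j z u = 0" using q0 x by (auto simp: d_def)
        then show ?thesis using r by simp
      qed
    qed
    then show "\<exists>B. \<forall>z\<in>K. \<forall>u. \<bar>d j z u\<bar> \<le> B * norm u" by blast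
  qed
qed

end

section \<open>Integration by parts in charts and patching\<close>

lemma integrable_lebesgue_of_lborel:
  fixes f :: "'a::euclidean_space \<Rightarrow> real"
  assumes "integrable lborel f"
  shows "integrable lebesgue f" "integral\<^sup>L lebesgue f = integral\<^sup>L lborel f"
  using assms integrable_completion[of f lborel] integral_completion[of f lborel]
    borel_measurable_integrable[OF assms] by auto

lemma continuous_on_compact_abs_bound:
  fixes f :: "'a::topological_space \<Rightarrow> real"
  assumes "compact L" "continuous_on L f"
  obtains M where "M \<ge> 0" "\<And>z. z \<in> L \<Longrightarrow> \<bar>f z\<bar> \<le> M"
proof -
  have "bounded (f ` L)" using compact_continuous_image[OF assms(2,1)] by (rule compact_imp_bounded)
  then obtain M where "M > 0" "\<forall>y\<in>f ` L. norm y \<le> M" unfolding bounded_pos by blast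
  then show thesis using that[of M] by auto
qed

context volume_atlas
begin

lemma tame_support:
  assumes "i \<in> I" "compact L" "L \<subseteq> img i"
    and supp: "\<And>x. \<rho> x \<noteq> 0 \<Longrightarrow> x \<in> D i \<and> \<phi> i x \<in> L"
    and j: "j \<in> I" "x \<in> D j" "x \<notin> \<theta> i ` L"
  shows "dif \<rho> j (\<phi> j x) u = 0"
proof -
  have "((\<lambda>z. \<rho> (\<theta> j z)) has_derivative (\<lambda>u. 0)) (at (\<phi> j x))"
  proof (rule dif_eq_0[OF j(1,2)])
    show "openin X (topspace X - \<theta> i ` L)"
      using closed_image[OF assms(1-3)] by (simp add: openin_diff)
    show "x \<in> topspace X - \<theta> i ` L" using j D_subset by blast
    show "\<rho> y = 0" if "y \<in> topspace X - \<theta> i ` L" for y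
      using supp[of y] that theta_phi[OF assms(1), of y] by (metis DiffD2 image_eqI)
  qed
  from dif_eqI[OF this] show ?thesis by simp
qed

text \<open>Integration by parts in one chart: \<open>A + E\<close> is the divergence of a compactly
  supported field, \<open>\<rho>\<close> times density times \<open>V\<close>, and has integral
  zero.\<close>

lemma local_divergence:
  assumes "tame \<rho>" "i \<in> I" "compact L" "L \<subseteq> img i"
    and supp: "\<And>x. \<rho> x \<noteq> 0 \<Longrightarrow> x \<in> D i \<and> \<phi> i x \<in> L"
  defines "A \<equiv> \<lambda>z. if z \<in> img i then \<rho> (\<theta> i z) * divergence i z else 0"
    and "E \<equiv> \<lambda>z. if z \<in> img i then P i z * dif \<rho> i z (V i z) else 0"
  shows "integrable lebesgue A" "integrable lebesgue E"
    "integral\<^sup>L lebesgue A = - integral\<^sup>L lebesgue E"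
proof -
  define Z where "Z a z = P i z * V i z $ a" for a z
  have Z: "Ck_on (Suc 0) (Z a) (img i)" for a
    using field_C1[OF assms(2), of a] by (simp add: Z_def[abs_def] img_def)
  define f where "f a z = (if z \<in> L then \<rho> (\<theta> i z) * Z a z else 0)" for a z
  define f' where "f' a z u = (if z \<in> L then \<rho> (\<theta> i z) * frechet_derivative (Z a) (at z) u + dif \<rho> i z u * Z a z else 0)" for a z u
  \<comment> \<open>On the part of the chart off \<open>L\<close> both \<open>\<rho>\<close> and its
    derivative vanish, so that the extension by zero in \<open>f\<close> is differentiable across
    the boundary of \<open>L\<close>.\<close>
  have off: "\<rho> (\<theta> i z) = 0" "dif \<rho> i z u = 0" if z: "z \<in> img i" "z \<notin> L" for z u
  proof -
    obtain x where x: "x \<in> D i" "z = \<phi> i x" "\<theta> i z = x" using imgE[OF assms(2) z(1)] by blast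
    show "\<rho> (\<theta> i z) = 0" using supp[of x] x z by auto
    have "x \<notin> \<theta> i ` L"
    proof
      assume "x \<in> \<theta> i ` L"
      then obtain w where w: "w \<in> L" "x = \<theta> i w" by blast
      then have "w \<in> img i" using assms(4) by auto
      then show False using w x z imgE[OF assms(2), of w] by metis
    qed
    then show "dif \<rho> i z u = 0" using tame_support[OF assms(2-4) supp assms(2) x(1)] x(2) by simp
  qed
  have "closed L" using assms(3) by (rule compact_imp_closed)
  have der: "(f a has_derivative f' a z) (at z)" for a z
  proof (cases "z \<in> L")
    case True
    then have z: "z \<in> img i" using assms(4) by auto
    have "((\<lambda>z. \<rho> (\<theta> i z) * Z a z) has_derivative f' a z) (at z)"
      using has_derivative_mult[OF tame_has_derivative[OF assms(1,2) z] Ck_on_has_derivative[OF Z z]] True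
      by (simp add: f'_def[abs_def])
    then show ?thesis
      by (rule has_derivative_transform_within_open[OF _ open_img'[OF assms(2)] z])
        (use off in \<open>auto simp: f_def\<close>)
  next
    case False
    have "(f a has_derivative (\<lambda>u. 0)) (at z)"
      by (rule has_derivative_transform_within_open[OF has_derivative_const[of 0] open_Compl[OF \<open>closed L\<close>]])
        (use False in \<open>auto simp: f_def\<close>)
    then show ?thesis using False by (simp add: f'_def[abs_def])
  qed
  have cont\<rho>: "continuous_on L (\<lambda>z. \<rho> (\<theta> i z))"
    using tame_continuous_on[OF assms(1,2)] assms(4) continuous_on_subset by blast
  have contZ: "continuous_on L (Z a)" for a
    using Ck_on_imp_continuous_on[OF Z] assms(4) continuous_on_subset by blast
  have contdZ: "continuous_on L (\<lambda>z. frechet_derivative (Z a) (at z) v)" for a v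
    using Ck_on_imp_continuous_on[OF Ck_on_frechet[OF Z]] assms(4) continuous_on_subset by blast
  have bound: "\<exists>B. \<forall>z. \<bar>f' a z v\<bar> \<le> B" for a v
  proof -
    obtain M1 where M1: "M1 \<ge> 0" "\<And>z. z \<in> L \<Longrightarrow> \<bar>\<rho> (\<theta> i z) * frechet_derivative (Z a) (at z) v\<bar> \<le> M1"
      using continuous_on_compact_abs_bound[OF assms(3) continuous_on_mult[OF cont\<rho> contdZ]] by metis
    obtain M2 where M2: "M2 \<ge> 0" "\<And>z. z \<in> L \<Longrightarrow> \<bar>Z a z\<bar> \<le> M2"
      using continuous_on_compact_abs_bound[OF assms(3) contZ] by metis
    obtain M3 where M3: "M3 \<ge> 0" "\<And>z u. z \<in> L \<Longrightarrow> \<bar>dif \<rho> i z u\<bar> \<le> M3 * norm u"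
      using tame_bounded[OF assms(1-4)] by metis
    have "\<bar>f' a z v\<bar> \<le> M1 + M3 * norm v * M2" for z
    proof (cases "z \<in> L")
      case True
      have "\<bar>dif \<rho> i z v * Z a z\<bar> \<le> M3 * norm v * M2"
        unfolding abs_mult using M2 M3 True by (intro mult_mono) auto
      then show ?thesis using M1(2)[OF True] True by (simp add: f'_def)
    next
      case False
      then show ?thesis using M1 M2 M3 by (simp add: f'_def)
    qed
    then show ?thesis by blast
  qed
  have f0: "f a z = 0" if "z \<notin> L" for a z using that by (simp add: f_def)
  have int: "integrable lborel (\<lambda>z. f' a z v)" "integral\<^sup>L lborel (\<lambda>z. f' a z v) = 0" for a v
    using integral_derivative_compact_support[OF der assms(3) f0] bound[of a v] by metis+
  define T where "T z = (\<Sum>a\<in>UNIV. f' a z (axis a 1))" for z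
  have T: "integrable lborel T" "integral\<^sup>L lborel T = 0"
    unfolding T_def[abs_def] by (auto simp: int)
  have TAE: "T z = A z + E z" for z
  proof (cases "z \<in> L")
    case True
    then have z: "z \<in> img i" using assms(4) by auto
    have lin: "linear (dif \<rho> i z)"
      using tame_has_derivative[OF assms(1,2) z] by (rule has_derivative_linear)
    have "dif \<rho> i z (V i z) = dif \<rho> i z (\<Sum>a\<in>UNIV. (V i z $ a) *\<^sub>R axis a 1)"
      using basis_expansion[of "V i z"] by (simp add: scalar_mult_eq_scaleR)
    also have "\<dots> = (\<Sum>a\<in>UNIV. V i z $ a * dif \<rho> i z (axis a 1))"
      by (simp add: linear_sum[OF lin] linear_scale[OF lin])
    finally have "P i z * dif \<rho> i z (V i z) = (\<Sum>a\<in>UNIV. dif \<rho> i z (axis a 1) * Z a z)"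
      by (simp add: Z_def sum_distrib_left algebra_simps)
    moreover have "\<rho> (\<theta> i z) * divergence i z = (\<Sum>a\<in>UNIV. \<rho> (\<theta> i z) * frechet_derivative (Z a) (at z) (axis a 1))"
      by (simp add: divergence_def Z_def[abs_def] sum_distrib_left)
    ultimately show ?thesis using True z by (simp add: T_def f'_def A_def E_def sum.distrib)
  next
    case False
    then show ?thesis using off by (simp add: T_def f'_def A_def E_def)
  qed
  have contdiv: "continuous_on L (divergence i)"
    unfolding divergence_def[abs_def] using contdZ
    by (intro continuous_on_sum) (simp add: Z_def[abs_def])
  have "integrable lborel (\<lambda>z. indicator L z *\<^sub>R (\<rho> (\<theta> i z) * divergence i z))"
    by (rule borel_integrable_compact[OF assms(3) continuous_on_mult[OF cont\<rho> contdiv]])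
  moreover have "(\<lambda>z. indicator L z *\<^sub>R (\<rho> (\<theta> i z) * divergence i z)) = A"
    unfolding A_def using off(1) assms(4) by (intro ext) (auto simp: indicator_def)
  ultimately have A: "integrable lborel A" by simp
  \<comment> \<open>\<open>E\<close> contains the derivative of \<open>\<rho>\<close>, which is only
    known to be bounded on compact sets; its integrability is inherited from \<open>T\<close> and
    \<open>A\<close>.\<close>
  have "E = (\<lambda>z. T z - A z)" using TAE by auto
  then have E: "integrable lborel E" "integral\<^sup>L lborel E = - integral\<^sup>L lborel A"
    using T A by simp_all
  show "integrable lebesgue A" "integrable lebesgue E" "integral\<^sup>L lebesgue A = - integral\<^sup>L lebesgue E"
    using integrable_lebesgue_of_lborel[OF A] integrable_lebesgue_of_lborel[OF E(1)] E(2) by simp_all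
qed

abbreviation weigh :: "('x \<Rightarrow> real) \<Rightarrow> 'i \<Rightarrow> real ^ 'm::_ \<Rightarrow> real" where
  "weigh h i \<equiv> \<lambda>z. if z \<in> img i then P i z * h (\<theta> i z) else 0"

abbreviation cut :: "('x \<Rightarrow> real) \<Rightarrow> 'i \<Rightarrow> real ^ 'm::_ \<Rightarrow> real" where
  "cut h i \<equiv> \<lambda>z. if z \<in> img i then h (\<theta> i z) else 0"

text \<open>The transformation law of \<open>P\<close> absorbs the Jacobian, so the integral of
  \<open>h\<close> against the density is independent of the chart as long as \<open>h\<close> lives
  on the overlap.\<close>

lemma integral_transfer:
  assumes i: "i \<in> I" and j: "j \<in> I" and h: "\<And>x. h x \<noteq> 0 \<Longrightarrow> x \<in> D i \<and> x \<in> D j"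
    and int: "integrable lebesgue (weigh h i)"
  shows "integrable lebesgue (weigh h j)"
    and "integral\<^sup>L lebesgue (weigh h j)
       = integral\<^sup>L lebesgue (weigh h i)"
proof -
  let ?S = "\<phi> i ` (D i \<inter> D j)"
  have S: "?S \<in> sets lebesgue"
    using open_image[OF i open_D[OF j]] by (simp add: borel_open)
  have im: "(\<lambda>z. \<phi> j (\<theta> i z)) ` ?S = \<phi> j ` (D i \<inter> D j)"
    using theta_phi[OF i] by (auto simp: image_image)
  have inj: "inj_on (\<lambda>z. \<phi> j (\<theta> i z)) ?S"
    by (rule inj_on_inverseI[where g = "\<lambda>w. \<phi> i (\<theta> j w)"]) (use theta_phi i j in auto)
  have der: "((\<lambda>z. \<phi> j (\<theta> i z)) has_derivative J i j z) (at z)" if "z \<in> ?S" for z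
    using transition_derivative[OF i j] that by auto
  have F1: "weigh h i z = \<bar>det (matrix (J i j z))\<bar> *
      (if \<phi> j (\<theta> i z) \<in> img j then P j (\<phi> j (\<theta> i z)) * h (\<theta> j (\<phi> j (\<theta> i z))) else 0)" if "z \<in> ?S" for z
    using that density_transition[OF i j] theta_phi i j phi_in_img by (auto simp: mult.assoc)
  have F2: "weigh h i z = 0" if "z \<notin> ?S" for z
  proof -
    have "h (\<theta> i z) = 0" if z: "z \<in> img i"
      using imgE[OF i z] h \<open>z \<notin> ?S\<close> by blast
    then show ?thesis by simp
  qed
  have F3: "weigh h j z = 0" if "z \<notin> (\<lambda>z. \<phi> j (\<theta> i z)) ` ?S" for z
  proof -
    have "h (\<theta> j z) = 0" if z: "z \<in> img j"
      using imgE[OF j z] h \<open>z \<notin> (\<lambda>z. \<phi> j (\<theta> i z)) ` ?S\<close> unfolding im by blast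
    then show ?thesis by simp
  qed
  show "integrable lebesgue (weigh h j)"
    by (rule lebesgue_change_of_variables(1)[OF S der inj F1 F2 F3 int])
  show "integral\<^sup>L lebesgue (weigh h j)
       = integral\<^sup>L lebesgue (weigh h i)"
    by (rule lebesgue_change_of_variables(2)[OF S der inj F1 F2 F3 int])
qed

text \<open>By \<open>local_divergence\<close> the integrals of \<open>\<rho> k\<close> times the
  divergence add up to minus the integrals of the derivatives of \<open>\<rho> k\<close> along
  \<open>V\<close>. Splitting each of these with \<open>1 = \<Sum>l. \<rho> l\<close> and moving the
  pieces to the chart of \<open>l\<close> lets the sum over \<open>k\<close> be taken pointwise,
  where it is the derivative of the constant 1. So the integrals sum to zero and, having one sign,
  vanish individually.\<close>

lemma divergence_partition:
  assumes F: "finite F" and ch: "\<And>k. k \<in> F \<Longrightarrow> ch k \<in> I" and tame: "\<And>k. k \<in> F \<Longrightarrow> tame (\<rho> k)"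
    and L: "\<And>k. k \<in> F \<Longrightarrow> compact (L k)" "\<And>k. k \<in> F \<Longrightarrow> L k \<subseteq> img (ch k)"
    and supp: "\<And>k x. k \<in> F \<Longrightarrow> \<rho> k x \<noteq> 0 \<Longrightarrow> x \<in> D (ch k) \<and> \<phi> (ch k) x \<in> L k"
    and nonneg: "\<And>k x. k \<in> F \<Longrightarrow> \<rho> k x \<ge> 0"
    and one: "\<And>x. x \<in> topspace X \<Longrightarrow> (\<Sum>k\<in>F. \<rho> k x) = 1"
    and div: "\<And>i z. i \<in> I \<Longrightarrow> z \<in> img i \<Longrightarrow> divergence i z \<le> 0"
    and k: "k \<in> F" "z \<in> img (ch k)" "\<rho> k (\<theta> (ch k) z) > 0"
  shows "divergence (ch k) z = 0"
proof -
  define A where "A k = (\<lambda>z. if z \<in> img (ch k) then \<rho> k (\<theta> (ch k) z) * divergence (ch k) z else 0)" for k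
  define E where "E k = (\<lambda>z. if z \<in> img (ch k) then P (ch k) z * dif (\<rho> k) (ch k) z (V (ch k) z) else 0)" for k
  define H where "H k l = (\<lambda>z. if z \<in> img (ch l) then P (ch l) z * (\<rho> l (\<theta> (ch l) z) * dif (\<rho> k) (ch l) z (V (ch l) z)) else 0)" for k l
  have loc: "integrable lebesgue (A k)" "integrable lebesgue (E k)"
    "integral\<^sup>L lebesgue (A k) = - integral\<^sup>L lebesgue (E k)" if "k \<in> F" for k
    using local_divergence[OF tame[OF that] ch[OF that] L(1)[OF that] L(2)[OF that] supp[OF that]]
    unfolding A_def E_def by blast+
  have top: "\<theta> i z \<in> topspace X" if "i \<in> I" "z \<in> img i" for i z
    using imgE[OF that] D_subset[OF that(1)] by blast
  have le1: "\<rho> l x \<le> 1" if "x \<in> topspace X" "l \<in> F" for l x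
    using member_le_sum[OF that(2), of "\<lambda>l. \<rho> l x"] one[OF that(1)] nonneg F by auto
  have EH: "integrable lebesgue (H k l)" "integrable lebesgue (\<lambda>z. cut (\<rho> l) (ch k) z * E k z)"
    "integral\<^sup>L lebesgue (H k l) = integral\<^sup>L lebesgue (\<lambda>z. cut (\<rho> l) (ch k) z * E k z)"
    if k: "k \<in> F" and l: "l \<in> F" for k l
  proof -
    \<comment> \<open>The global function \<open>\<rho> l\<close> times the derivative of
      \<open>\<rho> k\<close> along \<open>V\<close>, written in the chart of \<open>k\<close> and
      set to zero off the overlap. Its weighted expressions in the two charts are the integrands of
      \<open>EH\<close>.\<close>
    define h where "h x = (if x \<in> D (ch k) \<and> x \<in> D (ch l) then
        \<rho> l x * dif (\<rho> k) (ch k) (\<phi> (ch k) x) (V (ch k) (\<phi> (ch k) x)) else 0)" for x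
    have ik: "ch k \<in> I" and il: "ch l \<in> I" using ch k l by auto
    have G: "(weigh h (ch k))
        = (\<lambda>z. cut (\<rho> l) (ch k) z * E k z)"
    proof (intro ext)
      fix z
      show "weigh h (ch k) z
        = cut (\<rho> l) (ch k) z * E k z"
      proof (cases "z \<in> img (ch k)")
        case True
        obtain x where x: "x \<in> D (ch k)" "z = \<phi> (ch k) x" "\<theta> (ch k) z = x" using imgE[OF ik True] by blast
        show ?thesis using True x supp[OF l, of x] by (auto simp: h_def E_def)
      qed simp
    qed
    have "(\<lambda>z. indicator (img (ch k)) z *\<^sub>R \<rho> l (\<theta> (ch k) z)) \<in> borel_measurable borel"
      by (rule borel_measurable_continuous_on_indicator)
        (use open_img'[OF ik] tame_continuous_on[OF tame[OF l] ik] in auto)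
    moreover have "(\<lambda>z. indicator (img (ch k)) z *\<^sub>R \<rho> l (\<theta> (ch k) z))
        = cut (\<rho> l) (ch k)" by (auto simp: indicator_def)
    ultimately have meas: "cut (\<rho> l) (ch k) \<in> borel_measurable lebesgue"
      by (simp add: measurable_completion)
    show int: "integrable lebesgue (\<lambda>z. cut (\<rho> l) (ch k) z * E k z)"
    proof (rule Bochner_Integration.integrable_bound[OF loc(2)[OF k]])
      show "(\<lambda>z. cut (\<rho> l) (ch k) z * E k z) \<in> borel_measurable lebesgue"
        by (intro borel_measurable_times meas borel_measurable_integrable[OF loc(2)[OF k]])
      have "norm (cut (\<rho> l) (ch k) z * E k z) \<le> norm (E k z)" for z
        using le1[OF top[OF ik] l, of z] nonneg[OF l] by (auto simp: abs_mult intro!: mult_left_le_one_le)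
      then show "AE z in lebesgue. norm (cut (\<rho> l) (ch k) z * E k z) \<le> norm (E k z)"
        by simp
    qed
    have HH: "(weigh h (ch l)) = H k l"
    proof (intro ext)
      fix z
      show "weigh h (ch l) z = H k l z"
      proof (cases "z \<in> img (ch l)")
        case True
        obtain x where x: "x \<in> D (ch l)" "z = \<phi> (ch l) x" "\<theta> (ch l) z = x" using imgE[OF il True] by blast
        show ?thesis
        proof (cases "x \<in> D (ch k)")
          case k': True
          have "dif (\<rho> k) (ch k) (\<phi> (ch k) x) (V (ch k) (\<phi> (ch k) x)) = dif (\<rho> k) (ch l) z (V (ch l) z)"
            using dif_transition[OF tame[OF k] ik il k' x(1)] field_transition[OF ik il k' x(1)] x(2) by simp
          then show ?thesis using True k' x by (simp add: H_def h_def)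
        next
          case False
          \<comment> \<open>Off the chart of \<open>k\<close> the derivative of
            \<open>\<rho> k\<close> is zero, which agrees with the default value of
            \<open>h\<close>.\<close>
          have "x \<notin> \<theta> (ch k) ` L k"
            using False L(2)[OF k] imgE[OF ik] by blast
          then have "dif (\<rho> k) (ch l) z (V (ch l) z) = 0"
            using tame_support[OF ik L(1)[OF k] L(2)[OF k] supp[OF k] il x(1)] x(2) by simp
          then show ?thesis using True False x by (simp add: H_def h_def)
        qed
      qed (simp add: H_def)
    qed
    have h0: "\<And>x. h x \<noteq> 0 \<Longrightarrow> x \<in> D (ch k) \<and> x \<in> D (ch l)" by (simp add: h_def split: if_splits)
    show "integrable lebesgue (H k l)"
      and "integral\<^sup>L lebesgue (H k l) = integral\<^sup>L lebesgue (\<lambda>z. cut (\<rho> l) (ch k) z * E k z)"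
      using integral_transfer[OF ik il h0 int[folded G]] unfolding HH G by blast+
  qed
  have "integral\<^sup>L lebesgue (E k) = (\<Sum>l\<in>F. integral\<^sup>L lebesgue (H k l))" if k: "k \<in> F" for k
  proof -
    have "(\<Sum>l\<in>F. cut (\<rho> l) (ch k) z * E k z) = E k z" for z
    proof (cases "z \<in> img (ch k)")
      case True
      then show ?thesis using one[OF top[OF ch[OF k] True]] by (simp add: sum_distrib_right[symmetric])
    qed (simp add: E_def)
    then have "integral\<^sup>L lebesgue (E k) = integral\<^sup>L lebesgue
        (\<lambda>z. \<Sum>l\<in>F. cut (\<rho> l) (ch k) z * E k z)" by simp
    also have "\<dots> = (\<Sum>l\<in>F. integral\<^sup>L lebesgue (\<lambda>z. cut (\<rho> l) (ch k) z * E k z))"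
      by (rule Bochner_Integration.integral_sum) (rule EH(2)[OF k])
    finally show ?thesis using EH(3)[OF k] by simp
  qed
  then have "(\<Sum>k\<in>F. integral\<^sup>L lebesgue (E k)) = (\<Sum>k\<in>F. \<Sum>l\<in>F. integral\<^sup>L lebesgue (H k l))" by simp
  also have "\<dots> = (\<Sum>l\<in>F. \<Sum>k\<in>F. integral\<^sup>L lebesgue (H k l))" by (rule sum.swap)
  also have "\<dots> = (\<Sum>l\<in>F. integral\<^sup>L lebesgue (\<lambda>z. \<Sum>k\<in>F. H k l z))"
    by (intro sum.cong refl Bochner_Integration.integral_sum[symmetric] EH(1))
  also have "\<dots> = 0"
  proof (intro sum.neutral ballI)
    fix l assume l: "l \<in> F"
    have "(\<Sum>k\<in>F. H k l z) = 0" for z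
    proof (cases "z \<in> img (ch l)")
      case True
      have "((\<lambda>z. \<Sum>k\<in>F. \<rho> k (\<theta> (ch l) z)) has_derivative (\<lambda>u. 0)) (at z)"
        by (rule has_derivative_transform_within_open[OF has_derivative_const[of 1] open_img'[OF ch[OF l]] True])
          (use one[OF top[OF ch[OF l]]] in auto)
      then have "dif (\<lambda>x. \<Sum>k\<in>F. \<rho> k x) (ch l) z = (\<lambda>u. 0)" by (rule dif_eqI)
      then have "(\<Sum>k\<in>F. dif (\<rho> k) (ch l) z (V (ch l) z)) = 0"
        using tame_sum(2)[where F = F and \<rho> = \<rho>, OF F tame ch[OF l] True, where u = "V (ch l) z"] by simp
      then show ?thesis using True by (simp add: H_def sum_distrib_left[symmetric])
    qed (simp add: H_def)
    then show "integral\<^sup>L lebesgue (\<lambda>z. \<Sum>k\<in>F. H k l z) = 0" by simp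
  qed
  finally have sumA: "(\<Sum>k\<in>F. integral\<^sup>L lebesgue (\<lambda>z. - A k z)) = 0"
    using loc(3) by (simp add: sum_negf)
  have Apos: "- A k z \<ge> 0" if "k \<in> F" for k z
    using nonneg[OF that] div[OF ch[OF that]] by (auto simp: A_def mult_nonneg_nonpos)
  have "\<forall>k\<in>F. integral\<^sup>L lebesgue (\<lambda>z. - A k z) = 0"
    using iffD1[OF sum_nonneg_eq_0_iff[OF F Bochner_Integration.integral_nonneg[OF Apos]] sumA] .
  then have "integral\<^sup>L lebesgue (\<lambda>z. - A k z) = 0" using k by blast
  moreover have "continuous_on (img (ch k)) (\<lambda>z. - A k z)"
  proof -
    have "continuous_on (img (ch k)) (\<lambda>z. frechet_derivative (\<lambda>z. P (ch k) z * V (ch k) z $ a) (at z) v)" for a v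
      using Ck_on_imp_continuous_on[OF Ck_on_frechet] field_C1[OF ch[OF k(1)]] unfolding img_def One_nat_def by blast
    then have "continuous_on (img (ch k)) (\<lambda>z. - (\<rho> k (\<theta> (ch k) z) * divergence (ch k) z))"
      unfolding divergence_def[abs_def]
      by (intro continuous_intros tame_continuous_on tame ch k)
    then show ?thesis by (rule continuous_on_eq) (simp add: A_def)
  qed
  ultimately have "- A k z = 0"
    using lebesgue_integral_zero_nonneg_continuous[OF Bochner_Integration.integrable_minus[OF loc(1)[OF k(1)]] _ Apos[OF k(1)]
        open_img'[OF ch[OF k(1)]]] k(2) by blast
  then show ?thesis using k by (simp add: A_def)
qed

theorem divergence_nonpos_imp_zero:
  assumes div: "\<And>i z. i \<in> I \<Longrightarrow> z \<in> img i \<Longrightarrow> divergence i z \<le> 0"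
    and c: "c \<in> I" "z \<in> img c"
  shows "divergence c z = 0"
proof -
  obtain p where p: "p \<in> D c" "z = \<phi> c p" "\<theta> c z = p" using imgE[OF c] by blast
  have "\<forall>x\<in>topspace X. \<exists>i\<in>I. x \<in> D i" using cover by blast
  then obtain ch0 where ch0: "\<And>x. x \<in> topspace X \<Longrightarrow> ch0 x \<in> I \<and> x \<in> D (ch0 x)" by metis
  \<comment> \<open>The chart chosen at \<open>p\<close> is the given \<open>c\<close>, and
    \<open>p\<close> is added to the finite subcover below. The bump centred at \<open>p\<close> is
    then positive at \<open>z\<close>, which places the conclusion at the prescribed chart and
    point.\<close>
  define ch where "ch x = (if x = p then c else ch0 x)" for x
  have ch: "ch x \<in> I" "x \<in> D (ch x)" if "x \<in> topspace X" for x
    using ch0[OF that] p c by (auto simp: ch_def)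
  have "\<forall>x\<in>topspace X. \<exists>r>0. cball (\<phi> (ch x) x) r \<subseteq> img (ch x)"
    using open_img' ch phi_in_img by (meson open_contains_cball)
  then obtain r where r: "\<And>x. x \<in> topspace X \<Longrightarrow> r x > 0" "\<And>x. x \<in> topspace X \<Longrightarrow> cball (\<phi> (ch x) x) (r x) \<subseteq> img (ch x)"
    by metis
  define U where "U x = {y \<in> D (ch x). \<phi> (ch x) y \<in> ball (\<phi> (ch x) x) (r x)}" for x
  have U_open: "openin X (U x)" if x: "x \<in> topspace X" for x
  proof -
    have cm: "continuous_map (subtopology X (D (ch x))) (top_of_set (img (ch x))) (\<phi> (ch x))"
      using homeo[OF ch(1)[OF x]] by (simp add: homeomorphic_maps_def img_def)
    have "openin (top_of_set (img (ch x))) (ball (\<phi> (ch x) x) (r x))"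
      using r(2)[OF x] open_img'[OF ch(1)[OF x]] by (simp add: openin_open_eq ball_subset_cball[THEN subset_trans])
    from openin_continuous_map_preimage[OF cm this]
    have "openin (subtopology X (D (ch x))) {y \<in> D (ch x). \<phi> (ch x) y \<in> ball (\<phi> (ch x) x) (r x)}"
      using D_subset[OF ch(1)[OF x]] by (simp add: topspace_subtopology Int_absorb1)
    then show ?thesis
      using open_D[OF ch(1)[OF x]] by (simp add: U_def openin_open_subtopology)
  qed
  have "\<exists>\<F>. finite \<F> \<and> \<F> \<subseteq> U ` topspace X \<and> topspace X \<subseteq> \<Union>\<F>"
  proof (rule compactinD[OF compact_X[unfolded compact_space_def]])
    show "topspace X \<subseteq> \<Union> (U ` topspace X)" using ch r by (auto simp: U_def)
  qed (use U_open in auto)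
  then obtain G where G: "finite G" "G \<subseteq> topspace X" "topspace X \<subseteq> (\<Union>x\<in>G. U x)"
    by (metis finite_subset_image)
  define F where "F = insert p G"
  have p_top: "p \<in> topspace X" using p D_subset[OF c(1)] by auto
  have F: "finite F" "F \<subseteq> topspace X" using G p_top by (auto simp: F_def)
  define \<psi> where "\<psi> k = bump (ch k) (\<phi> (ch k) k) (r k)" for k
  have \<psi>_nonneg: "\<psi> k x \<ge> 0" for k x by (simp add: \<psi>_def bump_def)
  have \<psi>_pos: "\<psi> k x > 0" if "k \<in> topspace X" "x \<in> U k" for k x
  proof -
    have "norm (\<phi> (ch k) x - \<phi> (ch k) k) < r k"
      using that by (simp add: U_def dist_norm norm_minus_commute)
    then have "(norm (\<phi> (ch k) x - \<phi> (ch k) k))\<^sup>2 < (r k)\<^sup>2" by (intro power_strict_mono) auto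
    then show ?thesis using that by (simp add: \<psi>_def bump_def U_def power2_norm_eq_inner max_def)
  qed
  define s where "s x = (\<Sum>k\<in>F. \<psi> k x)" for x
  have tame\<psi>: "tame (\<psi> k)" if "k \<in> F" for k
  proof -
    have k: "k \<in> topspace X" using that F by blast
    show ?thesis unfolding \<psi>_def by (rule tame_bump[OF ch(1)[OF k] r(1)[OF k] r(2)[OF k]])
  qed
  have tame_s: "tame s" unfolding s_def[abs_def] by (rule tame_sum(1)[OF F(1) tame\<psi>])
  have s_pos: "s x > 0" if x: "x \<in> topspace X" for x
  proof -
    obtain k where k: "k \<in> G" "x \<in> U k" using G x by blast
    show ?thesis unfolding s_def
      by (rule sum_pos2[OF F(1), of k]) (use k G F_def \<psi>_pos \<psi>_nonneg in auto)
  qed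
  define \<rho> where "\<rho> k x = \<psi> k x / s x" for k x
  have s_nonneg: "s x \<ge> 0" for x unfolding s_def by (intro sum_nonneg \<psi>_nonneg)
  have "divergence (ch p) z = 0"
  proof (rule divergence_partition[where F = F and ch = ch and \<rho> = \<rho> and L = "\<lambda>k. cball (\<phi> (ch k) k) (r k)"])
    show "tame (\<rho> k)" if "k \<in> F" for k
      unfolding \<rho>_def by (rule tame_divide[OF tame\<psi>[OF that] tame_s s_pos])
    show "x \<in> D (ch k) \<and> \<phi> (ch k) x \<in> cball (\<phi> (ch k) k) (r k)" if "k \<in> F" "\<rho> k x \<noteq> 0" for k x
      using bump_support[of "ch k" "\<phi> (ch k) k" "r k" x] that F r(1)[of k] by (auto simp: \<rho>_def \<psi>_def)
    show "0 \<le> \<rho> k x" for k x unfolding \<rho>_def by (intro divide_nonneg_nonneg \<psi>_nonneg s_nonneg)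
    show "(\<Sum>k\<in>F. \<rho> k x) = 1" if "x \<in> topspace X" for x
      using s_pos[OF that] by (simp add: \<rho>_def sum_divide_distrib[symmetric] s_def[symmetric])
    show "z \<in> img (ch p)" using c by (simp add: ch_def)
    show "0 < \<rho> p (\<theta> (ch p) z)"
      using \<psi>_pos[OF p_top, of p] s_pos[OF p_top] p r(1)[OF p_top] ch(2)[OF p_top]
      by (simp add: \<rho>_def ch_def U_def)
    show "cball (\<phi> (ch k) k) (r k) \<subseteq> img (ch k)" if "k \<in> F" for k
      using r(2) F(2) that by (metis subsetD)
  qed (use F ch div in \<open>auto simp: F_def\<close>)
  then show ?thesis by (simp add: ch_def)
qed

end

section \<open>Hermitian linear algebra\<close>

lemma bilinear_rules:
  fixes w :: "'a::real_vector \<Rightarrow> 'b::real_vector \<Rightarrow> 'c::real_vector"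
  assumes "bilinear w"
  shows "w (u + u') v = w u v + w u' v" "w u (v + v') = w u v + w u v'"
    "w (r *\<^sub>R u) v = r *\<^sub>R w u v" "w u (r *\<^sub>R v) = r *\<^sub>R w u v"
    "w (- u) v = - w u v" "w u (- v) = - w u v"
    "w (\<Sum>i\<in>I. f i) v = (\<Sum>i\<in>I. w (f i) v)" "w u (\<Sum>i\<in>I. g i) = (\<Sum>i\<in>I. w u (g i))"
    "w 0 v = 0" "w u 0 = 0"
    "w (u - u') v = w u v - w u' v" "w u (v - v') = w u v - w u v'"
proof -
  have l1: "linear (w x)" and l2: "linear (\<lambda>x. w x y)" for x y
    using assms unfolding bilinear_def by auto
  show "w (u + u') v = w u v + w u' v" "w u (v + v') = w u v + w u v'"
    "w (r *\<^sub>R u) v = r *\<^sub>R w u v" "w u (r *\<^sub>R v) = r *\<^sub>R w u v"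
    "w (- u) v = - w u v" "w u (- v) = - w u v"
    "w (\<Sum>i\<in>I. f i) v = (\<Sum>i\<in>I. w (f i) v)" "w u (\<Sum>i\<in>I. g i) = (\<Sum>i\<in>I. w u (g i))"
    "w 0 v = 0" "w u 0 = 0"
    "w (u - u') v = w u v - w u' v" "w u (v - v') = w u v - w u v'"
    by (fact linear_add[OF l2] linear_add[OF l1] linear_scale[OF l2] linear_scale[OF l1] linear_neg[OF l2]
      linear_neg[OF l1] linear_sum[OF l2] linear_sum[OF l1] linear_0[OF l2] linear_0[OF l1]
      linear_diff[OF l2] linear_diff[OF l1])+
qed

lemma smult_complex: "c *s (u :: complex ^ 'n) = Re c *\<^sub>R u + Im c *\<^sub>R (\<i> *s u)"
  by (simp add: vec_eq_iff complex_eq_iff)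

lemma smult_real_linear:
  "c *s (x + y :: complex ^ 'n) = c *s x + c *s y" "c *s (r *\<^sub>R (x :: complex ^ 'n)) = r *\<^sub>R (c *s x)"
  by (simp_all add: vec_eq_iff algebra_simps)

lemma ii_smult [simp]: "\<i> *s (\<i> *s (u :: complex ^ 'n)) = - u"
  by (simp add: vec_eq_iff)

definition form_11 :: "(complex ^ 'n \<Rightarrow> complex ^ 'n \<Rightarrow> real) \<Rightarrow> bool" where
  "form_11 w \<longleftrightarrow> bilinear w \<and> (\<forall>u. w u u = 0) \<and> (\<forall>u v. w (\<i> *s u) (\<i> *s v) = w u v)"

definition pos_11 :: "(complex ^ 'n \<Rightarrow> complex ^ 'n \<Rightarrow> real) \<Rightarrow> bool" where
  "pos_11 w \<longleftrightarrow> form_11 w \<and> (\<forall>u. u \<noteq> 0 \<longrightarrow> w u (\<i> *s u) > 0)"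

lemma form_11_anti:
  assumes "form_11 w"
  shows "w u v = - w v u"
proof -
  have b: "bilinear w" and a: "\<And>u. w u u = 0" using assms by (auto simp: form_11_def)
  show ?thesis
    using a[of "u + v"] a[of u] a[of v] unfolding bilinear_rules(1,2)[OF b] by linarith
qed

text \<open>Antisymmetry is left out because the form will also be used for a Hessian that is not known to be
  symmetric.\<close>

definition J_bilinear :: "(complex ^ 'n \<Rightarrow> complex ^ 'n \<Rightarrow> real) \<Rightarrow> bool" where
  "J_bilinear w \<longleftrightarrow> bilinear w \<and> (\<forall>u v. w (\<i> *s u) (\<i> *s v) = w u v)"

lemma form_11_J_bilinear: "form_11 w \<Longrightarrow> J_bilinear w"
  by (simp add: form_11_def J_bilinear_def)

lemma J_bilinear_J:
  assumes "J_bilinear w"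
  shows "w (\<i> *s u) v = - w u (\<i> *s v)"
proof -
  have b: "bilinear w" and J: "\<And>u v. w (\<i> *s u) (\<i> *s v) = w u v" using assms by (auto simp: J_bilinear_def)
  show ?thesis using J[of "\<i> *s u" v] by (simp add: bilinear_rules[OF b])
qed

lemma form_11_J:
  assumes "form_11 w"
  shows "w (\<i> *s u) v = - w u (\<i> *s v)" "w u (\<i> *s v) = w v (\<i> *s u)"
proof -
  show 1: "w (\<i> *s u) v = - w u (\<i> *s v)" for u v
    by (rule J_bilinear_J[OF form_11_J_bilinear[OF assms]])
  show "w u (\<i> *s v) = w v (\<i> *s u)"
    using 1[of u v] form_11_anti[OF assms, of v "\<i> *s u"] by simp
qed

text \<open>The sesquilinear form belonging to a \<open>J_bilinear\<close> form, linear in the first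
  argument, with the normalisation that makes \<open>metric_matrix\<close> its matrix in the
  standard basis.\<close>

definition herm :: "(complex ^ 'n \<Rightarrow> complex ^ 'n \<Rightarrow> real) \<Rightarrow> complex ^ 'n \<Rightarrow> complex ^ 'n \<Rightarrow> complex" where
  "herm w u v = (complex_of_real (w u (\<i> *s v)) - \<i> * complex_of_real (w u v)) / 2"

lemma herm_linear:
  assumes "J_bilinear w"
  shows "herm w (u + u') v = herm w u v + herm w u' v" "herm w u (v + v') = herm w u v + herm w u v'"
    "herm w (c *s u) v = c * herm w u v" "herm w u (c *s v) = cnj c * herm w u v"
proof -
  have b: "bilinear w" using assms by (simp add: J_bilinear_def)
  note J = J_bilinear_J[OF assms]
  show "herm w (u + u') v = herm w u v + herm w u' v" "herm w u (v + v') = herm w u v + herm w u v'"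
    by (auto simp: herm_def bilinear_rules[OF b] vector_add_ldistrib algebra_simps add_divide_distrib diff_divide_distrib)
  have iu: "\<i> *s (c *s v) = Re c *\<^sub>R (\<i> *s v) - Im c *\<^sub>R v" for v :: "complex ^ 'n"
    by (simp add: vec_eq_iff complex_eq_iff)
  show "herm w (c *s u) v = c * herm w u v"
    unfolding smult_complex[of c u] herm_def
    by (simp add: bilinear_rules[OF b] J complex_eq_iff algebra_simps add_divide_distrib diff_divide_distrib)
  show "herm w u (c *s v) = cnj c * herm w u v"
    unfolding iu herm_def unfolding smult_complex[of c v] diff_conv_add_uminus bilinear_rules[OF b]
    by (simp add: complex_eq_iff algebra_simps add_divide_distrib diff_divide_distrib)
qed

lemma herm_sum:
  assumes "J_bilinear w" "finite I" "finite K"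
  shows "herm w (\<Sum>i\<in>I. a i *s e i) (\<Sum>k\<in>K. b k *s f k) = (\<Sum>i\<in>I. \<Sum>k\<in>K. a i * cnj (b k) * herm w (e i) (f k))"
proof -
  have z: "herm w 0 v = 0" "herm w v 0 = 0" for v
    using herm_linear(3)[OF assms(1), of 0 0 v] herm_linear(4)[OF assms(1), of v 0 0] by auto
  have 1: "herm w (\<Sum>i\<in>I. a i *s e i) v = (\<Sum>i\<in>I. a i * herm w (e i) v)" for v
    using assms(2) by induction (simp_all add: z herm_linear[OF assms(1)])
  have 2: "herm w u (\<Sum>k\<in>K. b k *s f k) = (\<Sum>k\<in>K. cnj (b k) * herm w u (f k))" for u
    using assms(3) by induction (simp_all add: z herm_linear[OF assms(1)])
  show ?thesis by (simp only: 1) (simp only: 2 sum_distrib_left mult.assoc)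
qed

definition form_matrix :: "(complex ^ 'n \<Rightarrow> complex ^ 'n \<Rightarrow> real) \<Rightarrow> complex ^ 'n ^ 'n" where
  "form_matrix w = (\<chi> j k. (complex_of_real (w (axis j 1) (axis k \<i>)) - \<i> * complex_of_real (w (axis j 1) (axis k 1))) / 2)"

lemma smult_axis: "c *s (axis k a :: complex ^ 'n) = axis k (c * a)"
  by (simp add: vec_eq_iff axis_def)

lemma form_matrix_herm: "form_matrix w $ j $ k = herm w (axis j 1) (axis k 1)"
  by (simp add: form_matrix_def herm_def smult_axis)

text \<open>A change of frame multiplies the matrix of the form by the frame matrix on one side and
  by its conjugate transpose on the other, so the determinant acquires a squared modulus.\<close>

lemma det_herm_frame:
  fixes e :: "'n::finite \<Rightarrow> complex ^ 'n"
  assumes "form_11 w"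
  shows "det (\<chi> j k. herm w (e j) (e k)) = complex_of_real ((norm (det (\<chi> j. e j)))\<^sup>2) * det (form_matrix w)"
proof -
  let ?M = "\<chi> j. e j"
  let ?N = "\<chi> j k. cnj (e k $ j)"
  have "herm w (e j) (e k) = (\<Sum>a\<in>UNIV. \<Sum>b\<in>UNIV. e j $ a * cnj (e k $ b) * herm w (axis a 1) (axis b 1))" for j k
    using herm_sum[OF form_11_J_bilinear[OF assms], of UNIV UNIV "\<lambda>a. e j $ a" "\<lambda>a. axis a 1" "\<lambda>a. e k $ a" "\<lambda>a. axis a 1"]
    by (simp add: basis_expansion)
  then have "(\<chi> j k. herm w (e j) (e k)) = ?M ** (form_matrix w ** ?N)"
    by (simp add: matrix_matrix_mult_def vec_eq_iff form_matrix_herm sum_distrib_left algebra_simps)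
  moreover have "det ?N = cnj (det ?M)"
  proof -
    have "det ?N = det (transpose ?N)" by simp
    also have "\<dots> = cnj (det ?M)" by (simp add: det_def transpose_def)
    finally show ?thesis .
  qed
  moreover have "det ?M * cnj (det ?M) = complex_of_real ((norm (det ?M))\<^sup>2)"
    by (simp only: complex_norm_square)
  ultimately show ?thesis by (simp add: det_mul algebra_simps)
qed

text \<open>Orthonormality for \<open>2 * herm w\<close>, whose real and imaginary parts are
  \<open>w u (\<i> *s v)\<close> and \<open>- w u v\<close>.\<close>

definition unitary_frame :: "(complex ^ 'n \<Rightarrow> complex ^ 'n \<Rightarrow> real) \<Rightarrow> ('n \<Rightarrow> complex ^ 'n) \<Rightarrow> bool" where
  "unitary_frame w e \<longleftrightarrow> (\<forall>j k. w (e j) (\<i> *s e k) = of_bool (j = k) \<and> w (e j) (e k) = 0)"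

definition diagonal_frame :: "(complex ^ 'n \<Rightarrow> complex ^ 'n \<Rightarrow> real) \<Rightarrow> ('n \<Rightarrow> complex ^ 'n) \<Rightarrow> ('n \<Rightarrow> real) \<Rightarrow> bool" where
  "diagonal_frame w e l \<longleftrightarrow> (\<forall>j k. w (e j) (\<i> *s e k) = (if j = k then l j else 0) \<and> w (e j) (e k) = 0)"

lemma unitary_diagonal: "unitary_frame w e \<longleftrightarrow> diagonal_frame w e (\<lambda>j. 1)"
  by (simp add: unitary_frame_def diagonal_frame_def of_bool_def)

lemma det_diagonal_frame:
  fixes e :: "'n::finite \<Rightarrow> complex ^ 'n"
  assumes "form_11 w" "diagonal_frame w e l"
  shows "complex_of_real ((norm (det (\<chi> j. e j)))\<^sup>2) * det (form_matrix w) = complex_of_real (\<Prod>j\<in>UNIV. l j / 2)"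
proof -
  have "det (\<chi> j k. herm w (e j) (e k)) = (\<Prod>j\<in>UNIV. (\<chi> j k. herm w (e j) (e k)) $ j $ j)"
    by (rule det_diagonal) (use assms(2) in \<open>auto simp: herm_def diagonal_frame_def\<close>)
  also have "\<dots> = complex_of_real (\<Prod>j\<in>UNIV. l j / 2)"
    using assms(2) by (simp add: herm_def diagonal_frame_def)
  finally show ?thesis using det_herm_frame[OF assms(1), of e] by simp
qed

text \<open>The Gram determinant of a unitary frame is nonzero, so the frame is a basis. Pairing
  with \<open>e k\<close> then reads off the coefficients, which are
  \<open>2 * herm w v (e k)\<close>.\<close>

lemma frame_expansion:
  fixes e :: "'n::finite \<Rightarrow> complex ^ 'n"
  assumes "form_11 w" "unitary_frame w e"
  shows "v = (\<Sum>j\<in>UNIV. (complex_of_real (w (e j) (\<i> *s v)) + \<i> * complex_of_real (w (e j) v)) *s e j)"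
proof -
  have "det (\<chi> j. e j) \<noteq> 0"
    using det_diagonal_frame[OF assms(1) assms(2)[unfolded unitary_diagonal]] by (auto simp: prod_zero_iff)
  then have "det (transpose (\<chi> j. e j)) \<noteq> 0" by simp
  then obtain B where "transpose (\<chi> j. e j) ** B = mat 1"
    using invertible_det_nz unfolding invertible_def by blast
  then have "transpose (\<chi> j. e j) *v (B *v v) = v" by (simp add: matrix_vector_mul_assoc)
  then have d: "v = (\<Sum>j\<in>UNIV. (B *v v) $ j *s e j)"
    by (simp add: matrix_mult_transpose_dot_column matrix_vector_mult_def transpose_def vec_eq_iff algebra_simps)
  have "(B *v v) $ k = complex_of_real (w (e k) (\<i> *s v)) + \<i> * complex_of_real (w (e k) v)" for k
  proof -
    have "herm w (e j) (e k) = (if j = k then 1 / 2 else 0)" for j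
      using assms(2) by (simp add: herm_def unitary_frame_def)
    then have "herm w v (e k) = (\<Sum>j\<in>UNIV. (B *v v) $ j * (if j = k then 1 / 2 else 0))"
      using herm_sum[OF form_11_J_bilinear[OF assms(1)], of UNIV "{k}" "\<lambda>j. (B *v v) $ j" e "\<lambda>j. 1" e, folded d] by simp
    also have "\<dots> = (B *v v) $ k / 2" by (simp add: if_distrib cong: if_cong)
    finally have hk: "herm w v (e k) = (B *v v) $ k / 2" .
    have "(B *v v) $ k = 2 * herm w v (e k)" unfolding hk by simp
    also have "\<dots> = complex_of_real (w (e k) (\<i> *s v)) + \<i> * complex_of_real (w (e k) v)"
      unfolding herm_def form_11_J(2)[OF assms(1), of v "e k"] form_11_anti[OF assms(1), of v "e k"]
      by simp
    finally show ?thesis .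
  qed
  then show ?thesis using d by simp
qed

lemma forms_eq_on_frame:
  fixes e :: "'n::finite \<Rightarrow> complex ^ 'n"
  assumes "form_11 w" "form_11 w'" "unitary_frame w e" "unitary_frame w' e"
  shows "w u v = w' u v"
proof -
  obtain a where a: "u = (\<Sum>j\<in>UNIV. a j *s e j)" using frame_expansion[OF assms(1,3)] by metis
  obtain b where b: "v = (\<Sum>j\<in>UNIV. b j *s e j)" using frame_expansion[OF assms(1,3)] by metis
  have "herm w (e j) (e k) = herm w' (e j) (e k)" for j k
    using assms(3,4) by (simp add: herm_def unitary_frame_def)
  then have "herm w u v = herm w' u v"
    unfolding a b by (simp add: herm_sum form_11_J_bilinear assms(1,2))
  then show ?thesis by (simp add: herm_def complex_eq_iff)
qed

section \<open>Simultaneous diagonalisation of two (1,1)-forms\<close>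

lemma psd_kernel:
  fixes B :: "'a::real_vector \<Rightarrow> 'a \<Rightarrow> real"
  assumes "bilinear B" "\<And>u v. B u v = B v u" "subspace U" "\<And>u. u \<in> U \<Longrightarrow> B u u \<ge> 0"
    and "e \<in> U" "v \<in> U" "B e e = 0"
  shows "B e v = 0"
proof (rule ccontr)
  assume n: "B e v \<noteq> 0"
  \<comment> \<open>As \<open>B e e = 0\<close>, the value of the quadratic form at
    \<open>t *\<^sub>R e + v\<close> is affine in \<open>t\<close>; this \<open>t\<close> makes it
    -1.\<close>
  define t where "t = - (B v v + 1) / (2 * B e v)"
  have "t *\<^sub>R e + v \<in> U" using assms(3,5,6) by (simp add: subspace_add subspace_scale)
  then have "0 \<le> B (t *\<^sub>R e + v) (t *\<^sub>R e + v)" by (rule assms(4))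
  also have "\<dots> = 2 * t * B e v + B v v"
    using assms(2)[of v e] assms(7) by (simp add: bilinear_rules[OF assms(1)])
  also have "2 * t * B e v = - (B v v + 1)" using n by (simp add: t_def)
  finally show False by simp
qed

text \<open>The vector \<open>e\<close> maximises \<open>w1(u, Ju) / w0(u, Ju)\<close> with maximum \<open>l\<close>, so that it lies in the kernel of
  the semidefinite form \<open>l w0 - w1\<close>.\<close>

lemma maximal_vector:
  fixes w0 w1 :: "complex ^ 'n::finite \<Rightarrow> complex ^ 'n \<Rightarrow> real"
  assumes w0: "pos_11 w0" and w1: "form_11 w1"
    and U: "subspace U" "\<And>v. v \<in> U \<Longrightarrow> \<i> *s v \<in> U" and ne: "v0 \<in> U" "v0 \<noteq> 0"
  obtains e l where "e \<in> U" "w0 e (\<i> *s e) = 1" "\<And>v. v \<in> U \<Longrightarrow> w1 e v = l * w0 e v"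
proof -
  have f0: "form_11 w0" and p0: "\<And>u. u \<noteq> 0 \<Longrightarrow> w0 u (\<i> *s u) > 0" using w0 by (auto simp: pos_11_def)
  have b0: "bilinear w0" and b1: "bilinear w1" using f0 w1 by (auto simp: form_11_def)
  have cont: "continuous_on S (\<lambda>u. w u (\<i> *s u))" if "bilinear w" for w :: "complex ^ 'n \<Rightarrow> complex ^ 'n \<Rightarrow> real" and S
  proof -
    have bb: "bounded_bilinear w" using that by (simp add: bilinear_conv_bounded_bilinear)
    have "linear (\<lambda>u :: complex ^ 'n. \<i> *s u)"
      by (rule linearI) (simp_all only: smult_real_linear)
    then have "continuous_on S (\<lambda>u :: complex ^ 'n. \<i> *s u)" by (rule linear_continuous_on[OF linear_conv_bounded_linear[THEN iffD1]])
    then show ?thesis by (intro bounded_bilinear.continuous_on[OF bb] continuous_on_id)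
  qed
  let ?S = "sphere 0 1 \<inter> U"
  let ?q = "\<lambda>u. w1 u (\<i> *s u) / w0 u (\<i> *s u)"
  have "compact ?S" using closed_subspace[OF U(1)] by (intro compact_Int_closed compact_sphere)
  moreover have "(1 / norm v0) *\<^sub>R v0 \<in> ?S" using ne U(1) by (simp add: subspace_scale)
  moreover have "continuous_on ?S ?q"
  proof (intro continuous_on_divide cont b0 b1 ballI)
    fix u assume "u \<in> ?S"
    then have "u \<noteq> 0" by auto
    then show "w0 u (\<i> *s u) \<noteq> 0" using p0 less_imp_neq by metis
  qed
  ultimately obtain m where m: "m \<in> ?S" "\<And>u. u \<in> ?S \<Longrightarrow> ?q u \<le> ?q m"
    using continuous_attains_sup[of ?S ?q] by blast
  define l where "l = ?q m"
  \<comment> \<open>Multiplication by \<open>\<i>\<close> in the second argument turns the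
    antisymmetric form \<open>l w0 - w1\<close> into a symmetric one, to which
    \<open>psd_kernel\<close> applies.\<close>
  define B where "B u v = l * w0 u (\<i> *s v) - w1 u (\<i> *s v)" for u v
  have B: "bilinear B"
    unfolding bilinear_def B_def
    by (auto intro!: linearI simp: bilinear_rules[OF b0] bilinear_rules[OF b1] smult_real_linear algebra_simps)
  have Bsym: "B u v = B v u" for u v
    unfolding B_def using form_11_J(2)[OF f0, of u v] form_11_J(2)[OF w1, of u v] by simp
  have Bpos: "B u u \<ge> 0" if u: "u \<in> U" for u
  proof (cases "u = 0")
    case False
    let ?n = "(1 / norm u) *\<^sub>R u"
    have "?n \<in> ?S" using False u U(1) by (simp add: subspace_scale)
    then have "?q ?n \<le> l" using m(2) l_def by simp
    moreover have "?n \<noteq> 0" using False by simp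
    ultimately have "w1 ?n (\<i> *s ?n) \<le> l * w0 ?n (\<i> *s ?n)"
      using p0[of ?n] by (simp add: pos_divide_le_eq)
    then have "B ?n ?n \<ge> 0" by (simp add: B_def)
    then have "(1 / norm u) * ((1 / norm u) * B u u) \<ge> 0" by (simp add: bilinear_rules[OF B])
    moreover have "(1 / norm u) * (1 / norm u) > 0" using False by simp
    ultimately show ?thesis
      using mult_le_cancel_left_pos[of "(1 / norm u) * (1 / norm u)" 0 "B u u"]
      by (simp only: mult.assoc mult_zero_right)
  qed (simp add: bilinear_rules[OF B])
  have mU: "m \<in> U" and m0: "m \<noteq> 0" using m(1) by auto
  have Bm: "B m m = 0" using p0[OF m0] by (simp add: B_def l_def)
  have w1m: "w1 m v = l * w0 m v" if v: "v \<in> U" for v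
  proof -
    have "\<i> *s v \<in> U" using U v by simp
    from psd_kernel[OF B Bsym U(1) Bpos mU this Bm] have "B m (\<i> *s v) = 0" by simp
    then show ?thesis by (simp add: B_def bilinear_rules[OF b0] bilinear_rules[OF b1])
  qed
  define r where "r = 1 / sqrt (w0 m (\<i> *s m))"
  have r: "r * r * w0 m (\<i> *s m) = 1" using p0[OF m0] by (simp add: r_def)
  show thesis
  proof (rule that[of "r *\<^sub>R m" l])
    show "r *\<^sub>R m \<in> U" using mU U(1) by (simp add: subspace_scale)
    show "w0 (r *\<^sub>R m) (\<i> *s r *\<^sub>R m) = 1"
      using r by (simp add: smult_real_linear bilinear_rules[OF b0])
    show "w1 (r *\<^sub>R m) v = l * w0 (r *\<^sub>R m) v" if "v \<in> U" for v
      using w1m[OF that] by (simp add: bilinear_rules[OF b0] bilinear_rules[OF b1])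
  qed
qed

text \<open>The last conjunct is the induction invariant: the chosen \<open>e j\<close> are
  eigenvectors of \<open>w1\<close> relative to \<open>w0\<close>, so they pair to zero under
  \<open>w1\<close> with the \<open>w0\<close>-orthogonal complement, where the next vector is
  sought.\<close>

lemma partial_diagonal_frame:
  fixes w0 w1 :: "complex ^ 'n::finite \<Rightarrow> complex ^ 'n \<Rightarrow> real"
  assumes w0: "pos_11 w0" and w1: "form_11 w1" and "m \<le> CARD('n)"
  shows "\<exists>(e :: nat \<Rightarrow> complex ^ 'n) l.
    (\<forall>j<m. \<forall>k<m. w0 (e j) (\<i> *s e k) = of_bool (j = k) \<and> w0 (e j) (e k) = 0) \<and>
    (\<forall>j<m. \<forall>k<m. w1 (e j) (\<i> *s e k) = (if j = k then l j else 0) \<and> w1 (e j) (e k) = 0) \<and>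
    (\<forall>j<m. \<forall>v. (\<forall>k<m. w0 (e k) v = 0 \<and> w0 (e k) (\<i> *s v) = 0) \<longrightarrow> w1 (e j) v = 0)"
  using assms(3)
proof (induction m)
  case 0
  then show ?case by simp
next
  case (Suc m)
  obtain e :: "nat \<Rightarrow> complex ^ 'n" and l where E:
    "(\<forall>j<m. \<forall>k<m. w0 (e j) (\<i> *s e k) = of_bool (j = k) \<and> w0 (e j) (e k) = 0) \<and>
    (\<forall>j<m. \<forall>k<m. w1 (e j) (\<i> *s e k) = (if j = k then l j else 0) \<and> w1 (e j) (e k) = 0) \<and>
    (\<forall>j<m. \<forall>v. (\<forall>k<m. w0 (e k) v = 0 \<and> w0 (e k) (\<i> *s v) = 0) \<longrightarrow> w1 (e j) v = 0)"
    using Suc.IH[OF Suc_leD[OF Suc.prems]] by (elim exE)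
  note e0 = E[THEN conjunct1, rule_format]
    and e1 = E[THEN conjunct2, THEN conjunct1, rule_format]
    and e2 = E[THEN conjunct2, THEN conjunct2, rule_format]
  have f0: "form_11 w0" using w0 by (auto simp: pos_11_def)
  have b0: "bilinear w0" and b1: "bilinear w1" using f0 w1 by (auto simp: form_11_def)
  define U where "U = {v. \<forall>k<m. w0 (e k) v = 0 \<and> w0 (e k) (\<i> *s v) = 0}"
  have U: "subspace U" unfolding subspace_def U_def by (auto simp: smult_real_linear bilinear_rules[OF b0])
  have UJ: "\<i> *s v \<in> U" if "v \<in> U" for v using that by (auto simp: U_def bilinear_rules[OF b0])
  \<comment> \<open>The real span of the frame built so far has dimension at most
    \<open>2 * m\<close>, less than the real dimension of the space. Subtracting from a
    \<open>v\<close> outside it the projection of \<open>v\<close> onto it gives a nonzero vector of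
    the complement \<open>U\<close>.\<close>
  define T where "T = e ` {..<m} \<union> (\<lambda>k. \<i> *s e k) ` {..<m}"
  have "card T \<le> m + m"
    unfolding T_def by (rule order_trans[OF card_Un_le add_mono]) (auto intro: card_image_le[THEN order_trans])
  then have "dim (span T) < DIM(complex ^ 'n)"
    using dim_le_card'[of T] Suc.prems by (simp add: T_def)
  then have "span T \<noteq> UNIV" by (metis dim_UNIV less_irrefl)
  then obtain v where v: "v \<notin> span T" by blast
  define v0 where "v0 = v - (\<Sum>k<m. w0 (e k) (\<i> *s v) *\<^sub>R e k + w0 (e k) v *\<^sub>R (\<i> *s e k))"
  have "(\<Sum>k<m. w0 (e k) (\<i> *s v) *\<^sub>R e k + w0 (e k) v *\<^sub>R (\<i> *s e k)) \<in> span T"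
    by (intro span_sum span_add span_scale span_base) (auto simp: T_def)
  then have v0_ne: "v0 \<noteq> 0" using v by (auto simp: v0_def)
  have v0U: "v0 \<in> U"
  proof -
    have "w0 (e j) v0 = 0" if j: "j < m" for j
    proof -
      have "w0 (e j) (\<Sum>k<m. w0 (e k) (\<i> *s v) *\<^sub>R e k + w0 (e k) v *\<^sub>R (\<i> *s e k))
         = (\<Sum>k<m. if j = k then w0 (e j) v else 0)"
        unfolding bilinear_rules(8)[OF b0]
        by (intro sum.cong refl) (use e0[OF j] in \<open>auto simp: bilinear_rules[OF b0]\<close>)
      also have "\<dots> = w0 (e j) v" using j by simp
      finally show ?thesis
        unfolding v0_def diff_conv_add_uminus by (simp add: bilinear_rules[OF b0])
    qed
    moreover have "w0 (e j) (\<i> *s v0) = 0" if j: "j < m" for j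
    proof -
      have iv: "\<i> *s v0 = \<i> *s v + - (\<Sum>k<m. w0 (e k) (\<i> *s v) *\<^sub>R (\<i> *s e k) + (- w0 (e k) v) *\<^sub>R e k)"
        by (simp add: v0_def vec_eq_iff algebra_simps sum_distrib_left sum_subtractf sum.distrib sum_negf)
      have "w0 (e j) (\<Sum>k<m. w0 (e k) (\<i> *s v) *\<^sub>R (\<i> *s e k) + (- w0 (e k) v) *\<^sub>R e k)
         = (\<Sum>k<m. if j = k then w0 (e j) (\<i> *s v) else 0)"
        unfolding bilinear_rules(8)[OF b0]
        by (intro sum.cong refl) (use e0[OF j] in \<open>auto simp: bilinear_rules[OF b0]\<close>)
      also have "\<dots> = w0 (e j) (\<i> *s v)" using j by simp
      finally show ?thesis
        unfolding iv by (simp add: bilinear_rules[OF b0])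
    qed
    ultimately show ?thesis by (simp add: U_def)
  qed
  obtain d r where d: "d \<in> U" "w0 d (\<i> *s d) = 1" "\<And>v. v \<in> U \<Longrightarrow> w1 d v = r * w0 d v"
    using maximal_vector[OF w0 w1 U UJ v0U v0_ne] by metis
  have d0: "w0 (e k) d = 0" "w0 (e k) (\<i> *s d) = 0" "w0 d (e k) = 0" "w0 d (\<i> *s e k) = 0" if "k < m" for k
    using d(1) that form_11_anti[OF f0, of d "e k"] form_11_J(2)[OF f0, of d "e k"] by (auto simp: U_def)
  have d1: "w1 (e k) d = 0" "w1 (e k) (\<i> *s d) = 0" "w1 d (e k) = 0" "w1 d (\<i> *s e k) = 0" if "k < m" for k
    using E[THEN conjunct2, THEN conjunct2] that d(1) UJ[OF d(1)]
      form_11_anti[OF w1, of d "e k"] form_11_J(2)[OF w1, of d "e k"] by (auto simp: U_def)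
  have dd: "w0 d d = 0" "w1 d d = 0" "w1 d (\<i> *s d) = r"
    using f0 w1 d(2) d(3)[OF UJ[OF d(1)]] by (auto simp: form_11_def)
  let ?e = "e(m := d)" and ?l = "l(m := r)"
  have "w0 (?e j) (\<i> *s ?e k) = of_bool (j = k) \<and> w0 (?e j) (?e k) = 0" if "j < Suc m" "k < Suc m" for j k
    using that e0 d0 d(2) dd by (auto simp: less_Suc_eq)
  moreover have "w1 (?e j) (\<i> *s ?e k) = (if j = k then ?l j else 0) \<and> w1 (?e j) (?e k) = 0" if "j < Suc m" "k < Suc m" for j k
    using that e1 d1 dd by (auto simp: less_Suc_eq)
  moreover have "w1 (?e j) v = 0" if "j < Suc m" and v: "\<forall>k<Suc m. w0 (?e k) v = 0 \<and> w0 (?e k) (\<i> *s v) = 0" for j v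
  proof -
    have vU: "\<forall>k<m. w0 (e k) v = 0 \<and> w0 (e k) (\<i> *s v) = 0" and vd: "w0 d v = 0"
      using v by (auto simp: less_Suc_eq)
    show ?thesis
    proof (cases "j = m")
      case True
      then show ?thesis using d(3)[of v] vU vd by (simp add: U_def)
    next
      case False
      then show ?thesis using E[THEN conjunct2, THEN conjunct2] vU that(1) by simp
    qed
  qed
  ultimately show ?case by blast
qed

theorem simultaneous_diagonalization:
  fixes w0 w1 :: "complex ^ 'n::finite \<Rightarrow> complex ^ 'n \<Rightarrow> real"
  assumes "pos_11 w0" "form_11 w1"
  obtains e l where "unitary_frame w0 e" "diagonal_frame w1 e l"
proof -
  obtain e :: "nat \<Rightarrow> complex ^ 'n" and l where
    e0: "\<And>j k. j < CARD('n) \<Longrightarrow> k < CARD('n) \<Longrightarrow> w0 (e j) (\<i> *s e k) = of_bool (j = k) \<and> w0 (e j) (e k) = 0" and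
    e1: "\<And>j k. j < CARD('n) \<Longrightarrow> k < CARD('n) \<Longrightarrow> w1 (e j) (\<i> *s e k) = (if j = k then l j else 0) \<and> w1 (e j) (e k) = 0"
    using partial_diagonal_frame[OF assms order_refl] by blast
  obtain b :: "'n \<Rightarrow> nat" where b: "bij_betw b UNIV {0..<CARD('n)}"
    using ex_bij_betw_finite_nat[of "UNIV :: 'n set"] by auto
  have lt: "b j < CARD('n)" for j using b by (auto simp: bij_betw_def)
  have inj: "b j = b k \<longleftrightarrow> j = k" for j k using b by (auto simp: bij_betw_def dest: injD)
  show thesis
    by (rule that[of "e \<circ> b" "l \<circ> b"])
      (use e0[OF lt lt] e1[OF lt lt] inj in \<open>auto simp: unitary_frame_def diagonal_frame_def\<close>)
qed

section \<open>Determinants in diagonal frames\<close>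

definition vol :: "(complex ^ 'n \<Rightarrow> complex ^ 'n \<Rightarrow> real) \<Rightarrow> real" where
  "vol w = Re (det (form_matrix w))"

text \<open>Both determinants, computed in the frame \<open>e\<close>, carry the same positive
  factor \<open>d\<close>, which cancels from their ratio.\<close>

lemma vol_diagonal:
  fixes e :: "'n::finite \<Rightarrow> complex ^ 'n"
  assumes "form_11 w0" "form_11 w1" "unitary_frame w0 e" "diagonal_frame w1 e l"
  shows "vol w0 > 0" "vol w1 = (\<Prod>j\<in>UNIV. l j) * vol w0"
proof -
  define d where "d = (norm (det (\<chi> j. e j)))\<^sup>2"
  have 0: "d * vol w0 = (1 / 2) ^ CARD('n)"
    using arg_cong[OF det_diagonal_frame[OF assms(1) assms(3)[unfolded unitary_diagonal]], of Re]
    by (simp add: d_def vol_def del: of_real_power)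
  have 1: "d * vol w1 = (\<Prod>j\<in>UNIV. l j) * (1 / 2) ^ CARD('n)"
    using arg_cong[OF det_diagonal_frame[OF assms(2,4)], of Re]
    by (simp add: d_def vol_def prod_dividef power_divide del: of_real_power of_real_prod)
  have "d \<ge> 0" by (simp add: d_def)
  moreover have "d \<noteq> 0" using 0 by auto
  ultimately have "d > 0" by simp
  moreover have "d * vol w0 > 0" unfolding 0 by simp
  ultimately show "vol w0 > 0" by (simp add: zero_less_mult_iff)
  have "d * vol w1 = d * ((\<Prod>j\<in>UNIV. l j) * vol w0)" using 0 1 by (simp add: algebra_simps)
  then show "vol w1 = (\<Prod>j\<in>UNIV. l j) * vol w0" using \<open>d > 0\<close> by simp
qed

lemma vol_pos:
  assumes "pos_11 (w :: complex ^ 'n::finite \<Rightarrow> complex ^ 'n \<Rightarrow> real)"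
  shows "vol w > 0"
  using simultaneous_diagonalization[OF assms] assms vol_diagonal(1) unfolding pos_11_def by metis

lemma diagonal_pos:
  fixes e :: "'n::finite \<Rightarrow> complex ^ 'n"
  assumes "pos_11 w0" "pos_11 w1" "unitary_frame w0 e" "diagonal_frame w1 e l"
  shows "l j > 0"
proof -
  have b: "bilinear w0" using assms(1) by (simp add: pos_11_def form_11_def)
  have "w0 (e j) (\<i> *s e j) = 1" using assms(3) by (simp add: unitary_frame_def)
  then have "e j \<noteq> 0" using bilinear_rules(9)[OF b] by force
  then show ?thesis using assms(2,4) unfolding pos_11_def diagonal_frame_def by metis
qed

lemma ln_vol_diagonal:
  fixes e :: "'n::finite \<Rightarrow> complex ^ 'n"
  assumes "pos_11 w0" "pos_11 w1" "unitary_frame w0 e" "diagonal_frame w1 e l"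
  shows "ln (vol w1) - ln (vol w0) = (\<Sum>j\<in>UNIV. ln (l j))"
proof -
  have f: "form_11 w0" "form_11 w1" using assms by (auto simp: pos_11_def)
  have "(\<Prod>j\<in>UNIV. l j) > 0" using diagonal_pos[OF assms] by (simp add: prod_pos)
  then have "ln (vol w1) = ln (\<Prod>j\<in>UNIV. l j) + ln (vol w0)"
    using vol_diagonal[OF f assms(3,4)] by (simp only: ln_mult_pos)
  also have "ln (\<Prod>j\<in>UNIV. l j) = (\<Sum>j\<in>UNIV. ln (l j))"
    by (rule ln_prod) (simp_all add: order_less_imp_not_eq2[OF diagonal_pos[OF assms]])
  finally show ?thesis by simp
qed

text \<open>The matrix of \<open>w\<close> is the Gram matrix of the vectors
  \<open>T (axis j 1)\<close> for \<open>w'\<close>, so \<open>det_herm_frame\<close> supplies the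
  factor.\<close>

lemma vol_pullback:
  fixes w w' :: "complex ^ 'n::finite \<Rightarrow> complex ^ 'n \<Rightarrow> real"
  assumes "form_11 w'" "\<And>u v. w u v = w' (T u) (T v)" "\<And>c u. T (c *s u) = c *s T u"
  shows "vol w = (norm (det (\<chi> j. T (axis j 1))))\<^sup>2 * vol w'"
proof -
  have "form_matrix w = (\<chi> j k. herm w' (T (axis j 1)) (T (axis k 1)))"
    by (simp add: vec_eq_iff form_matrix_herm) (simp add: herm_def assms(2,3))
  then have "det (form_matrix w) = complex_of_real ((norm (det (\<chi> j. T (axis j 1))))\<^sup>2) * det (form_matrix w')"
    using det_herm_frame[OF assms(1), of "\<lambda>j. T (axis j 1)"] by simp
  from arg_cong[OF this, of Re] show ?thesis by (simp add: vol_def del: of_real_power)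
qed

section \<open>Real coordinates\<close>

text \<open>\<open>'n bit0\<close> has \<open>2 * CARD('n)\<close> elements and carries the
  well-order that \<open>volume_atlas\<close> asks of its index type. The enumeration of
  \<open>Basis\<close> is arbitrary; its orthonormality is what matters.\<close>

definition rbasis :: "'n::finite bit0 \<Rightarrow> complex ^ 'n" where
  "rbasis = (SOME b. bij_betw b UNIV Basis)"

lemma rbasis_bij: "bij_betw (rbasis :: 'n::finite bit0 \<Rightarrow> complex ^ 'n) UNIV Basis"
proof -
  have "\<exists>b. bij_betw b (UNIV :: 'n bit0 set) (Basis :: (complex ^ 'n) set)"
    by (rule finite_same_card_bij) simp_all
  then show ?thesis unfolding rbasis_def by (rule someI_ex)
qed

definition toR :: "complex ^ 'n::finite \<Rightarrow> real ^ ('n bit0)" where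
  "toR v = (\<chi> a. v \<bullet> rbasis a)"

definition ofR :: "real ^ ('n bit0) \<Rightarrow> complex ^ 'n::finite" where
  "ofR x = (\<Sum>a\<in>UNIV. x $ a *\<^sub>R rbasis a)"

lemma rbasis_inner: "rbasis a \<bullet> rbasis b = of_bool (a = b)"
proof -
  have "rbasis a \<in> Basis" "rbasis b \<in> Basis" "rbasis a = rbasis b \<longleftrightarrow> a = b"
    using rbasis_bij by (auto simp: bij_betw_def dest: injD)
  then show ?thesis by (simp add: inner_Basis)
qed

lemma toR_ofR [simp]: "toR (ofR x) = x"
  by (simp add: toR_def ofR_def vec_eq_iff inner_sum_left rbasis_inner of_bool_def if_distrib cong: if_cong)

lemma ofR_toR [simp]: "ofR (toR v) = v"
proof -
  have "ofR (toR v) = (\<Sum>b\<in>Basis. (v \<bullet> b) *\<^sub>R b)"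
    unfolding ofR_def toR_def using sum.reindex_bij_betw[OF rbasis_bij, of "\<lambda>b. (v \<bullet> b) *\<^sub>R b"] by simp
  then show ?thesis by (simp add: euclidean_representation)
qed

lemma linear_toR: "linear toR"
  by (rule linearI) (simp_all add: toR_def vec_eq_iff inner_add_left)

lemma linear_ofR: "linear ofR"
  by (rule linearI) (simp_all add: ofR_def scaleR_left_distrib sum.distrib scaleR_right.sum)

lemma bounded_linear_toR: "bounded_linear toR"
  using linear_toR linear_conv_bounded_linear by blast

lemma bounded_linear_ofR: "bounded_linear ofR"
  using linear_ofR linear_conv_bounded_linear by blast

lemma toR_rbasis: "toR (rbasis a) = axis a 1"
  by (simp add: toR_def vec_eq_iff rbasis_inner axis_def of_bool_def)

lemma ofR_axis: "ofR (axis a 1) = rbasis a"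
  using toR_rbasis ofR_toR by metis

lemma norm_toR: "norm (toR v) = norm v"
proof -
  have "toR v \<bullet> toR v = (\<Sum>a\<in>UNIV. toR v $ a * toR v $ a)" by (simp add: inner_vec_def[of "toR v"])
  also have "\<dots> = (\<Sum>b\<in>Basis. (v \<bullet> b) * (v \<bullet> b))"
    using sum.reindex_bij_betw[OF rbasis_bij, of "\<lambda>b. (v \<bullet> b) * (v \<bullet> b)"] by (simp add: toR_def)
  also have "\<dots> = v \<bullet> v" by (rule euclidean_inner[symmetric])
  finally show ?thesis by (simp add: norm_eq_sqrt_inner)
qed

lemma norm_ofR: "norm (ofR x) = norm x"
  using norm_toR[of "ofR x"] by simp

lemma rbasis_expansion: "v = (\<Sum>a\<in>UNIV. toR v $ a *\<^sub>R rbasis a)"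
  using ofR_toR[of v] by (simp add: ofR_def)

lemma bilinear_rbasis:
  fixes \<delta> :: "complex ^ 'n::finite \<Rightarrow> complex ^ 'n \<Rightarrow> real"
  assumes "bilinear \<delta>"
  shows "\<delta> u v = (\<Sum>a\<in>UNIV. \<Sum>b\<in>UNIV. toR u $ a * toR v $ b * \<delta> (rbasis a) (rbasis b))"
proof -
  have "\<delta> (\<Sum>a\<in>UNIV. toR u $ a *\<^sub>R rbasis a) (\<Sum>a\<in>UNIV. toR v $ a *\<^sub>R rbasis a)
      = (\<Sum>a\<in>UNIV. \<Sum>b\<in>UNIV. toR u $ a * toR v $ b * \<delta> (rbasis a) (rbasis b))"
    by (simp add: bilinear_rules(3,4,7)[OF assms])
      (simp only: bilinear_rules(4,8)[OF assms] sum_distrib_left mult.assoc real_scaleR_def)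
  then show ?thesis by (simp only: rbasis_expansion[symmetric])
qed

lemma smult_complex_of_real:
  "(complex_of_real a + \<i> * complex_of_real b) *s (u :: complex ^ 'n) = b *\<^sub>R (\<i> *s u) + a *\<^sub>R u"
  by (simp add: vec_eq_iff complex_eq_iff)

lemma toR_image: "toR ` S = ofR -` S"
proof (intro set_eqI iffI)
  show "x \<in> toR ` S" if "x \<in> ofR -` S" for x
    using that by (intro image_eqI[of _ _ "ofR x"]) simp_all
qed auto

lemma open_toR: "open S \<Longrightarrow> open (toR ` S)"
  unfolding toR_image
  by (rule continuous_open_vimage) (auto intro: linear_continuous_at bounded_linear_ofR)

lemma Ck_on_ofR:
  assumes "open S" "Ck_on k f S"
  shows "Ck_on k (\<lambda>x. f (ofR x)) (toR ` S)"
  by (rule Ck_on_compose_linear[OF assms(1) open_toR[OF assms(1)] bounded_linear_ofR _ assms(2)]) auto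

lemma frechet_derivative_ofR:
  assumes "f differentiable at (ofR x)"
  shows "frechet_derivative (\<lambda>x. f (ofR x)) (at x) v = frechet_derivative f (at (ofR x)) (ofR v)"
proof -
  have "((\<lambda>x. f (ofR x)) has_derivative (\<lambda>v. frechet_derivative f (at (ofR x)) (ofR v))) (at x)"
    using has_derivative_compose[OF bounded_linear_imp_has_derivative[OF bounded_linear_ofR]]
      frechet_derivative_works[THEN iffD1, OF assms] by metis
  from frechet_derivative_at[OF this] show ?thesis by metis
qed

definition real_matrix :: "(complex ^ 'n::finite \<Rightarrow> complex ^ 'n \<Rightarrow> real) \<Rightarrow> real ^ ('n bit0) ^ ('n bit0)" where
  "real_matrix w = (\<chi> a b. w (rbasis a) (rbasis b))"

definition real_covector :: "(complex ^ 'n::finite \<Rightarrow> real) \<Rightarrow> real ^ ('n bit0)" where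
  "real_covector h = (\<chi> a. h (rbasis a))"

text \<open>In a unitary frame the inverse of the matrix of a Kaehler form is explicit; this turns the
  contraction of \<open>W\<inverse>\<close> with \<open>d\<eta>\<close> in real coordinates into a sum over the frame.\<close>

lemma real_matrix_inverse_frame:
  fixes w :: "complex ^ 'n::finite \<Rightarrow> complex ^ 'n \<Rightarrow> real"
  assumes "form_11 w" "unitary_frame w e"
  defines "R \<equiv> \<chi> a b. \<Sum>j\<in>UNIV. toR (\<i> *s e j) $ a * toR (e j) $ b - toR (e j) $ a * toR (\<i> *s e j) $ b"
  shows "det (real_matrix w) \<noteq> 0" "matrix_inv (real_matrix w) = R"
proof -
  have b: "bilinear w" using assms(1) by (simp add: form_11_def)
  have sumw: "(\<Sum>b\<in>UNIV. toR u $ b * w (rbasis b) v) = w u v" for u v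
  proof -
    have "w (\<Sum>b\<in>UNIV. toR u $ b *\<^sub>R rbasis b) v = (\<Sum>b\<in>UNIV. toR u $ b * w (rbasis b) v)"
      by (simp add: bilinear_rules[OF b])
    then show ?thesis by (simp only: rbasis_expansion[symmetric])
  qed
  have "R ** real_matrix w = mat 1"
  proof -
    have "(R ** real_matrix w) $ a $ c = (mat 1 :: real ^ ('n bit0) ^ ('n bit0)) $ a $ c" for a c
    proof -
      \<comment> \<open>Column \<open>c\<close> of the product is, in real coordinates, the frame
        expansion of the basis vector \<open>?v\<close>, hence a unit column.\<close>
      let ?v = "rbasis c :: complex ^ 'n"
      have v: "?v = (\<Sum>j\<in>UNIV. w (e j) ?v *\<^sub>R (\<i> *s e j) + w (e j) (\<i> *s ?v) *\<^sub>R e j)"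
        using frame_expansion[OF assms(1,2), of ?v] by (simp only: smult_complex_of_real)
      have "toR ?v $ a = (\<Sum>j\<in>UNIV. w (e j) ?v * toR (\<i> *s e j) $ a + w (e j) (\<i> *s ?v) * toR (e j) $ a)"
        by (rule trans[OF arg_cong[OF v, of "\<lambda>v. toR v $ a"]])
          (simp add: linear_sum[OF linear_toR] linear_add[OF linear_toR] linear_scale[OF linear_toR])
      moreover have "(R ** real_matrix w) $ a $ c
        = (\<Sum>j\<in>UNIV. w (e j) ?v * toR (\<i> *s e j) $ a + w (e j) (\<i> *s ?v) * toR (e j) $ a)"
      proof -
        have "(R ** real_matrix w) $ a $ c = (\<Sum>b\<in>UNIV. (\<Sum>j\<in>UNIV. toR (\<i> *s e j) $ a * toR (e j) $ b
            - toR (e j) $ a * toR (\<i> *s e j) $ b) * w (rbasis b) ?v)"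
          by (simp add: R_def matrix_matrix_mult_def real_matrix_def)
        also have "\<dots> = (\<Sum>b\<in>UNIV. \<Sum>j\<in>UNIV. toR (\<i> *s e j) $ a * (toR (e j) $ b * w (rbasis b) ?v)
            - toR (e j) $ a * (toR (\<i> *s e j) $ b * w (rbasis b) ?v))"
          by (simp only: sum_distrib_right left_diff_distrib mult.assoc)
        also have "\<dots> = (\<Sum>j\<in>UNIV. toR (\<i> *s e j) $ a * w (e j) ?v - toR (e j) $ a * w (\<i> *s e j) ?v)"
          by (subst sum.swap) (simp add: sum_subtractf sum_distrib_left[symmetric] sumw)
        also have "\<dots> = (\<Sum>j\<in>UNIV. w (e j) ?v * toR (\<i> *s e j) $ a + w (e j) (\<i> *s ?v) * toR (e j) $ a)"
          by (intro sum.cong refl) (simp add: form_11_J(1)[OF assms(1)])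
        finally show ?thesis .
      qed
      ultimately show ?thesis by (simp add: toR_rbasis axis_def mat_def eq_commute)
    qed
    then show ?thesis by (simp add: vec_eq_iff)
  qed
  then have "det R * det (real_matrix w) = 1" by (metis det_I det_mul)
  then show d: "det (real_matrix w) \<noteq> 0" by auto
  have "matrix_inv (real_matrix w) = (R ** real_matrix w) ** matrix_inv (real_matrix w)"
    using \<open>R ** real_matrix w = mat 1\<close> by simp
  also have "\<dots> = R" by (simp add: matrix_mul_assoc[symmetric] matrix_inv_props[OF d])
  finally show "matrix_inv (real_matrix w) = R" .
qed

text \<open>\<open>\<delta>\<close> will be the coordinate derivative of a one-form, whose
  antisymmetrisation is the differential. The minus sign is the reason why a nonnegative trace
  corresponds to the nonpositive divergence of \<open>divergence_nonpos_imp_zero\<close>.\<close>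

lemma inverse_contraction_frame:
  fixes w \<delta> :: "complex ^ 'n::finite \<Rightarrow> complex ^ 'n \<Rightarrow> real"
  assumes "form_11 w" "unitary_frame w e" "bilinear \<delta>"
  shows "(\<Sum>a\<in>UNIV. \<Sum>b\<in>UNIV. matrix_inv (real_matrix w) $ a $ b * \<delta> (rbasis a) (rbasis b))
    = - (\<Sum>j\<in>UNIV. \<delta> (e j) (\<i> *s e j) - \<delta> (\<i> *s e j) (e j))"
proof -
  have s: "(\<Sum>a\<in>UNIV. \<Sum>b\<in>UNIV. toR u $ a * toR v $ b * \<delta> (rbasis a) (rbasis b)) = \<delta> u v" for u v
    by (rule bilinear_rbasis[OF assms(3), symmetric])
  have "(\<Sum>a\<in>UNIV. \<Sum>b\<in>UNIV. matrix_inv (real_matrix w) $ a $ b * \<delta> (rbasis a) (rbasis b))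
    = (\<Sum>a\<in>UNIV. \<Sum>b\<in>UNIV. \<Sum>j\<in>UNIV. toR (\<i> *s e j) $ a * toR (e j) $ b * \<delta> (rbasis a) (rbasis b)
         - toR (e j) $ a * toR (\<i> *s e j) $ b * \<delta> (rbasis a) (rbasis b))"
    by (simp add: real_matrix_inverse_frame(2)[OF assms(1,2)] sum_distrib_right left_diff_distrib)
  also have "\<dots> = (\<Sum>a\<in>UNIV. \<Sum>j\<in>UNIV. \<Sum>b\<in>UNIV. toR (\<i> *s e j) $ a * toR (e j) $ b * \<delta> (rbasis a) (rbasis b)
         - toR (e j) $ a * toR (\<i> *s e j) $ b * \<delta> (rbasis a) (rbasis b))"
    by (intro sum.cong refl sum.swap)
  also have "\<dots> = (\<Sum>j\<in>UNIV. \<Sum>a\<in>UNIV. \<Sum>b\<in>UNIV. toR (\<i> *s e j) $ a * toR (e j) $ b * \<delta> (rbasis a) (rbasis b)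
         - toR (e j) $ a * toR (\<i> *s e j) $ b * \<delta> (rbasis a) (rbasis b))"
    by (rule sum.swap)
  also have "\<dots> = (\<Sum>j\<in>UNIV. \<delta> (\<i> *s e j) (e j) - \<delta> (e j) (\<i> *s e j))"
    by (simp add: sum_subtractf s)
  finally show ?thesis by (simp add: sum_subtractf)
qed

section \<open>The divergence theorem on compact Kaehler manifolds\<close>

text \<open>The regularity that remains after multiplying a smooth one-form by the weight
  \<open>(max 0 F)\<^sup>2\<close>.\<close>

definition C1_form :: "('a, 'n::finite) chart set \<Rightarrow> ('a, 'n) form1 \<Rightarrow> bool" where
  "C1_form A \<eta> \<longleftrightarrow>
     (\<forall>c z. in_atlas A c z \<longrightarrow> linear (\<eta> c z)) \<and>
     (\<forall>c\<in>A. \<forall>u. Ck_on 1 (\<lambda>z. \<eta> c z u) (chart_image c)) \<and>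
     (\<forall>c\<in>A. \<forall>c'\<in>A. \<forall>z\<in>overlap c c'. \<forall>u.
        \<eta> c z u = \<eta> c' (transition c c' z) (frechet_derivative (transition c c') (at z) u))"

definition d1 :: "('a, 'n::finite) form1 \<Rightarrow> ('a, 'n) form2" where
  "d1 \<eta> c z u v = frechet_derivative (\<lambda>y. \<eta> c y v) (at z) u - frechet_derivative (\<lambda>y. \<eta> c y u) (at z) v"

abbreviation trace_d1 :: "('a, 'n::finite) form1 \<Rightarrow> ('a, 'n) chart \<Rightarrow> complex ^ 'n \<Rightarrow> ('n \<Rightarrow> complex ^ 'n) \<Rightarrow> real" where
  "trace_d1 \<eta> c z e \<equiv> \<Sum>j\<in>UNIV. d1 \<eta> c z (e j) (\<i> *s e j)"

lemma one_form_C1: "one_form A \<eta> \<Longrightarrow> C1_form A \<eta>"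
  unfolding one_form_def C1_form_def smooth_on_def by blast

lemma ext_deriv1_d1: "in_atlas A c z \<Longrightarrow> ext_deriv1 A \<eta> c z u v = d1 \<eta> c z u v"
  by (simp add: ext_deriv1_def d1_def)

section \<open>Charts and the local geometry of a Kaehler form\<close>

locale atlas =
  fixes X :: "'a topology" and A :: "('a, 'n::finite) chart set"
  assumes manifold: "complex_manifold X A"
begin

lemma open_chart_image: "c \<in> A \<Longrightarrow> open (chart_image c)"
  using manifold by (simp add: complex_manifold_def)

lemma inj_chart: "c \<in> A \<Longrightarrow> inj_on (snd c) (fst c)"
proof -
  assume c: "c \<in> A"
  then have "openin X (fst c)" "homeomorphic_map (subtopology X (fst c)) (top_of_set (chart_image c)) (snd c)"
    using manifold by (auto simp: complex_manifold_def)
  then show ?thesis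
    using openin_subset[of X "fst c"] by (simp add: homeomorphic_map_def topspace_subtopology Int_absorb1)
qed

lemma inv_chart: "c \<in> A \<Longrightarrow> x \<in> fst c \<Longrightarrow> inv_into (fst c) (snd c) (snd c x) = x"
  by (simp add: inj_chart)

lemma transition_chart: "c \<in> A \<Longrightarrow> x \<in> fst c \<Longrightarrow> transition c c' (snd c x) = snd c' x"
  by (simp add: transition_def inv_chart)

abbreviation T where "T c c' z \<equiv> frechet_derivative (transition c c') (at z)"

lemma transition_derivative:
  assumes "c \<in> A" "c' \<in> A" "z \<in> overlap c c'"
  shows "(transition c c' has_derivative T c c' z) (at z)" "T c c' z (a *s u) = a *s T c c' z u"
proof -
  obtain D where D: "(transition c c' has_derivative D) (at z)" "\<And>a u. D (a *s u) = a *s D u"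
    using manifold assms unfolding complex_manifold_def holomorphic_map_on_def by blast
  have "D = T c c' z" by (rule frechet_derivative_at[OF D(1)])
  then show "(transition c c' has_derivative T c c' z) (at z)" "T c c' z (a *s u) = a *s T c c' z u"
    using D by auto
qed

lemma overlap_image:
  assumes "c \<in> A" "c' \<in> A" "z \<in> overlap c c'"
  shows "z \<in> chart_image c" "transition c c' z \<in> chart_image c'"
proof -
  obtain x where "x \<in> fst c" "x \<in> fst c'" "z = snd c x" using assms(3) by (auto simp: overlap_def)
  then show "z \<in> chart_image c" "transition c c' z \<in> chart_image c'"
    using transition_chart[OF assms(1), of x c'] by (simp_all add: chart_image_def)
qed

lemma hermitian_pos:
  assumes h: "hermitian_form A h" and "c \<in> A" "z \<in> chart_image c"
  shows "pos_11 (h c z)"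
proof -
  have ia: "in_atlas A c z" using assms by (simp add: in_atlas_def)
  have tf: "two_form A h" using h by (simp add: hermitian_form_def)
  have "bilinear (h c z) \<and> (\<forall>u. h c z u u = 0)"
    using tf[unfolded two_form_def, THEN conjunct1] ia by blast
  moreover have "\<forall>u v. h c z (\<i> *s u) (\<i> *s v) = h c z u v"
    using h ia unfolding hermitian_form_def type_11_def by blast
  moreover have "\<forall>u. u \<noteq> 0 \<longrightarrow> h c z u (\<i> *s u) > 0"
    using h ia unfolding hermitian_form_def by blast
  ultimately show ?thesis by (simp add: pos_11_def form_11_def)
qed

lemma hermitian_form_11:
  "hermitian_form A h \<Longrightarrow> c \<in> A \<Longrightarrow> z \<in> chart_image c \<Longrightarrow> form_11 (h c z)"
  using hermitian_pos by (simp add: pos_11_def)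

lemma hermitian_two_form: "hermitian_form A h \<Longrightarrow> two_form A h"
  by (simp add: hermitian_form_def)

lemma two_form_Ck: "two_form A h \<Longrightarrow> c \<in> A \<Longrightarrow> Ck_on k (\<lambda>z. h c z u v) (chart_image c)"
  unfolding two_form_def smooth_on_def by blast

lemma two_form_off: "two_form A h \<Longrightarrow> \<not> in_atlas A c z \<Longrightarrow> h c z u v = 0"
  unfolding two_form_def by blast

end

locale kaehler = atlas X A for X :: "'a topology" and A :: "('a, 'n::finite) chart set" +
  fixes \<omega> :: "('a, 'n) form2"
  assumes compact: "compact_space X" and kaehler: "kahler_form A \<omega>"
begin

lemma hermitian: "hermitian_form A \<omega>"
  using kaehler by (simp add: kahler_form_def)

lemma two_form: "two_form A \<omega>"
  by (rule hermitian_two_form[OF hermitian])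

lemma pos: "c \<in> A \<Longrightarrow> z \<in> chart_image c \<Longrightarrow> pos_11 (\<omega> c z)"
  by (rule hermitian_pos[OF hermitian])

lemma form: "c \<in> A \<Longrightarrow> z \<in> chart_image c \<Longrightarrow> form_11 (\<omega> c z)"
  using pos by (simp add: pos_11_def)

lemma Ck: "c \<in> A \<Longrightarrow> Ck_on k (\<lambda>z. \<omega> c z u v) (chart_image c)"
  by (rule two_form_Ck[OF two_form])

lemma pullback:
  "c \<in> A \<Longrightarrow> c' \<in> A \<Longrightarrow> z \<in> overlap c c' \<Longrightarrow> \<omega> c z u v = \<omega> c' (transition c c' z) (T c c' z u) (T c c' z v)"
  using two_form unfolding two_form_def by blast

lemma frame_exists:
  assumes "c \<in> A" "z \<in> chart_image c"
  obtains e where "unitary_frame (\<omega> c z) e"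
  using simultaneous_diagonalization[OF pos[OF assms] form[OF assms]] by metis

lemma quadratic_bounds:
  assumes c: "c \<in> A" and K: "compact K" "K \<subseteq> chart_image c"
  obtains m M where "m > 0" "\<And>z u. z \<in> K \<Longrightarrow> m * (norm u)\<^sup>2 \<le> \<omega> c z u (\<i> *s u)"
    "\<And>z u. z \<in> K \<Longrightarrow> \<omega> c z u (\<i> *s u) \<le> M * (norm u)\<^sup>2"
proof (cases "K = {}")
  case True
  then show ?thesis using that[of 1 0] by simp
next
  case False
  define q where "q p = \<omega> c (fst p) (snd p) (\<i> *s snd p)" for p
  let ?S = "K \<times> sphere 0 1 :: ((complex ^ 'n) \<times> (complex ^ 'n)) set"
  have cpt: "compact ?S" by (intro compact_Times K compact_sphere)
  have "axis undefined 1 \<in> sphere (0 :: complex ^ 'n) 1" by (simp add: norm_axis_1)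
  then have ne: "?S \<noteq> {}" using False by blast
  \<comment> \<open>Smoothness of a form is stated for fixed \<open>u\<close> and \<open>v\<close>;
    expansion in the real basis yields joint continuity in the point and the vector.\<close>
  have "continuous_on ?S (\<lambda>p. \<Sum>a\<in>UNIV. \<Sum>b\<in>UNIV. (toR (snd p) $ a * toR (\<i> *s snd p) $ b) * \<omega> c (fst p) (rbasis a) (rbasis b))"
  proof (intro continuous_on_sum continuous_on_mult)
    have l1: "linear (\<lambda>p :: (complex ^ 'n) \<times> (complex ^ 'n). toR (snd p) $ a)" for a
      by (rule linearI) (simp_all add: linear_add[OF linear_toR] linear_scale[OF linear_toR])
    have l2: "linear (\<lambda>p :: (complex ^ 'n) \<times> (complex ^ 'n). toR (\<i> *s snd p) $ a)" for a
    proof (rule linearI)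
      fix p p' :: "(complex ^ 'n) \<times> (complex ^ 'n)" and r :: real
      show "toR (\<i> *s snd (p + p')) $ a = toR (\<i> *s snd p) $ a + toR (\<i> *s snd p') $ a"
        by (simp add: smult_real_linear linear_add[OF linear_toR])
      show "toR (\<i> *s snd (r *\<^sub>R p)) $ a = r *\<^sub>R toR (\<i> *s snd p) $ a"
        by (simp add: smult_real_linear linear_scale[OF linear_toR])
    qed
    show "continuous_on ?S (\<lambda>p. toR (snd p) $ a)" for a
      using l1 linear_conv_bounded_linear linear_continuous_on by blast
    show "continuous_on ?S (\<lambda>p. toR (\<i> *s snd p) $ a)" for a
      using l2 linear_conv_bounded_linear linear_continuous_on by blast
    show "continuous_on ?S (\<lambda>p. \<omega> c (fst p) (rbasis a) (rbasis b))" for a b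
      by (rule continuous_on_compose2[OF Ck_on_imp_continuous_on[OF Ck[OF c, of 0]]])
        (use K in \<open>auto intro!: continuous_intros\<close>)
  qed
  moreover have "(\<Sum>a\<in>UNIV. \<Sum>b\<in>UNIV. (toR (snd p) $ a * toR (\<i> *s snd p) $ b) * \<omega> c (fst p) (rbasis a) (rbasis b)) = q p"
    if "p \<in> ?S" for p
  proof -
    have "fst p \<in> chart_image c" using that K by auto
    then have b: "bilinear (\<omega> c (fst p))" using form[OF c] by (simp add: form_11_def)
    show ?thesis unfolding q_def
      by (rule bilinear_rbasis[OF b, symmetric])
  qed
  ultimately have cont: "continuous_on ?S q" by (rule continuous_on_eq)
  obtain p1 where p1: "p1 \<in> ?S" "\<And>p. p \<in> ?S \<Longrightarrow> q p1 \<le> q p"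
    using continuous_attains_inf[OF cpt ne cont] by blast
  obtain p2 where p2: "p2 \<in> ?S" "\<And>p. p \<in> ?S \<Longrightarrow> q p \<le> q p2"
    using continuous_attains_sup[OF cpt ne cont] by blast
  have "q p1 > 0"
  proof -
    have "fst p1 \<in> chart_image c" "snd p1 \<noteq> 0" using p1(1) K by auto
    then show ?thesis using pos[OF c] by (simp add: q_def pos_11_def)
  qed
  moreover have "q p1 * (norm u)\<^sup>2 \<le> \<omega> c z u (\<i> *s u) \<and> \<omega> c z u (\<i> *s u) \<le> q p2 * (norm u)\<^sup>2" if z: "z \<in> K" for z u
  proof (cases "u = 0")
    case True
    have "bilinear (\<omega> c z)" using form[OF c] z K by (auto simp: form_11_def)
    then show ?thesis using True bilinear_rules(9) by force
  next
    case False
    have b: "bilinear (\<omega> c z)" using form[OF c] z K by (auto simp: form_11_def)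
    define n where "n = (1 / norm u) *\<^sub>R u"
    have n: "u = norm u *\<^sub>R n" "(z, n) \<in> ?S" using False z by (auto simp: n_def)
    have "\<omega> c z (norm u *\<^sub>R n) (\<i> *s (norm u *\<^sub>R n)) = (norm u)\<^sup>2 * q (z, n)"
      unfolding smult_real_linear by (simp add: bilinear_rules[OF b] q_def power2_eq_square)
    then have "\<omega> c z u (\<i> *s u) = (norm u)\<^sup>2 * q (z, n)" using n(1) by simp
    then show ?thesis using p1(2)[OF n(2)] p2(2)[OF n(2)] by (simp add: mult.commute[of "(norm u)\<^sup>2"] mult_right_mono)
  qed
  ultimately show ?thesis using that[of "q p1" "q p2"] by blast
qed

text \<open>A transition map is an isometry of the Kaehler metrics, which are comparable to the Euclidean one on
  compact sets.\<close>

lemma transition_bounded: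
  assumes c: "c \<in> A" "c' \<in> A" and K: "compact K" "K \<subseteq> chart_image c" and L: "compact L" "L \<subseteq> chart_image c'"
  shows "\<exists>B. \<forall>z u. z \<in> overlap c c' \<longrightarrow> z \<in> K \<longrightarrow> transition c c' z \<in> L \<longrightarrow> norm (T c c' z u) \<le> B * norm u"
proof -
  obtain M where M: "\<And>z u. z \<in> K \<Longrightarrow> \<omega> c z u (\<i> *s u) \<le> M * (norm u)\<^sup>2"
    using quadratic_bounds[OF c(1) K] by metis
  obtain m where m: "m > 0" "\<And>z u. z \<in> L \<Longrightarrow> m * (norm u)\<^sup>2 \<le> \<omega> c' z u (\<i> *s u)"
    using quadratic_bounds[OF c(2) L] by metis
  have "norm (T c c' z u) \<le> sqrt (\<bar>M\<bar> / m) * norm u"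
    if z: "z \<in> overlap c c'" "z \<in> K" "transition c c' z \<in> L" for z u
  proof -
    have "m * (norm (T c c' z u))\<^sup>2 \<le> \<omega> c' (transition c c' z) (T c c' z u) (\<i> *s T c c' z u)"
      by (rule m(2)[OF z(3)])
    also have "\<dots> = \<omega> c z u (\<i> *s u)"
      using pullback[OF c z(1), of u "\<i> *s u"] transition_derivative(2)[OF c z(1)] by simp
    also have "\<dots> \<le> M * (norm u)\<^sup>2" by (rule M[OF z(2)])
    also have "\<dots> \<le> \<bar>M\<bar> * (norm u)\<^sup>2" by (intro mult_right_mono) auto
    finally have "(norm (T c c' z u))\<^sup>2 \<le> \<bar>M\<bar> / m * (norm u)\<^sup>2"
      using m(1) by (simp add: field_simps)
    also have "\<dots> = (sqrt (\<bar>M\<bar> / m) * norm u)\<^sup>2" using m(1) by (simp add: power_mult_distrib)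
    finally show ?thesis by (rule power2_le_imp_le) (use m(1) in simp)
  qed
  then show ?thesis by blast
qed

abbreviation W where "W c x \<equiv> real_matrix (\<omega> c (ofR x))"

lemma ofR_img: "x \<in> toR ` chart_image c \<Longrightarrow> ofR x \<in> chart_image c"
  by auto

lemma closed_nondegenerate:
  assumes c: "c \<in> A"
  shows "closed_nondegenerate (toR ` chart_image c) (W c)"
proof
  note o = open_chart_image[OF c]
  show "open (toR ` chart_image c)" by (rule open_toR[OF o])
  show "Ck_on 1 (\<lambda>x. W c x $ a $ b) (toR ` chart_image c)" for a b
    using Ck_on_ofR[OF o Ck[OF c]] by (simp add: real_matrix_def)
  fix x assume x: "x \<in> toR ` chart_image c"
  note z = ofR_img[OF x]
  show "W c x $ a $ b = - W c x $ b $ a" for a b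
    unfolding real_matrix_def vec_lambda_beta by (rule form_11_anti[OF form[OF c z]])
  show "det (W c x) \<noteq> 0"
    using frame_exists[OF c z] real_matrix_inverse_frame(1)[OF form[OF c z]] by metis
  show "frechet_derivative (\<lambda>x. W c x $ b $ d) (at x) (axis a 1)
      + frechet_derivative (\<lambda>x. W c x $ d $ a) (at x) (axis b 1)
      + frechet_derivative (\<lambda>x. W c x $ a $ b) (at x) (axis d 1) = 0" for a b d
  proof -
    have dif: "(\<lambda>y. \<omega> c y u v) differentiable at (ofR x)" for u v
      using Ck_on_differentiable[OF Ck[OF c] z] .
    have e: "frechet_derivative (\<lambda>x. W c x $ a $ b) (at x) (axis d 1)
        = frechet_derivative (\<lambda>y. \<omega> c y (rbasis a) (rbasis b)) (at (ofR x)) (rbasis d)" for a b d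
      using frechet_derivative_ofR[OF dif, of "rbasis a" "rbasis b" "axis d 1"] by (simp add: real_matrix_def ofR_axis)
    \<comment> \<open>\<open>closed_form2\<close> has the alternating formula and
      \<open>W_closed\<close> the cyclic one; antisymmetry converts the middle term.\<close>
    have anti: "frechet_derivative (\<lambda>y. \<omega> c y v u) (at (ofR x)) t = - frechet_derivative (\<lambda>y. \<omega> c y u v) (at (ofR x)) t" for u v t
    proof -
      have "((\<lambda>y. - \<omega> c y u v) has_derivative (\<lambda>t. - frechet_derivative (\<lambda>y. \<omega> c y u v) (at (ofR x)) t)) (at (ofR x))"
        using dif frechet_derivative_works by (intro has_derivative_minus) blast
      then have "((\<lambda>y. \<omega> c y v u) has_derivative (\<lambda>t. - frechet_derivative (\<lambda>y. \<omega> c y u v) (at (ofR x)) t)) (at (ofR x))"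
        by (rule has_derivative_transform_within_open[OF _ o z]) (rule form_11_anti[OF form[OF c], symmetric])
      from frechet_derivative_at[OF this] show ?thesis by metis
    qed
    have "frechet_derivative (\<lambda>y. \<omega> c y (rbasis b) (rbasis d)) (at (ofR x)) (rbasis a)
        - frechet_derivative (\<lambda>y. \<omega> c y (rbasis a) (rbasis d)) (at (ofR x)) (rbasis b)
        + frechet_derivative (\<lambda>y. \<omega> c y (rbasis a) (rbasis b)) (at (ofR x)) (rbasis d) = 0"
    proof -
      have "closed_form2 A \<omega>" using kaehler by (simp add: kahler_form_def)
      moreover have "in_atlas A c (ofR x)" using c z by (simp add: in_atlas_def)
      ultimately show ?thesis unfolding closed_form2_def by blast
    qed
    then show ?thesis unfolding e using anti[of "rbasis d" "rbasis a" "rbasis b"] by simp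
  qed
qed

end

lemma matrix_inv_cancel:
  fixes M :: "real ^ 'm ^ 'm"
  assumes "det M \<noteq> 0"
  shows "matrix_inv M *v (M *v x) = x" "M *v (matrix_inv M *v x) = x"
  by (simp_all only: matrix_vector_mul_assoc matrix_inv_props[OF assms] matrix_vector_mul_lid)

lemma matrix_toR_ofR:
  assumes "linear t"
  shows "linear (\<lambda>u. toR (t (ofR u)))" "matrix (\<lambda>u. toR (t (ofR u))) $ c $ b = toR (t (rbasis b)) $ c"
proof -
  show "linear (\<lambda>u. toR (t (ofR u)))"
    using linear_compose[OF linear_compose[OF linear_ofR assms] linear_toR] by (simp add: o_def)
  show "matrix (\<lambda>u. toR (t (ofR u))) $ c $ b = toR (t (rbasis b)) $ c"
    by (simp add: matrix_def ofR_axis)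
qed

lemma real_matrix_pullback:
  fixes w w' :: "complex ^ 'n::finite \<Rightarrow> complex ^ 'n \<Rightarrow> real"
  assumes "linear t" "bilinear w'" "\<And>u v. w u v = w' (t u) (t v)"
  shows "real_matrix w = transpose (matrix (\<lambda>u. toR (t (ofR u)))) ** real_matrix w' ** matrix (\<lambda>u. toR (t (ofR u)))"
proof -
  have "w (rbasis a) (rbasis b) = (\<Sum>d\<in>UNIV. (\<Sum>c\<in>UNIV. toR (t (rbasis a)) $ c * w' (rbasis c) (rbasis d)) * toR (t (rbasis b)) $ d)" for a b
    unfolding assms(3) by (subst bilinear_rbasis[OF assms(2)], subst sum.swap)
      (simp add: sum_distrib_right sum_distrib_left mult_ac)
  then show ?thesis
    by (simp add: vec_eq_iff matrix_matrix_mult_def transpose_def matrix_toR_ofR[OF assms(1)] real_matrix_def)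
qed

lemma real_covector_pullback:
  fixes h h' :: "complex ^ 'n::finite \<Rightarrow> real"
  assumes "linear t" "linear h'" "\<And>u. h u = h' (t u)"
  shows "real_covector h = transpose (matrix (\<lambda>u. toR (t (ofR u)))) *v real_covector h'"
proof -
  have "h (rbasis b) = (\<Sum>c\<in>UNIV. toR (t (rbasis b)) $ c * h' (rbasis c))" for b
  proof -
    have "h' (\<Sum>c\<in>UNIV. toR (t (rbasis b)) $ c *\<^sub>R rbasis c) = (\<Sum>c\<in>UNIV. toR (t (rbasis b)) $ c * h' (rbasis c))"
      by (simp add: linear_sum[OF assms(2)] linear_scale[OF assms(2)])
    then show ?thesis unfolding assms(3) by (simp only: rbasis_expansion[symmetric])
  qed
  then show ?thesis
    by (simp add: vec_eq_iff matrix_vector_mult_def transpose_def matrix_toR_ofR[OF assms(1)] real_covector_def)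
qed

context kaehler
begin

text \<open>With the Liouville density \<open>P\<close>, the field \<open>V\<close> dual to
  \<open>\<eta>\<close> has divergence minus \<open>P\<close> times the trace. By the fact
  \<open>trace\<close> this is so in every unitary frame, hence the sign may be tested in any one
  frame at each point.\<close>

theorem trace_nonneg_imp_zero:
  assumes \<eta>: "C1_form A \<eta>"
    and nonneg: "\<And>c z. c \<in> A \<Longrightarrow> z \<in> chart_image c \<Longrightarrow>
      \<exists>e. unitary_frame (\<omega> c z) e \<and> trace_d1 \<eta> c z e \<ge> 0"
    and c: "c \<in> A" "z \<in> chart_image c" "unitary_frame (\<omega> c z) e"
  shows "trace_d1 \<eta> c z e = 0"
proof -
  define H where "H c x = real_covector (\<eta> c (ofR x))" for c :: "('a, 'n) chart" and x
  define V where "V c x = matrix_inv (W c x) *v H c x" for c :: "('a, 'n) chart" and x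
  define P where "P c x = sqrt \<bar>det (W c x)\<bar>" for c :: "('a, 'n) chart" and x
  define J where "J c c' x u = toR (T c c' (ofR x) (ofR u))" for c c' :: "('a, 'n) chart" and x u
  have lin: "linear (\<eta> c z)" if "c \<in> A" "z \<in> chart_image c" for c z
    using \<eta> that unfolding C1_form_def in_atlas_def by blast
  have \<eta>_C1: "Ck_on 1 (\<lambda>z. \<eta> c z u) (chart_image c)" if "c \<in> A" for c u
    using \<eta> that unfolding C1_form_def by blast
  have \<eta>_pull: "\<eta> c z u = \<eta> c' (transition c c' z) (T c c' z u)" if "c \<in> A" "c' \<in> A" "z \<in> overlap c c'" for c c' z u
    using \<eta> that unfolding C1_form_def by blast
  have img: "(\<lambda>x. toR (snd c x)) ` fst c = toR ` chart_image c" for c :: "('a, 'n) chart"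
    by (simp add: chart_image_def image_image)
  have H_C1: "Ck_on 1 (\<lambda>x. H c x $ b) (toR ` chart_image c)" if "c \<in> A" for c b
    using Ck_on_ofR[OF open_chart_image[OF that] \<eta>_C1[OF that]] by (simp add: H_def real_covector_def)
  have T_linear: "linear (T c c' z)" if "c \<in> A" "c' \<in> A" "z \<in> overlap c c'" for c c' z
    using transition_derivative(1)[OF that] by (rule has_derivative_linear)
  have trans: "W c x = transpose (matrix (J c c' x)) ** W c' (toR (transition c c' (ofR x))) ** matrix (J c c' x)"
    "H c x = transpose (matrix (J c c' x)) *v H c' (toR (transition c c' (ofR x)))"
    if cc: "c \<in> A" "c' \<in> A" "ofR x \<in> overlap c c'" for c c' x
  proof -
    note im = overlap_image[OF cc]
    show "W c x = transpose (matrix (J c c' x)) ** W c' (toR (transition c c' (ofR x))) ** matrix (J c c' x)"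
      using real_matrix_pullback[OF T_linear[OF cc], of "\<omega> c' (transition c c' (ofR x))" "\<omega> c (ofR x)"]
        form[OF cc(2) im(2)] pullback[OF cc] unfolding J_def form_11_def by simp
    show "H c x = transpose (matrix (J c c' x)) *v H c' (toR (transition c c' (ofR x)))"
      unfolding H_def J_def using real_covector_pullback[OF T_linear[OF cc] lin[OF cc(2) im(2)] \<eta>_pull[OF cc]] by simp
  qed
  have detW: "det (W c x) \<noteq> 0" if "c \<in> A" "x \<in> toR ` chart_image c" for c x
    using closed_nondegenerate.W_nondeg[OF closed_nondegenerate[OF that(1)] that(2)] .
  have chart: "(\<lambda>x. toR (snd c x)) p \<in> toR ` chart_image c" "ofR (toR (snd c p)) \<in> overlap c c'"
    "transition c c' (ofR (toR (snd c p))) = snd c' p" if "c \<in> A" "p \<in> fst c" "p \<in> fst c'" for c c' :: "('a, 'n) chart" and p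
    using that transition_chart by (auto simp: chart_image_def overlap_def)
  interpret volume_atlas X A fst "\<lambda>c x. toR (snd c x)" "\<lambda>c y. inv_into (fst c) (snd c) (ofR y)" J P V
  proof
    show "Hausdorff_space X" "compact_space X"
      using manifold compact by (auto simp: complex_manifold_def)
    show "topspace X = (\<Union>c\<in>A. fst c)" using manifold by (simp add: complex_manifold_def)
  next
    fix c assume c: "c \<in> A"
    show oc: "openin X (fst c)" using manifold c by (simp add: complex_manifold_def)
    show "open ((\<lambda>x. toR (snd c x)) ` fst c)" unfolding img by (rule open_toR[OF open_chart_image[OF c]])
    show "homeomorphic_maps (subtopology X (fst c)) (top_of_set ((\<lambda>x. toR (snd c x)) ` fst c))
       (\<lambda>x. toR (snd c x)) (\<lambda>y. inv_into (fst c) (snd c) (ofR y))"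
    proof -
      have ts: "topspace (subtopology X (fst c)) = fst c"
        using openin_subset[OF oc] by (simp add: topspace_subtopology Int_absorb1)
      have "homeomorphic_map (subtopology X (fst c)) (top_of_set (chart_image c)) (snd c)"
        using manifold c by (simp add: complex_manifold_def)
      then obtain g where g: "homeomorphic_maps (subtopology X (fst c)) (top_of_set (chart_image c)) (snd c) g"
        using homeomorphic_map_maps by blast
      have ginv: "g y = inv_into (fst c) (snd c) y" if y: "y \<in> chart_image c" for y
      proof -
        obtain p where p: "p \<in> fst c" "y = snd c p" using y by (auto simp: chart_image_def)
        then have "g y = p" using g ts by (auto simp: homeomorphic_maps_def)
        then show ?thesis using p inv_chart[OF c] by simp
      qed
      have hR: "homeomorphic_maps (top_of_set (chart_image c)) (top_of_set (toR ` chart_image c)) toR ofR"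
        unfolding homeomorphic_maps_def
        by (auto simp: continuous_map_in_subtopology linear_continuous_on bounded_linear_toR bounded_linear_ofR)
      have "homeomorphic_maps (subtopology X (fst c)) (top_of_set (toR ` chart_image c)) (toR \<circ> snd c) (g \<circ> ofR)"
        by (rule homeomorphic_maps_compose[OF conjI[OF g hR]])
      then show ?thesis unfolding img
        by (rule homeomorphic_maps_eq) (use ginv ts in \<open>auto simp: o_def\<close>)
    qed
    show "Ck_on 1 (\<lambda>z. P c z * V c z $ a) ((\<lambda>x. toR (snd c x)) ` fst c)" for a
      using closed_nondegenerate.divergence_formula(1)[OF closed_nondegenerate[OF c] H_C1[OF c], of a]
      unfolding img P_def V_def closed_nondegenerate.dens_def[OF closed_nondegenerate[OF c]]
        closed_nondegenerate.Q_def[OF closed_nondegenerate[OF c]] .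
  next
    fix c c' p assume cc: "c \<in> A" "c' \<in> A" "p \<in> fst c" "p \<in> fst c'"
    note ch = chart[OF cc(1,3,4)]
    show "((\<lambda>z. toR (snd c' (inv_into (fst c) (snd c) (ofR z)))) has_derivative J c c' (toR (snd c p))) (at (toR (snd c p)))"
    proof -
      have "((\<lambda>z. toR (transition c c' (ofR z))) has_derivative J c c' (toR (snd c p))) (at (toR (snd c p)))"
        unfolding J_def
        by (intro bounded_linear.has_derivative[OF bounded_linear_toR]
            has_derivative_compose[OF bounded_linear_imp_has_derivative[OF bounded_linear_ofR]]
            transition_derivative(1)[OF cc(1,2) ch(2)])
      then show ?thesis by (simp add: transition_def)
    qed
    note tr = trans[OF cc(1,2) ch(2), unfolded ch(3)]
    let ?M = "matrix (J c c' (toR (snd c p)))" and ?x = "toR (snd c p)" and ?x' = "toR (snd c' p)"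
    have "det (W c ?x) = (det ?M)\<^sup>2 * det (W c' ?x')"
      unfolding tr(1) by (simp only: det_mul det_transpose power2_eq_square mult_ac)
    then show "P c (toR (snd c p)) = \<bar>det ?M\<bar> * P c' (toR (snd c' p))"
      unfolding P_def by (simp add: abs_mult real_sqrt_mult)
    have dM: "det ?M \<noteq> 0" using detW[OF cc(1) ch(1)] \<open>det (W c ?x) = _\<close> by auto
    have dW': "det (W c' ?x') \<noteq> 0" using detW[OF cc(1) ch(1)] \<open>det (W c ?x) = _\<close> by auto
    \<comment> \<open>Both \<open>transpose M *v (W' *v (M *v V))\<close> and
      \<open>transpose M *v H'\<close> equal \<open>H\<close>. Cancelling the transposed Jacobian
      and then \<open>W'\<close> leaves the transformation law of a vector field.\<close>
    have "transpose ?M *v (W c' ?x' *v (?M *v V c ?x)) = W c ?x *v V c ?x"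
      unfolding tr(1) by (simp add: matrix_vector_mul_assoc matrix_mul_assoc)
    also have "\<dots> = H c ?x"
      unfolding V_def by (rule matrix_inv_cancel(2)[OF detW[OF cc(1) ch(1)]])
    also have "\<dots> = transpose ?M *v H c' ?x'" by (rule tr(2))
    finally have "matrix_inv (transpose ?M) *v (transpose ?M *v (W c' ?x' *v (?M *v V c ?x)))
        = matrix_inv (transpose ?M) *v (transpose ?M *v H c' ?x')" by simp
    then have "W c' ?x' *v (?M *v V c ?x) = H c' ?x'"
      using dM by (simp only: matrix_inv_cancel(1) det_transpose not_False_eq_True)
    then have "matrix_inv (W c' ?x') *v (W c' ?x' *v (?M *v V c ?x)) = V c' ?x'"
      unfolding V_def[of c'] by simp
    then have "?M *v V c ?x = V c' ?x'"
      by (simp only: matrix_inv_cancel(1)[OF dW'])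
    moreover have "linear (J c c' ?x)"
      unfolding J_def by (rule matrix_toR_ofR(1)[OF T_linear[OF cc(1,2) ch(2)]])
    ultimately show "V c' (toR (snd c' p)) = J c c' (toR (snd c p)) (V c (toR (snd c p)))"
      using fun_cong[OF matrix_vector_mul(2), of "J c c' ?x" "V c ?x"] by (simp only:)
  next
    fix c c' :: "('a, 'n) chart" and K L :: "(real ^ 'n bit0) set"
    assume cc: "c \<in> A" "c' \<in> A" and K: "compact K" "K \<subseteq> (\<lambda>x. toR (snd c x)) ` fst c"
      and L: "compact L" "L \<subseteq> (\<lambda>x. toR (snd c' x)) ` fst c'"
    have cpt: "compact (ofR ` K)" "compact (ofR ` L)"
      using K(1) L(1) linear_continuous_on[OF bounded_linear_ofR] compact_continuous_image by blast+
    have sub: "ofR ` K \<subseteq> chart_image c" "ofR ` L \<subseteq> chart_image c'"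
      using K(2) L(2) unfolding img by auto
    obtain B where B: "\<And>z u. z \<in> overlap c c' \<Longrightarrow> z \<in> ofR ` K \<Longrightarrow> transition c c' z \<in> ofR ` L \<Longrightarrow> norm (T c c' z u) \<le> B * norm u"
      using transition_bounded[OF cc cpt(1) sub(1) cpt(2) sub(2)] by blast
    have "norm (J c c' (toR (snd c p)) u) \<le> B * norm u"
      if p: "p \<in> fst c" "p \<in> fst c'" "toR (snd c p) \<in> K" "toR (snd c' p) \<in> L" for p u
    proof -
      note ch = chart[OF cc(1) p(1,2)]
      have 1: "ofR (toR (snd c p)) \<in> ofR ` K" using p(3) by (rule imageI)
      have 2: "transition c c' (ofR (toR (snd c p))) \<in> ofR ` L" unfolding ch(3) using imageI[OF p(4), of ofR] by simp
      from B[OF ch(2) 1 2, of "ofR u"] show ?thesis by (simp add: J_def norm_toR norm_ofR)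
    qed
    then show "\<exists>B. \<forall>x u. x \<in> fst c \<longrightarrow> x \<in> fst c' \<longrightarrow> toR (snd c x) \<in> K \<longrightarrow> toR (snd c' x) \<in> L \<longrightarrow>
        norm (J c c' (toR (snd c x)) u) \<le> B * norm u" by blast
  qed
  have trace: "divergence c (toR z) = - P c (toR z) * trace_d1 \<eta> c z e"
    if c: "c \<in> A" and z: "z \<in> chart_image c" and e: "unitary_frame (\<omega> c z) e" for c z e
  proof -
    have x: "toR z \<in> toR ` chart_image c" using z by blast
    have dif: "(\<lambda>y. \<eta> c y u) differentiable at z" for u
      using Ck_on_differentiable[OF \<eta>_C1[OF c, unfolded One_nat_def] z] .
    define \<delta> where "\<delta> u v = frechet_derivative (\<lambda>y. \<eta> c y v) (at z) u" for u v
    have b: "bilinear \<delta>"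
      using bilinear_frechet_derivative[OF open_chart_image[OF c] z lin[OF c] dif] by (simp add: \<delta>_def[abs_def])
    have fr: "frechet_derivative (\<lambda>x. H c x $ b) (at (toR z)) (axis a 1) = \<delta> (rbasis a) (rbasis b)" for a b
      using frechet_derivative_ofR[of "\<lambda>y. \<eta> c y (rbasis b)" "toR z" "axis a 1"] dif
      by (simp add: H_def real_covector_def \<delta>_def ofR_axis)
    have "divergence c (toR z) = P c (toR z) * (\<Sum>a\<in>UNIV. \<Sum>b\<in>UNIV. matrix_inv (W c (toR z)) $ a $ b * \<delta> (rbasis a) (rbasis b))"
      using closed_nondegenerate.divergence_formula(2)[OF closed_nondegenerate[OF c] H_C1[OF c] x]
      unfolding divergence_def P_def V_def closed_nondegenerate.dens_def[OF closed_nondegenerate[OF c]]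
        closed_nondegenerate.Q_def[OF closed_nondegenerate[OF c]] fr .
    also have "\<dots> = - P c (toR z) * trace_d1 \<eta> c z e"
      using inverse_contraction_frame[OF form[OF c z] e b] by (simp add: \<delta>_def d1_def)
    finally show ?thesis .
  qed
  have Ppos: "P c (toR z) > 0" if "c \<in> A" "z \<in> chart_image c" for c z
    using detW[OF that(1), of "toR z"] that by (simp add: P_def)
  have "divergence c (toR z) = 0"
  proof (rule divergence_nonpos_imp_zero[OF _ c(1)])
    show "toR z \<in> volume_atlas.img fst (\<lambda>c x. toR (snd c x)) c"
      using c(2) by (simp add: img_def img)
    fix c x assume cx: "c \<in> A" "x \<in> volume_atlas.img fst (\<lambda>c x. toR (snd c x)) c"
    then have z: "ofR x \<in> chart_image c" unfolding img_def img by auto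
    obtain e where e: "unitary_frame (\<omega> c (ofR x)) e" "trace_d1 \<eta> c (ofR x) e \<ge> 0"
      using nonneg[OF cx(1) z] by blast
    show "divergence c x \<le> 0"
      using trace[OF cx(1) z e(1)] e(2) Ppos[OF cx(1) z] by simp
  qed
  then show ?thesis using trace[OF c] Ppos[OF c(1,2)] by simp
qed

end

section \<open>The complex Hessian\<close>

definition hess :: "(complex ^ 'n::finite \<Rightarrow> real) \<Rightarrow> complex ^ 'n \<Rightarrow> complex ^ 'n \<Rightarrow> complex ^ 'n \<Rightarrow> real" where
  "hess f z u v = frechet_derivative (\<lambda>y. frechet_derivative f (at y) v) (at z) u"

lemma C2_rules:
  assumes "Ck_on 2 f S"
  shows "Ck_on (Suc 0) f S" "Ck_on (Suc 0) (\<lambda>y. frechet_derivative f (at y) v) S"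
proof -
  have "Ck_on (Suc (Suc 0)) f S" using assms by (simp add: numeral_2_eq_2)
  then show "Ck_on (Suc 0) f S" "Ck_on (Suc 0) (\<lambda>y. frechet_derivative f (at y) v) S"
    by (rule Ck_on_SucD, rule Ck_on_frechet)
qed

lemma linear_first:
  assumes "Ck_on (Suc 0) f S" "z \<in> S"
  shows "linear (frechet_derivative f (at z))"
  using Ck_on_has_derivative[OF assms] by (rule has_derivative_linear)

lemma bilinear_hess:
  assumes "open S" "Ck_on 2 f S" "z \<in> S"
  shows "bilinear (hess f z)"
  using bilinear_frechet_derivative[OF assms(1,3) linear_first[OF C2_rules(1)[OF assms(2)]]
      Ck_on_differentiable[OF C2_rules(2)[OF assms(2)] assms(3)]]
  by (simp add: hess_def[abs_def])

lemma wirtinger_wirtinger_bar: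
  assumes "open S" "Ck_on 2 f S" "z \<in> S"
  shows "wirtinger j (wirtinger_bar k (\<lambda>y. complex_of_real (f y))) z
    = (complex_of_real (hess f z (axis j 1) (axis k 1) + hess f z (axis j \<i>) (axis k \<i>))
       + \<i> * complex_of_real (hess f z (axis j 1) (axis k \<i>) - hess f z (axis j \<i>) (axis k 1))) / 4"
proof -
  note C = C2_rules[OF assms(2)]
  let ?D = "\<lambda>y v. frechet_derivative f (at y) v"
  have 1: "wirtinger_bar k (\<lambda>y. complex_of_real (f y)) y
      = (complex_of_real (?D y (axis k 1)) + \<i> * complex_of_real (?D y (axis k \<i>))) / 2" if "y \<in> S" for y
  proof -
    have "((\<lambda>y. complex_of_real (f y)) has_derivative (\<lambda>v. complex_of_real (?D y v))) (at y)"
      by (rule has_derivative_of_real[OF Ck_on_has_derivative[OF C(1) that]])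
    from frechet_derivative_at[OF this, symmetric] show ?thesis by (simp add: wirtinger_bar_def)
  qed
  have "((\<lambda>y. (complex_of_real (?D y (axis k 1)) + \<i> * complex_of_real (?D y (axis k \<i>))) / 2) has_derivative
      (\<lambda>u. (complex_of_real (hess f z u (axis k 1)) + \<i> * complex_of_real (hess f z u (axis k \<i>))) / 2)) (at z)"
    unfolding hess_def
    by (intro bounded_linear.has_derivative[OF bounded_linear_divide] has_derivative_add has_derivative_mult_right has_derivative_of_real Ck_on_has_derivative[OF C(2) assms(3)])
  then have "(wirtinger_bar k (\<lambda>y. complex_of_real (f y)) has_derivative
      (\<lambda>u. (complex_of_real (hess f z u (axis k 1)) + \<i> * complex_of_real (hess f z u (axis k \<i>))) / 2)) (at z)"
    by (rule has_derivative_transform_within_open[OF _ assms(1,3)]) (simp add: 1)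
  from frechet_derivative_at[OF this, symmetric] show ?thesis
    by (simp add: wirtinger_def field_simps)
qed

text \<open>The auxiliary \<open>w\<close> is made so that the mixed Wirtinger derivatives are the
  entries of \<open>herm w\<close>. Sesquilinearity collapses the double sum in
  \<open>i_ddbar\<close> to \<open>herm w u v - herm w v u\<close>, and for
  \<open>v = \<i> *s u\<close> this leads to \<open>2 * Re (herm w u u)\<close>, half the trace of
  the Hessian over the complex line of \<open>u\<close>.\<close>

lemma i_ddbar_J:
  fixes f :: "complex ^ 'n::finite \<Rightarrow> real"
  assumes "open S" "Ck_on 2 f S" "z \<in> S"
  shows "i_ddbar f z u (\<i> *s u) = (hess f z u u + hess f z (\<i> *s u) (\<i> *s u)) / 2"
proof -
  have b: "bilinear (hess f z)" by (rule bilinear_hess[OF assms])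
  define w where "w u v = (hess f z (\<i> *s u) v - hess f z u (\<i> *s v)) / 2" for u v
  have "bilinear w"
    unfolding bilinear_def w_def
    by (auto intro!: linearI simp: bilinear_rules[OF b] smult_real_linear field_simps)
  moreover have "w (\<i> *s u) (\<i> *s v) = w u v" for u v
    by (simp add: w_def bilinear_rules[OF b])
  ultimately have J: "J_bilinear w" by (simp add: J_bilinear_def)
  have h: "herm w u v = (complex_of_real (hess f z u v + hess f z (\<i> *s u) (\<i> *s v))
       + \<i> * complex_of_real (hess f z u (\<i> *s v) - hess f z (\<i> *s u) v)) / 4" for u v
    by (simp add: herm_def w_def bilinear_rules[OF b] field_simps)
  have W: "wirtinger j (wirtinger_bar k (\<lambda>y. complex_of_real (f y))) z = herm w (axis j 1) (axis k 1)" for j k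
    unfolding wirtinger_wirtinger_bar[OF assms] h by (simp add: smult_axis)
  have s: "(\<Sum>j\<in>UNIV. \<Sum>k\<in>UNIV. herm w (axis j 1) (axis k 1) * (u $ j * cnj (v $ k))) = herm w u v" for u v
    using herm_sum[OF J, of UNIV UNIV "\<lambda>j. u $ j" "\<lambda>j. axis j 1" "\<lambda>k. v $ k" "\<lambda>k. axis k 1"]
    by (simp add: basis_expansion mult.commute)
  have "i_ddbar f z u v = Re (\<i> * (herm w u v - herm w v u))" for v
    unfolding i_ddbar_def W by (simp add: right_diff_distrib sum_subtractf s)
  then have "i_ddbar f z u (\<i> *s u) = Re (\<i> * (herm w u (\<i> *s u) - herm w (\<i> *s u) u))" .
  also have "\<dots> = 2 * Re (herm w u u)"
    by (simp add: herm_linear[OF J] algebra_simps)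
  also have "\<dots> = (hess f z u u + hess f z (\<i> *s u) (\<i> *s u)) / 2"
    unfolding h by simp
  finally show ?thesis .
qed

lemma hess_diff:
  assumes "open S" "Ck_on 2 f S" "Ck_on 2 g S" "z \<in> S"
  shows "hess (\<lambda>y. f y - g y) z u v = hess f z u v - hess g z u v"
proof -
  note f = C2_rules[OF assms(2)] and g = C2_rules[OF assms(3)]
  have 1: "frechet_derivative (\<lambda>y. f y - g y) (at y) v = frechet_derivative f (at y) v - frechet_derivative g (at y) v"
    if "y \<in> S" for y
    using frechet_derivative_at[OF has_derivative_diff[OF Ck_on_has_derivative[OF f(1) that] Ck_on_has_derivative[OF g(1) that]]]
    by metis
  have "((\<lambda>y. frechet_derivative f (at y) v - frechet_derivative g (at y) v) has_derivative
      (\<lambda>u. hess f z u v - hess g z u v)) (at z)"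
    unfolding hess_def
    by (intro has_derivative_diff Ck_on_has_derivative[OF f(2) assms(4)] Ck_on_has_derivative[OF g(2) assms(4)])
  then have "((\<lambda>y. frechet_derivative (\<lambda>y. f y - g y) (at y) v) has_derivative (\<lambda>u. hess f z u v - hess g z u v)) (at z)"
    by (rule has_derivative_transform_within_open[OF _ assms(1,4)]) (simp add: 1)
  from fun_cong[OF frechet_derivative_at[OF this], of u] show ?thesis by (simp add: hess_def)
qed

lemma i_ddbar_diff_J:
  assumes "open S" "Ck_on 2 f S" "Ck_on 2 g S" "z \<in> S"
  shows "i_ddbar (\<lambda>y. f y - g y) z u (\<i> *s u) = i_ddbar f z u (\<i> *s u) - i_ddbar g z u (\<i> *s u)"
  unfolding i_ddbar_J[OF assms(1,2,4)] i_ddbar_J[OF assms(1,3,4)]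
    i_ddbar_J[OF assms(1) Ck_on_diff[OF assms(1-3)] assms(4)]
  by (simp add: hess_diff[OF assms] field_simps)

section \<open>Functions and one-forms on the manifold\<close>

definition Ck_function :: "nat \<Rightarrow> ('a, 'n::finite) chart set \<Rightarrow> (('a, 'n) chart \<Rightarrow> complex ^ 'n \<Rightarrow> real) \<Rightarrow> bool" where
  "Ck_function k A F \<longleftrightarrow> (\<forall>c\<in>A. Ck_on k (F c) (chart_image c)) \<and>
     (\<forall>c\<in>A. \<forall>c'\<in>A. \<forall>z\<in>overlap c c'. F c z = F c' (transition c c' z))"

text \<open>The sign is such that on \<open>(u, \<i> *s u)\<close> the form \<open>d1 (dc F)\<close>
  is twice \<open>i_ddbar F\<close>, and the wedge product of dF and \<open>dc F\<close> is
  nonnegative.\<close>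

definition dc :: "(('a, 'n::finite) chart \<Rightarrow> complex ^ 'n \<Rightarrow> real) \<Rightarrow> ('a, 'n) form1" where
  "dc F c z u = - frechet_derivative (F c) (at z) (\<i> *s u)"

context atlas
begin

lemma Ck_functionD:
  assumes "Ck_function k A F" "c \<in> A"
  shows "Ck_on k (F c) (chart_image c)"
    "c' \<in> A \<Longrightarrow> z \<in> overlap c c' \<Longrightarrow> F c z = F c' (transition c c' z)"
  using assms unfolding Ck_function_def by blast+

lemma C1_formD:
  assumes "C1_form A \<eta>" "c \<in> A"
  shows "z \<in> chart_image c \<Longrightarrow> linear (\<eta> c z)" "Ck_on (Suc 0) (\<lambda>z. \<eta> c z u) (chart_image c)"
    "c' \<in> A \<Longrightarrow> z \<in> overlap c c' \<Longrightarrow> \<eta> c z u = \<eta> c' (transition c c' z) (T c c' z u)"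
  using assms unfolding C1_form_def in_atlas_def One_nat_def by blast+

lemma C1_formI:
  assumes "\<And>c z. c \<in> A \<Longrightarrow> z \<in> chart_image c \<Longrightarrow> linear (\<eta> c z)"
    and "\<And>c u. c \<in> A \<Longrightarrow> Ck_on (Suc 0) (\<lambda>z. \<eta> c z u) (chart_image c)"
    and "\<And>c c' z u. c \<in> A \<Longrightarrow> c' \<in> A \<Longrightarrow> z \<in> overlap c c' \<Longrightarrow> \<eta> c z u = \<eta> c' (transition c c' z) (T c c' z u)"
  shows "C1_form A \<eta>"
  unfolding C1_form_def in_atlas_def One_nat_def using assms by blast

lemma open_overlap: "c \<in> A \<Longrightarrow> c' \<in> A \<Longrightarrow> open (overlap c c')"
proof -
  assume c: "c \<in> A" "c' \<in> A"
  have o: "openin X (fst c)" "openin X (fst c')"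
    "homeomorphic_map (subtopology X (fst c)) (top_of_set (chart_image c)) (snd c)"
    using manifold c by (auto simp: complex_manifold_def)
  have "openin (subtopology X (fst c)) (fst c \<inter> fst c')"
    using o(1,2) by (simp add: openin_open_subtopology openin_Int)
  then have "openin (top_of_set (chart_image c)) (snd c ` (fst c \<inter> fst c'))"
    using homeomorphic_imp_open_map[OF o(3)] by (simp add: open_map_def)
  then show ?thesis
    using open_chart_image[OF c(1)] by (simp add: overlap_def openin_open_eq)
qed

lemma dc_C1_form:
  assumes "Ck_function 2 A F"
  shows "C1_form A (dc F)"
proof (rule C1_formI)
  note C = C2_rules[OF Ck_functionD(1)[OF assms]]
  show "linear (dc F c z)" if "c \<in> A" "z \<in> chart_image c" for c z
  proof -
    note l = linear_first[OF C(1)[OF that(1)] that(2)]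
    show ?thesis
      by (rule linearI) (simp_all add: dc_def smult_real_linear linear_add[OF l] linear_scale[OF l])
  qed
  show "Ck_on (Suc 0) (\<lambda>z. dc F c z u) (chart_image c)" if "c \<in> A" for c u
    unfolding dc_def by (rule Ck_on_minus[OF open_chart_image[OF that] C(2)[OF that]])
  fix c c' z u assume c: "c \<in> A" "c' \<in> A" "z \<in> overlap c c'"
  note im = overlap_image[OF c]
  have "((\<lambda>y. F c' (transition c c' y)) has_derivative (\<lambda>u. frechet_derivative (F c') (at (transition c c' z)) (T c c' z u))) (at z)"
    by (rule has_derivative_compose[OF transition_derivative(1)[OF c] Ck_on_has_derivative[OF C(1)[OF c(2)] im(2)]])
  then have "(F c has_derivative (\<lambda>u. frechet_derivative (F c') (at (transition c c' z)) (T c c' z u))) (at z)"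
    by (rule has_derivative_transform_within_open[OF _ open_overlap[OF c(1,2)] c(3)])
      (rule Ck_functionD(2)[OF assms c(1,2), symmetric])
  then have "frechet_derivative (F c) (at z) (\<i> *s u) = frechet_derivative (F c') (at (transition c c' z)) (T c c' z (\<i> *s u))"
    using frechet_derivative_at by metis
  then show "dc F c z u = dc F c' (transition c c' z) (T c c' z u)"
    unfolding dc_def transition_derivative(2)[OF c] by simp
qed

lemma d1_dc_J:
  assumes "Ck_function 2 A F" "c \<in> A" "z \<in> chart_image c"
  shows "d1 (dc F) c z u (\<i> *s u) = 2 * i_ddbar (F c) z u (\<i> *s u)"
proof -
  note C = C2_rules[OF Ck_functionD(1)[OF assms(1,2)]]
  note der = Ck_on_has_derivative[OF C(2) assms(3)]
  have m: "frechet_derivative (\<lambda>y. - frechet_derivative (F c) (at y) v) (at z) = (\<lambda>u. - hess (F c) z u v)" for v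
    using frechet_derivative_at[OF has_derivative_minus[OF der[of v]]] by (simp add: hess_def)
  have b: "bilinear (hess (F c) z)"
    by (rule bilinear_hess[OF open_chart_image[OF assms(2)] Ck_functionD(1)[OF assms(1,2)] assms(3)])
  show ?thesis
    unfolding i_ddbar_J[OF open_chart_image[OF assms(2)] Ck_functionD(1)[OF assms(1,2)] assms(3)]
    by (simp add: d1_def dc_def m bilinear_rules[OF b])
qed

lemma C1_form_lincomb:
  assumes "C1_form A \<eta>" "C1_form A \<zeta>"
  shows "C1_form A (\<lambda>c z u. a * \<eta> c z u + b * \<zeta> c z u)"
    and "c \<in> A \<Longrightarrow> z \<in> chart_image c \<Longrightarrow>
      d1 (\<lambda>c z u. a * \<eta> c z u + b * \<zeta> c z u) c z u v = a * d1 \<eta> c z u v + b * d1 \<zeta> c z u v"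
proof -
  note E = C1_formD[OF assms(1)] and Z = C1_formD[OF assms(2)]
  show "C1_form A (\<lambda>c z u. a * \<eta> c z u + b * \<zeta> c z u)"
  proof (rule C1_formI)
    show "linear (\<lambda>u. a * \<eta> c z u + b * \<zeta> c z u)" if "c \<in> A" "z \<in> chart_image c" for c z
      by (rule linearI)
        (simp_all add: linear_add[OF E(1)[OF that]] linear_add[OF Z(1)[OF that]]
          linear_scale[OF E(1)[OF that]] linear_scale[OF Z(1)[OF that]] algebra_simps)
    show "Ck_on (Suc 0) (\<lambda>z. a * \<eta> c z u + b * \<zeta> c z u) (chart_image c)" if "c \<in> A" for c u
      by (intro Ck_on_add Ck_on_cmult open_chart_image E(2) Z(2) that)
  qed (use E(3) Z(3) in metis)
  assume cz: "c \<in> A" "z \<in> chart_image c"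
  have "frechet_derivative (\<lambda>y. a * \<eta> c y v + b * \<zeta> c y v) (at z)
      = (\<lambda>u. a * frechet_derivative (\<lambda>y. \<eta> c y v) (at z) u + b * frechet_derivative (\<lambda>y. \<zeta> c y v) (at z) u)" for v
    by (rule frechet_derivative_at[symmetric])
      (intro has_derivative_add has_derivative_mult_right Ck_on_has_derivative[OF E(2)[OF cz(1)] cz(2)]
        Ck_on_has_derivative[OF Z(2)[OF cz(1)] cz(2)])
  then show "d1 (\<lambda>c z u. a * \<eta> c z u + b * \<zeta> c z u) c z u v = a * d1 \<eta> c z u v + b * d1 \<zeta> c z u v"
    by (simp add: d1_def algebra_simps)
qed

lemma C1_form_mult:
  assumes "Ck_function 1 A G" "C1_form A \<eta>"
  shows "C1_form A (\<lambda>c z u. G c z * \<eta> c z u)"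
    and "c \<in> A \<Longrightarrow> z \<in> chart_image c \<Longrightarrow> d1 (\<lambda>c z u. G c z * \<eta> c z u) c z u v
      = G c z * d1 \<eta> c z u v + frechet_derivative (G c) (at z) u * \<eta> c z v - frechet_derivative (G c) (at z) v * \<eta> c z u"
proof -
  note E = C1_formD[OF assms(2)] and G = Ck_functionD[OF assms(1), unfolded One_nat_def]
  show "C1_form A (\<lambda>c z u. G c z * \<eta> c z u)"
  proof (rule C1_formI)
    show "linear (\<lambda>u. G c z * \<eta> c z u)" if "c \<in> A" "z \<in> chart_image c" for c z
      by (rule linearI) (simp_all add: linear_add[OF E(1)[OF that]] linear_scale[OF E(1)[OF that]] algebra_simps)
    show "Ck_on (Suc 0) (\<lambda>z. G c z * \<eta> c z u) (chart_image c)" if "c \<in> A" for c u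
      by (intro Ck_on_mult open_chart_image E(2) G(1) that)
  qed (use E(3) G(2) in metis)
  assume cz: "c \<in> A" "z \<in> chart_image c"
  have "frechet_derivative (\<lambda>y. G c y * \<eta> c y v) (at z)
      = (\<lambda>u. G c z * frechet_derivative (\<lambda>y. \<eta> c y v) (at z) u + frechet_derivative (G c) (at z) u * \<eta> c z v)" for v
    by (rule frechet_derivative_at[symmetric])
      (intro has_derivative_mult Ck_on_has_derivative[OF E(2)[OF cz(1)] cz(2)]
        Ck_on_has_derivative[OF G(1)[OF cz(1)] cz(2)])
  then show "d1 (\<lambda>c z u. G c z * \<eta> c z u) c z u v
      = G c z * d1 \<eta> c z u v + frechet_derivative (G c) (at z) u * \<eta> c z v - frechet_derivative (G c) (at z) v * \<eta> c z u"
    by (simp add: d1_def algebra_simps)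
qed

lemma max_sq_function:
  assumes "Ck_function (Suc 0) A F"
  shows "Ck_function 1 A (\<lambda>c z. (max 0 (F c z))\<^sup>2)"
    and "c \<in> A \<Longrightarrow> z \<in> chart_image c \<Longrightarrow>
      frechet_derivative (\<lambda>z. (max 0 (F c z))\<^sup>2) (at z) u = 2 * max 0 (F c z) * frechet_derivative (F c) (at z) u"
proof -
  have d: "((\<lambda>t. (max 0 t)\<^sup>2) has_real_derivative 2 * max 0 t) (at (t::real))" for t
    by (rule DERIV_max_sq)
  note F = Ck_functionD[OF assms]
  have "Ck_on (Suc 0) (\<lambda>z. (max 0 (F c z))\<^sup>2) (chart_image c)" if c: "c \<in> A" for c
    by (rule Ck_on_compose_real[OF open_chart_image[OF c] d F(1)[OF c]])
      (use Ck_on_imp_continuous_on[OF F(1)[OF c]] in \<open>auto intro!: continuous_intros\<close>)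
  then show "Ck_function 1 A (\<lambda>c z. (max 0 (F c z))\<^sup>2)"
    unfolding Ck_function_def One_nat_def using F(2) by metis
  assume cz: "c \<in> A" "z \<in> chart_image c"
  have "((\<lambda>z. (max 0 (F c z))\<^sup>2) has_derivative (\<lambda>u. 2 * max 0 (F c z) * frechet_derivative (F c) (at z) u)) (at z)"
    using has_derivative_compose[OF Ck_on_has_derivative[OF F(1)[OF cz(1)] cz(2)] d[unfolded has_field_derivative_def]] by simp
  from frechet_derivative_at[OF this]
  show "frechet_derivative (\<lambda>z. (max 0 (F c z))\<^sup>2) (at z) u = 2 * max 0 (F c z) * frechet_derivative (F c) (at z) u"
    by metis
qed

end

section \<open>Volume ratios and Ricci forms\<close>

definition log_ratio :: "('a, 'n::finite) form2 \<Rightarrow> ('a, 'n) form2 \<Rightarrow> ('a, 'n) chart \<Rightarrow> complex ^ 'n \<Rightarrow> real" where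
  "log_ratio h h' c z = ln (vol (h' c z)) - ln (vol (h c z))"

lemma metric_matrix_form_matrix: "metric_matrix h c z = form_matrix (h c z)"
  by (simp add: metric_matrix_def form_matrix_def)

context atlas
begin

lemma Ck_vol:
  assumes "two_form A h" "c \<in> A"
  shows "Ck_on k (\<lambda>z. vol (h c z)) (chart_image c)"
proof -
  note o = open_chart_image[OF assms(2)]
  have "Ck_on k (\<lambda>z. form_matrix (h c z) $ i $ j) (chart_image c)" for i j
  proof -
    have r: "Ck_on k (\<lambda>z. complex_of_real (h c z u v)) (chart_image c)" for u v
      by (rule Ck_on_bounded_linear[OF o bounded_linear_of_real two_form_Ck[OF assms]])
    show ?thesis unfolding form_matrix_def
      by (simp del: Ck_on.simps) (intro Ck_on_bounded_linear[OF o bounded_linear_divide] Ck_on_diff Ck_on_cmult o r)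
  qed
  then show ?thesis unfolding vol_def
    by (intro Ck_on_bounded_linear[OF o bounded_linear_Re] Ck_on_det o)
qed

lemma vol_transition:
  assumes "hermitian_form A h" "c \<in> A" "c' \<in> A" "z \<in> overlap c c'"
  shows "vol (h c z) = (norm (det (\<chi> j. T c c' z (axis j 1))))\<^sup>2 * vol (h c' (transition c c' z))"
proof (rule vol_pullback)
  show "form_11 (h c' (transition c c' z))"
    by (rule hermitian_form_11[OF assms(1,3) overlap_image(2)[OF assms(2-4)]])
  show "h c z u v = h c' (transition c c' z) (T c c' z u) (T c c' z v)" for u v
    using hermitian_two_form[OF assms(1)] assms(2-4) unfolding two_form_def by blast
qed (rule transition_derivative(2)[OF assms(2-4)])

lemma log_ratio_function:
  assumes "hermitian_form A h0" "hermitian_form A h1"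
  shows "Ck_function k A (log_ratio h0 h1)"
  unfolding Ck_function_def log_ratio_def[abs_def]
proof (intro conjI ballI)
  show "Ck_on k (\<lambda>z. ln (vol (h1 c z)) - ln (vol (h0 c z))) (chart_image c)" if "c \<in> A" for c
    by (intro Ck_on_diff Ck_on_ln open_chart_image Ck_vol hermitian_two_form vol_pos hermitian_pos assms that)
  fix c c' z assume c: "c \<in> A" "c' \<in> A" "z \<in> overlap c c'"
  \<comment> \<open>The squared modulus of the Jacobian determinant multiplies both volumes and
    drops out of the difference of logarithms.\<close>
  define d where "d = (norm (det (\<chi> j. T c c' z (axis j 1))))\<^sup>2"
  note im = overlap_image[OF c]
  have p: "vol (h c z) > 0" "vol (h c' (transition c c' z)) > 0" if "hermitian_form A h" for h
    using vol_pos hermitian_pos[OF that] c im by blast+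
  have v: "vol (h c z) = d * vol (h c' (transition c c' z))" if "hermitian_form A h" for h
    unfolding d_def by (rule vol_transition[OF that c])
  have "d > 0" using p[OF assms(1)] v[OF assms(1)] by (simp add: zero_less_mult_iff)
  then show "ln (vol (h1 c z)) - ln (vol (h0 c z)) = ln (vol (h1 c' (transition c c' z))) - ln (vol (h0 c' (transition c c' z)))"
    using p[OF assms(1)] p[OF assms(2)] unfolding v[OF assms(1)] v[OF assms(2)] by (simp add: ln_mult_pos)
qed

lemma i_ddbar_log_ratio:
  assumes "hermitian_form A h0" "hermitian_form A h1" "c \<in> A" "z \<in> chart_image c"
  shows "i_ddbar (log_ratio h0 h1 c) z u (\<i> *s u)
    = ricci_form A h0 c z u (\<i> *s u) - ricci_form A h1 c z u (\<i> *s u)"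
proof -
  have C: "Ck_on 2 (\<lambda>z. ln (vol (h c z))) (chart_image c)" if "hermitian_form A h" for h
    by (intro Ck_on_ln open_chart_image Ck_vol hermitian_two_form vol_pos hermitian_pos that assms(3))
  have "ricci_form A h c z u (\<i> *s u) = - i_ddbar (\<lambda>z. ln (vol (h c z))) z u (\<i> *s u)" for h
    using assms(3,4) by (simp add: ricci_form_def in_atlas_def metric_matrix_form_matrix vol_def)
  then show ?thesis
    using i_ddbar_diff_J[OF open_chart_image[OF assms(3)] C[OF assms(2)] C[OF assms(1)] assms(4), of u]
    by (simp add: log_ratio_def[abs_def])
qed

end

section \<open>Uniqueness\<close>

context kaehler
begin

text \<open>The trace of the differential of \<open>r * \<eta>\<close> over a unitary frame is
  \<open>r * r * real CARD('n)\<close>: the extra factor \<open>r\<close> makes it nonnegative for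
  either sign of \<open>r\<close>.\<close>

lemma not_exact:
  assumes "C1_form A \<eta>" "\<And>c z u. c \<in> A \<Longrightarrow> z \<in> chart_image c \<Longrightarrow> d1 \<eta> c z u (\<i> *s u) = r * \<omega> c z u (\<i> *s u)"
    and c: "c \<in> A" "z \<in> chart_image c"
  shows "r = 0"
proof -
  let ?\<zeta> = "\<lambda>c z u. r * \<eta> c z u + 0 * \<eta> c z u"
  have s: "trace_d1 ?\<zeta> c z e = r * r * real CARD('n)"
    if "c \<in> A" "z \<in> chart_image c" "unitary_frame (\<omega> c z) e" for c z e
    unfolding C1_form_lincomb(2)[OF assms(1,1) that(1,2)] assms(2)[OF that(1,2)]
    using that(3) by (simp add: unitary_frame_def)
  obtain e where e: "unitary_frame (\<omega> c z) e" using frame_exists[OF c] by blast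
  have "trace_d1 ?\<zeta> c z e = 0"
  proof (rule trace_nonneg_imp_zero[OF C1_form_lincomb(1)[OF assms(1,1)] _ c e])
    fix c z assume cz: "c \<in> A" "z \<in> chart_image c"
    obtain e where "unitary_frame (\<omega> c z) e" using frame_exists[OF cz] by blast
    then show "\<exists>e. unitary_frame (\<omega> c z) e \<and> 0 \<le> trace_d1 ?\<zeta> c z e"
      using s[OF cz] by (intro exI[of _ e]) simp
  qed
  then show ?thesis using s[OF c e] by simp
qed

text \<open>\<open>s\<close> is minus the common Einstein constant. The equations are stated on
  pairs \<open>(u, \<i> *s u)\<close>, which are what a trace over a frame evaluates. The lemmas on
  \<open>F\<close> are later applied a second time, with the metrics exchanged and
  \<open>- \<eta>\<close> as primitive.\<close>

context
  fixes \<omega>' :: "('a, 'n) form2" and \<eta> :: "('a, 'n) form1" and s :: real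
  assumes \<omega>': "hermitian_form A \<omega>'" and s: "s \<ge> 0"
    and ricci: "\<And>c z u. c \<in> A \<Longrightarrow> z \<in> chart_image c \<Longrightarrow>
      ricci_form A \<omega> c z u (\<i> *s u) - ricci_form A \<omega>' c z u (\<i> *s u)
        = s * (\<omega>' c z u (\<i> *s u) - \<omega> c z u (\<i> *s u))"
    and \<eta>: "C1_form A \<eta>"
    and d\<eta>: "\<And>c z u. c \<in> A \<Longrightarrow> z \<in> chart_image c \<Longrightarrow>
      d1 \<eta> c z u (\<i> *s u) = \<omega>' c z u (\<i> *s u) - \<omega> c z u (\<i> *s u)"
begin

abbreviation "F \<equiv> log_ratio \<omega> \<omega>'"

lemma F_function: "Ck_function k A F"
  by (rule log_ratio_function[OF hermitian \<omega>'])

lemma dF: "c \<in> A \<Longrightarrow> z \<in> chart_image c \<Longrightarrow>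
    i_ddbar (F c) z u (\<i> *s u) = s * (\<omega>' c z u (\<i> *s u) - \<omega> c z u (\<i> *s u))"
  using i_ddbar_log_ratio[OF hermitian \<omega>', of c z u] ricci[of c z u] by simp

lemma diagonal:
  assumes "c \<in> A" "z \<in> chart_image c"
  obtains e l where "unitary_frame (\<omega> c z) e" "diagonal_frame (\<omega>' c z) e l"
    "\<And>j. l j > 0" "F c z = (\<Sum>j\<in>UNIV. ln (l j))" "F c z \<le> (\<Sum>j\<in>UNIV. l j - 1)"
    "\<And>j. \<omega>' c z (e j) (\<i> *s e j) - \<omega> c z (e j) (\<i> *s e j) = l j - 1"
proof -
  obtain e l where e: "unitary_frame (\<omega> c z) e" "diagonal_frame (\<omega>' c z) e l"
    using simultaneous_diagonalization[OF pos[OF assms] hermitian_form_11[OF \<omega>' assms]] by metis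
  note p = diagonal_pos[OF pos[OF assms] hermitian_pos[OF \<omega>' assms] e]
  have F: "F c z = (\<Sum>j\<in>UNIV. ln (l j))"
    unfolding log_ratio_def by (rule ln_vol_diagonal[OF pos[OF assms] hermitian_pos[OF \<omega>' assms] e])
  moreover have "\<dots> \<le> (\<Sum>j\<in>UNIV. l j - 1)"
    by (intro sum_mono ln_le_minus_one p)
  moreover have "\<omega>' c z (e j) (\<i> *s e j) - \<omega> c z (e j) (\<i> *s e j) = l j - 1" for j
    using e by (simp add: unitary_frame_def diagonal_frame_def)
  ultimately show thesis using that[OF e p] by simp
qed

definition G :: "('a, 'n) chart \<Rightarrow> complex ^ 'n \<Rightarrow> real" where "G c z = (max 0 (F c z))\<^sup>2"

lemma G_function: "Ck_function 1 A G"
  unfolding G_def[abs_def] by (rule max_sq_function(1)[OF F_function])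

lemma G_derivative:
  "c \<in> A \<Longrightarrow> z \<in> chart_image c \<Longrightarrow>
    frechet_derivative (G c) (at z) u = 2 * max 0 (F c z) * frechet_derivative (F c) (at z) u"
  unfolding G_def[abs_def] by (rule max_sq_function(2)[OF F_function])

text \<open>Meant for \<open>t = (\<Sum>j. l j - 1)\<close>, whose sign is undetermined where
  \<open>F\<close> is negative: there the weight is zero, and where \<open>F\<close> is positive so
  is \<open>t\<close>.\<close>

lemma G_times: "F c z \<le> t \<Longrightarrow> G c z * t \<ge> 0"
  by (cases "F c z \<le> 0") (auto simp: G_def max_def)

text \<open>The trace of \<open>d(G d\<^sup>cF)\<close> is the sum of two nonnegative terms, so both vanish.\<close>

lemma gradient_vanishes:
  assumes c: "c \<in> A" "z \<in> chart_image c" and e: "unitary_frame (\<omega> c z) e" "diagonal_frame (\<omega>' c z) e l"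
    and F: "F c z > 0" "F c z \<le> (\<Sum>j\<in>UNIV. l j - 1)"
  shows "frechet_derivative (F c) (at z) (e j) = 0" "frechet_derivative (F c) (at z) (\<i> *s e j) = 0"
proof -
  let ?\<zeta> = "\<lambda>c z u. G c z * dc F c z u"
  let ?D = "\<lambda>c z u. frechet_derivative (F c) (at z) u"
  have dc: "C1_form A (dc F)" by (rule dc_C1_form[OF F_function])
  have lin: "?D c z (- u) = - ?D c z u" if "c \<in> A" "z \<in> chart_image c" for c z u
    using linear_first[OF Ck_functionD(1)[OF F_function that(1)] that(2)] by (rule linear_neg)
  \<comment> \<open>The last term is the wedge product of dG and \<open>dc F\<close>: on
    \<open>(u, \<i> *s u)\<close> that of dF and \<open>dc F\<close> is the sum of the squared
    derivatives along \<open>u\<close> and \<open>\<i> *s u\<close>. The 2 in \<open>2 * s\<close>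
    comes from \<open>d1_dc_J\<close>.\<close>
  have d: "d1 ?\<zeta> c z u (\<i> *s u) = 2 * s * (G c z * (\<omega>' c z u (\<i> *s u) - \<omega> c z u (\<i> *s u)))
      + 2 * max 0 (F c z) * ((?D c z u)\<^sup>2 + (?D c z (\<i> *s u))\<^sup>2)" if "c \<in> A" "z \<in> chart_image c" for c z u
    unfolding C1_form_mult(2)[OF G_function dc that]
    unfolding d1_dc_J[OF F_function that] dF[OF that] G_derivative[OF that] dc_def
    by (simp add: lin[OF that] power2_eq_square algebra_simps)
  have tr: "trace_d1 ?\<zeta> c z e = 2 * s * (G c z * (\<Sum>j\<in>UNIV. l j - 1))
      + 2 * max 0 (F c z) * (\<Sum>j\<in>UNIV. (?D c z (e j))\<^sup>2 + (?D c z (\<i> *s e j))\<^sup>2)"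
    if "c \<in> A" "z \<in> chart_image c" "\<And>j. \<omega>' c z (e j) (\<i> *s e j) - \<omega> c z (e j) (\<i> *s e j) = l j - 1" for c z e l
    unfolding d[OF that(1,2)] that(3) by (subst sum.distrib) (simp only: sum_distrib_left)
  have nn: "2 * max 0 (F c z) * (\<Sum>j\<in>UNIV. (?D c z (e j))\<^sup>2 + (?D c z (\<i> *s e j))\<^sup>2) \<ge> 0" for c z and e :: "'n \<Rightarrow> complex ^ 'n"
    by (intro mult_nonneg_nonneg sum_nonneg) auto
  have Gs: "2 * s * (G c z * t) \<ge> 0" if "F c z \<le> t" for c z t
    using mult_nonneg_nonneg[of "2 * s", OF _ G_times[OF that]] s by simp
  have "trace_d1 ?\<zeta> c z e = 0"
  proof (rule trace_nonneg_imp_zero[OF C1_form_mult(1)[OF G_function dc] _ c e(1)])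
    fix c z assume cz: "c \<in> A" "z \<in> chart_image c"
    obtain e l where el: "unitary_frame (\<omega> c z) e" "F c z \<le> (\<Sum>j\<in>UNIV. l j - 1)"
      "\<And>j. \<omega>' c z (e j) (\<i> *s e j) - \<omega> c z (e j) (\<i> *s e j) = l j - 1"
      using diagonal[OF cz] by metis
    have "trace_d1 ?\<zeta> c z e \<ge> 0"
      unfolding tr[OF cz, of e l, OF el(3)] by (rule add_nonneg_nonneg[OF Gs[OF el(2)] nn])
    then show "\<exists>e. unitary_frame (\<omega> c z) e \<and> 0 \<le> trace_d1 ?\<zeta> c z e"
      using el(1) by blast
  qed
  moreover have l: "\<omega>' c z (e j) (\<i> *s e j) - \<omega> c z (e j) (\<i> *s e j) = l j - 1" for j
    using e by (simp add: unitary_frame_def diagonal_frame_def)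
  ultimately have "2 * max 0 (F c z) * (\<Sum>j\<in>UNIV. (?D c z (e j))\<^sup>2 + (?D c z (\<i> *s e j))\<^sup>2) = 0"
    using tr[OF c, of e l, OF l] nn[of c z e] Gs[OF F(2)] by linarith
  then have "(\<Sum>j\<in>UNIV. (?D c z (e j))\<^sup>2 + (?D c z (\<i> *s e j))\<^sup>2) = 0" using F(1) by simp
  then have "(?D c z (e j))\<^sup>2 + (?D c z (\<i> *s e j))\<^sup>2 = 0"
    by (subst (asm) sum_nonneg_eq_0_iff) auto
  then show "?D c z (e j) = 0" "?D c z (\<i> *s e j) = 0"
    by (simp_all add: sum_power2_eq_zero_iff)
qed

lemma F_nonpos:
  assumes c: "c \<in> A" "z \<in> chart_image c"
  shows "F c z \<le> 0"
proof (rule ccontr)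
  assume pos: "\<not> F c z \<le> 0"
  let ?\<zeta> = "\<lambda>c z u. G c z * \<eta> c z u"
  have tr: "trace_d1 ?\<zeta> c z e = G c z * (\<Sum>j\<in>UNIV. l j - 1)"
    if c: "c \<in> A" "z \<in> chart_image c" and e: "unitary_frame (\<omega> c z) e" "diagonal_frame (\<omega>' c z) e l"
      and F: "F c z \<le> (\<Sum>j\<in>UNIV. l j - 1)" and l: "\<And>j. \<omega>' c z (e j) (\<i> *s e j) - \<omega> c z (e j) (\<i> *s e j) = l j - 1" for c z e l
  proof -
    \<comment> \<open>The terms with the derivative of \<open>G\<close> vanish in both cases: by
      \<open>gradient_vanishes\<close> where \<open>F\<close> is positive, and through the factor
      \<open>max 0 (F c z)\<close> elsewhere.\<close>
    have "d1 ?\<zeta> c z (e j) (\<i> *s e j) = G c z * (l j - 1)" for j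
    proof (cases "F c z > 0")
      case True
      then show ?thesis
        unfolding C1_form_mult(2)[OF G_function \<eta> c] G_derivative[OF c] d\<eta>[OF c] l
        using gradient_vanishes[OF c e True F] by simp
    next
      case False
      then show ?thesis
        unfolding C1_form_mult(2)[OF G_function \<eta> c] G_derivative[OF c] d\<eta>[OF c] l by simp
    qed
    then show ?thesis by (simp only: sum_distrib_left)
  qed
  obtain e l where e: "unitary_frame (\<omega> c z) e" "diagonal_frame (\<omega>' c z) e l"
    "F c z \<le> (\<Sum>j\<in>UNIV. l j - 1)" "\<And>j. \<omega>' c z (e j) (\<i> *s e j) - \<omega> c z (e j) (\<i> *s e j) = l j - 1"
    using diagonal[OF c] by metis
  have "trace_d1 ?\<zeta> c z e = 0"
  proof (rule trace_nonneg_imp_zero[OF C1_form_mult(1)[OF G_function \<eta>] _ c e(1)])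
    fix c z assume cz: "c \<in> A" "z \<in> chart_image c"
    obtain e l where el: "unitary_frame (\<omega> c z) e" "diagonal_frame (\<omega>' c z) e l" "F c z \<le> (\<Sum>j\<in>UNIV. l j - 1)"
      "\<And>j. \<omega>' c z (e j) (\<i> *s e j) - \<omega> c z (e j) (\<i> *s e j) = l j - 1"
      using diagonal[OF cz] by metis
    show "\<exists>e. unitary_frame (\<omega> c z) e \<and> 0 \<le> trace_d1 ?\<zeta> c z e"
      using el(1) tr[OF cz el] G_times[OF el(3)] by auto
  qed
  then have "G c z * (\<Sum>j\<in>UNIV. l j - 1) = 0" using tr[OF c e] by simp
  moreover have "G c z > 0" "(\<Sum>j\<in>UNIV. l j - 1) > 0" using pos e(3) by (auto simp: G_def)
  ultimately show False by simp
qed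

lemma equal_volume_imp_equal:
  assumes F0: "\<And>c z. c \<in> A \<Longrightarrow> z \<in> chart_image c \<Longrightarrow> F c z = 0"
    and c: "c \<in> A" "z \<in> chart_image c"
  shows "\<omega>' c z u v = \<omega> c z u v"
proof -
  obtain e l where e: "unitary_frame (\<omega> c z) e" "diagonal_frame (\<omega>' c z) e l" "\<And>j. l j > 0"
    "F c z = (\<Sum>j\<in>UNIV. ln (l j))" "\<And>j. \<omega>' c z (e j) (\<i> *s e j) - \<omega> c z (e j) (\<i> *s e j) = l j - 1"
    using diagonal[OF c] by metis
  have "trace_d1 \<eta> c z e = 0"
  proof (rule trace_nonneg_imp_zero[OF \<eta> _ c e(1)])
    fix c z assume cz: "c \<in> A" "z \<in> chart_image c"
    obtain e l where el: "unitary_frame (\<omega> c z) e" "F c z \<le> (\<Sum>j\<in>UNIV. l j - 1)"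
      "\<And>j. \<omega>' c z (e j) (\<i> *s e j) - \<omega> c z (e j) (\<i> *s e j) = l j - 1"
      using diagonal[OF cz] by metis
    show "\<exists>e. unitary_frame (\<omega> c z) e \<and> 0 \<le> trace_d1 \<eta> c z e"
      using el(1,2) F0[OF cz] unfolding d\<eta>[OF cz] by (intro exI[of _ e]) (simp only: el(3) simp_thms)
  qed
  \<comment> \<open>Subtracting \<open>F c z = 0\<close>, written as the sum of logarithms, turns
    the trace into a sum of nonnegative terms.\<close>
  then have "(\<Sum>j\<in>UNIV. (l j - 1) - ln (l j)) = 0"
    unfolding d\<eta>[OF c] e(5) using e(4) F0[OF c] by (simp only: sum_subtractf)
  then have "\<forall>j\<in>UNIV. (l j - 1) - ln (l j) = 0"
    using ln_le_minus_one[OF e(3)] by (subst (asm) sum_nonneg_eq_0_iff) auto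
  then have "l j = 1" for j using ln_eq_minus_one[OF e(3)[of j]] by simp
  then have "unitary_frame (\<omega>' c z) e" using e(2) by (simp add: unitary_diagonal diagonal_frame_def)
  then show ?thesis
    by (rule forms_eq_on_frame[OF hermitian_form_11[OF \<omega>' c] form[OF c] _ e(1)])
qed

end

end

section \<open>Cohomology classes and the Einstein constant\<close>

context atlas
begin

lemma closed_form2_scale:
  assumes "closed_form2 A \<alpha>"
  shows "closed_form2 A (scale_form2 r \<alpha>)"
proof -
  have tf: "two_form A \<alpha>"
    and cl: "\<And>c z u v w. in_atlas A c z \<Longrightarrow> frechet_derivative (\<lambda>y. \<alpha> c y v w) (at z) u
        - frechet_derivative (\<lambda>y. \<alpha> c y u w) (at z) v + frechet_derivative (\<lambda>y. \<alpha> c y u v) (at z) w = 0"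
    using assms unfolding closed_form2_def by blast+
  have bil: "\<And>c z. in_atlas A c z \<Longrightarrow> bilinear (\<alpha> c z)" "\<And>c z u. in_atlas A c z \<Longrightarrow> \<alpha> c z u u = 0"
    and tr: "\<And>c c' z u v. c \<in> A \<Longrightarrow> c' \<in> A \<Longrightarrow> z \<in> overlap c c' \<Longrightarrow> \<alpha> c z u v = \<alpha> c' (transition c c' z) (T c c' z u) (T c c' z v)"
    and off: "\<And>c z u v. \<not> in_atlas A c z \<Longrightarrow> \<alpha> c z u v = 0"
    using tf unfolding two_form_def by blast+
  have two: "two_form A (scale_form2 r \<alpha>)"
    unfolding two_form_def
  proof (intro conjI allI ballI impI)
    show "bilinear (scale_form2 r \<alpha> c z)" if "in_atlas A c z" for c z
      unfolding bilinear_def scale_form2_def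
      by (auto intro!: linearI simp: bilinear_rules[OF bil(1)[OF that]] algebra_simps)
    show "smooth_on (\<lambda>z. scale_form2 r \<alpha> c z u v) (chart_image c)" if "c \<in> A" for c u v
      unfolding smooth_on_def scale_form2_def
      by (intro allI Ck_on_cmult open_chart_image two_form_Ck[OF tf] that)
    show "scale_form2 r \<alpha> c z u v = scale_form2 r \<alpha> c' (transition c c' z) (T c c' z u) (T c c' z v)"
      if "c \<in> A" "c' \<in> A" "z \<in> overlap c c'" for c c' z u v
      using tr[OF that, of u v] by (simp add: scale_form2_def)
  qed (simp_all add: scale_form2_def bil off)
  have "frechet_derivative (\<lambda>y. scale_form2 r \<alpha> c y u v) (at z) = (\<lambda>w. r * frechet_derivative (\<lambda>y. \<alpha> c y u v) (at z) w)"
    if "in_atlas A c z" for c z u v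
  proof -
    have cz: "c \<in> A" "z \<in> chart_image c" using that by (auto simp: in_atlas_def)
    show ?thesis unfolding scale_form2_def
      by (rule frechet_derivative_at[symmetric])
        (rule has_derivative_mult_right[OF Ck_on_has_derivative[OF two_form_Ck[OF tf cz(1)] cz(2)]])
  qed
  then have "frechet_derivative (\<lambda>y. scale_form2 r \<alpha> c y v w) (at z) u
        - frechet_derivative (\<lambda>y. scale_form2 r \<alpha> c y u w) (at z) v
        + frechet_derivative (\<lambda>y. scale_form2 r \<alpha> c y u v) (at z) w = 0" if "in_atlas A c z" for c z u v w
    using arg_cong[OF cl[OF that, of v w u], of "\<lambda>t. r * t"] that by (simp add: algebra_simps)
  then show ?thesis using two unfolding closed_form2_def by blast
qed

lemma cohomologous_refl: "cohomologous A \<alpha> \<alpha>"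
  unfolding cohomologous_def
proof (intro exI[of _ "\<lambda>c z u. 0"] conjI allI)
  show "one_form A (\<lambda>c z u. 0)"
    unfolding one_form_def smooth_on_def
    by (auto intro!: linearI Ck_on_const open_chart_image)
  show "\<alpha> c z u v - \<alpha> c z u v = ext_deriv1 A (\<lambda>c z u. 0) c z u v" for c z u v
    by (simp add: ext_deriv1_def frechet_derivative_const)
qed

lemma dR_classD:
  assumes "\<beta> \<in> dR_class A \<alpha>"
  obtains \<eta> where "C1_form A \<eta>"
    "\<And>c z u v. c \<in> A \<Longrightarrow> z \<in> chart_image c \<Longrightarrow> d1 \<eta> c z u v = \<beta> c z u v - \<alpha> c z u v"
proof -
  obtain \<eta> where \<eta>: "one_form A \<eta>" "\<And>c z u v. \<beta> c z u v - \<alpha> c z u v = ext_deriv1 A \<eta> c z u v"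
    using assms unfolding dR_class_def cohomologous_def by blast
  show thesis
    by (rule that[OF one_form_C1[OF \<eta>(1)]]) (simp add: \<eta>(2) ext_deriv1_d1 in_atlas_def)
qed

end

context kaehler
begin

text \<open>By the Einstein equation the Ricci form inherits closedness from
  \<open>\<omega>\<close>, so it lies in the class that it defines. Vanishing of the Chern class
  then makes a multiple of \<open>\<omega>\<close> exact, and \<open>not_exact\<close>
  applies.\<close>

lemma einstein_constant_zero:
  assumes ke: "ricci_form A \<omega> = scale_form2 l \<omega>" and "chern1_zero A" and c: "c \<in> A" "z \<in> chart_image c"
  shows "l = 0"
proof -
  let ?\<rho> = "scale_form2 (1 / (2 * pi)) (ricci_form A \<omega>)"
  have "closed_form2 A \<omega>" using kaehler by (simp add: kahler_form_def)
  then have "closed_form2 A ?\<rho>" unfolding ke by (intro closed_form2_scale)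
  then have "?\<rho> \<in> dR_class A ?\<rho>" using cohomologous_refl by (simp add: dR_class_def)
  then have "?\<rho> \<in> chern1 A" unfolding chern1_def using hermitian by blast
  then have "?\<rho> \<in> dR_class A zero_form2" using assms(2) by (simp add: chern1_zero_def)
  then obtain \<eta> where \<eta>: "C1_form A \<eta>"
    "\<And>c z u v. c \<in> A \<Longrightarrow> z \<in> chart_image c \<Longrightarrow> d1 \<eta> c z u v = ?\<rho> c z u v - zero_form2 c z u v"
    using dR_classD by blast
  have "l / (2 * pi) = 0"
    by (rule not_exact[OF \<eta>(1) _ c]) (simp add: \<eta>(2) ke scale_form2_def zero_form2_def)
  then show ?thesis by simp
qed

text \<open>The class is represented through some Hermitian metric \<open>h\<close>, and
  \<open>log_ratio \<omega> h\<close> compares the Ricci form of \<open>h\<close> with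
  \<open>l * \<omega>\<close>. Modulo exact forms, \<open>\<omega>\<close> is minus the Ricci form
  of \<open>h\<close>, which on pairs \<open>(u, \<i> *s u)\<close> is
  \<open>- l * \<omega>\<close>; so \<open>not_exact\<close> applies to
  \<open>l + 1\<close>.\<close>

lemma einstein_constant_negative:
  assumes ke: "ricci_form A \<omega> = scale_form2 l \<omega>" and cls: "\<omega> \<in> scale_class A (- 2 * pi) (chern1 A)"
    and c: "c \<in> A" "z \<in> chart_image c"
  shows "l = -1"
proof -
  obtain \<alpha> where \<alpha>: "\<alpha> \<in> chern1 A" "\<omega> \<in> dR_class A (scale_form2 (- 2 * pi) \<alpha>)"
    using cls unfolding scale_class_def by blast
  obtain h where h: "hermitian_form A h" "\<alpha> \<in> dR_class A (scale_form2 (1 / (2 * pi)) (ricci_form A h))"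
    using \<alpha>(1) unfolding chern1_def by blast
  obtain \<eta> where \<eta>: "C1_form A \<eta>"
    "\<And>c z u v. c \<in> A \<Longrightarrow> z \<in> chart_image c \<Longrightarrow> d1 \<eta> c z u v = \<omega> c z u v - scale_form2 (- 2 * pi) \<alpha> c z u v"
    using dR_classD[OF \<alpha>(2)] by blast
  obtain \<zeta> where \<zeta>: "C1_form A \<zeta>"
    "\<And>c z u v. c \<in> A \<Longrightarrow> z \<in> chart_image c \<Longrightarrow> d1 \<zeta> c z u v = \<alpha> c z u v - scale_form2 (1 / (2 * pi)) (ricci_form A h) c z u v"
    using dR_classD[OF h(2)] by blast
  let ?L = "log_ratio \<omega> h"
  have L: "Ck_function 2 A ?L" by (rule log_ratio_function[OF hermitian h(1)])
  note dcL = dc_C1_form[OF L]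
  note lc = C1_form_lincomb[OF \<eta>(1) \<zeta>(1)]
  \<comment> \<open>A primitive of \<open>\<omega>\<close> plus the Ricci form of \<open>h\<close>:
    the two occurrences of \<open>\<alpha>\<close> cancel. Adding half of \<open>dc ?L\<close>
    replaces that Ricci form by \<open>l * \<omega>\<close>.\<close>
  let ?\<xi> = "\<lambda>c z u. 1 * \<eta> c z u + (- 2 * pi) * \<zeta> c z u"
  have "l + 1 = 0"
  proof (rule not_exact[OF C1_form_lincomb(1)[OF dcL lc(1)] _ c])
    fix c z u assume cz: "c \<in> A" "z \<in> chart_image c"
    have "i_ddbar (?L c) z u (\<i> *s u) = l * \<omega> c z u (\<i> *s u) - ricci_form A h c z u (\<i> *s u)"
      using i_ddbar_log_ratio[OF hermitian h(1) cz] by (simp add: ke scale_form2_def)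
    then show "d1 (\<lambda>c z u. (1 / 2) * dc ?L c z u + 1 * ?\<xi> c z u) c z u (\<i> *s u) = (l + 1) * \<omega> c z u (\<i> *s u)"
      unfolding C1_form_lincomb(2)[OF dcL lc(1) cz]
      unfolding lc(2)[OF cz] d1_dc_J[OF L cz] \<eta>(2)[OF cz] \<zeta>(2)[OF cz]
      by (simp add: scale_form2_def algebra_simps)
  qed
  then show ?thesis by simp
qed

end

lemma einstein_uniqueness:
  assumes "kaehler X A \<omega>" "kaehler X A \<omega>'" and l: "l \<le> 0"
    and ke: "ricci_form A \<omega> = scale_form2 l \<omega>" "ricci_form A \<omega>' = scale_form2 l \<omega>'"
    and \<eta>: "C1_form A \<eta>" "\<And>c z u v. c \<in> A \<Longrightarrow> z \<in> chart_image c \<Longrightarrow> d1 \<eta> c z u v = \<omega>' c z u v - \<omega> c z u v"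
  shows "\<omega>' = \<omega>"
proof -
  interpret a: kaehler X A \<omega> by (rule assms(1))
  interpret b: kaehler X A \<omega>' by (rule assms(2))
  let ?\<zeta> = "\<lambda>c z u. (-1) * \<eta> c z u + 0 * \<eta> c z u"
  have l': "- l \<ge> 0" using l by simp
  have r: "ricci_form A \<omega> c z u (\<i> *s u) - ricci_form A \<omega>' c z u (\<i> *s u) = - l * (\<omega>' c z u (\<i> *s u) - \<omega> c z u (\<i> *s u))"
    "ricci_form A \<omega>' c z u (\<i> *s u) - ricci_form A \<omega> c z u (\<i> *s u) = - l * (\<omega> c z u (\<i> *s u) - \<omega>' c z u (\<i> *s u))" for c z u
    by (simp_all add: ke scale_form2_def algebra_simps)
  have \<zeta>: "C1_form A ?\<zeta>" by (rule a.C1_form_lincomb(1)[OF \<eta>(1) \<eta>(1)])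
  have d\<zeta>: "d1 ?\<zeta> c z u v = \<omega> c z u v - \<omega>' c z u v" if "c \<in> A" "z \<in> chart_image c" for c z u v
    unfolding a.C1_form_lincomb(2)[OF \<eta>(1) \<eta>(1) that] \<eta>(2)[OF that] by simp
  \<comment> \<open>Exchanging the metrics changes the sign of the logarithmic ratio, so the
    one-sided bound \<open>F_nonpos\<close> works in both directions.\<close>
  have F0: "log_ratio \<omega> \<omega>' c z = 0" if "c \<in> A" "z \<in> chart_image c" for c z
    using a.F_nonpos[OF b.hermitian l' r(1) \<eta>(1) \<eta>(2) that] b.F_nonpos[OF a.hermitian l' r(2) \<zeta> d\<zeta> that]
    by (simp add: log_ratio_def)
  have "\<omega>' c z u v = \<omega> c z u v" for c z u v
  proof (cases "in_atlas A c z")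
    case True
    then have cz: "c \<in> A" "z \<in> chart_image c" by (auto simp: in_atlas_def)
    show ?thesis
      by (rule a.equal_volume_imp_equal[OF b.hermitian l' r(1) \<eta>(1) \<eta>(2) F0 cz])
  next
    case False
    then show ?thesis using a.two_form_off[OF a.two_form] a.two_form_off[OF b.two_form] by simp
  qed
  then show ?thesis by blast
qed

theorem theorem5p9:
  fixes X :: "'a topology"
    and A :: "('a, 'n::finite) chart set"
    and \<Omega> :: "('a, 'n) form2 set"
    and \<omega>\<^sub>0 \<omega>\<^sub>1 :: "('a, 'n) form2"
  assumes "kahler_manifold X A"
    and "compact_space X"
    and "connected_space X"
    and "topspace X \<noteq> {}"
    and "chern1_nonpositive A"
    and "kahler_class A \<Omega>"
    and "chern1_zero A \<or>
         (chern1_negative A \<and> \<Omega> = scale_class A (- 2 * pi) (chern1 A))"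
    and "\<omega>\<^sub>0 \<in> \<Omega>" and "kahler_einstein A \<omega>\<^sub>0"
    and "\<omega>\<^sub>1 \<in> \<Omega>" and "kahler_einstein A \<omega>\<^sub>1"
  shows "\<omega>\<^sub>0 = \<omega>\<^sub>1"
proof -
  have k: "kaehler X A \<omega>\<^sub>0" "kaehler X A \<omega>\<^sub>1"
    using assms by unfold_locales (auto simp: kahler_manifold_def kahler_einstein_def)
  interpret atlas X A using k(1) by (simp add: kaehler_def)
  obtain l\<^sub>0 l\<^sub>1 where ke: "ricci_form A \<omega>\<^sub>0 = scale_form2 l\<^sub>0 \<omega>\<^sub>0" "ricci_form A \<omega>\<^sub>1 = scale_form2 l\<^sub>1 \<omega>\<^sub>1"
    using assms(9,11) by (auto simp: kahler_einstein_def)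
  \<comment> \<open>A point of \<open>X\<close> gives a chart point at which
    \<open>not_exact\<close> can be evaluated to fix the Einstein constants.\<close>
  obtain p where "p \<in> topspace X" using assms(4) by blast
  then obtain c where c: "c \<in> A" "snd c p \<in> chart_image c"
    using manifold unfolding complex_manifold_def chart_image_def by blast
  have l: "l\<^sub>0 = l\<^sub>1 \<and> l\<^sub>0 \<le> 0"
    using assms(7)
  proof
    assume "chern1_zero A"
    then show ?thesis
      using kaehler.einstein_constant_zero[OF k(1) ke(1) _ c] kaehler.einstein_constant_zero[OF k(2) ke(2) _ c] by simp
  next
    assume n: "chern1_negative A \<and> \<Omega> = scale_class A (- 2 * pi) (chern1 A)"
    show ?thesis
      using kaehler.einstein_constant_negative[OF k(1) ke(1) _ c] kaehler.einstein_constant_negative[OF k(2) ke(2) _ c]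
        n assms(8,10) by simp
  qed
  obtain \<omega> where "\<Omega> = dR_class A \<omega>" using assms(6) by (auto simp: kahler_class_def)
  then have cls: "\<omega>\<^sub>0 \<in> dR_class A \<omega>" "\<omega>\<^sub>1 \<in> dR_class A \<omega>" using assms(8,10) by auto
  obtain \<eta> where \<eta>: "C1_form A \<eta>"
    "\<And>c z u v. c \<in> A \<Longrightarrow> z \<in> chart_image c \<Longrightarrow> d1 \<eta> c z u v = \<omega>\<^sub>0 c z u v - \<omega> c z u v"
    using dR_classD[OF cls(1)] by blast
  obtain \<zeta> where \<zeta>: "C1_form A \<zeta>"
    "\<And>c z u v. c \<in> A \<Longrightarrow> z \<in> chart_image c \<Longrightarrow> d1 \<zeta> c z u v = \<omega>\<^sub>1 c z u v - \<omega> c z u v"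
    using dR_classD[OF cls(2)] by blast
  show ?thesis
  \<comment> \<open>\<open>\<omega>\<^sub>1\<close> takes the place of the first metric. The
    primitives of both metrics relative to the representative \<open>\<omega>\<close> of the class
    are subtracted.\<close>
  proof (rule einstein_uniqueness[OF k(2,1) _ _ _ C1_form_lincomb(1)[OF \<eta>(1) \<zeta>(1)]])
    show "l\<^sub>0 \<le> 0" "ricci_form A \<omega>\<^sub>0 = scale_form2 l\<^sub>0 \<omega>\<^sub>0" "ricci_form A \<omega>\<^sub>1 = scale_form2 l\<^sub>0 \<omega>\<^sub>1"
      using l ke by auto
    show "d1 (\<lambda>c z u. 1 * \<eta> c z u + (-1) * \<zeta> c z u) c z u v = \<omega>\<^sub>0 c z u v - \<omega>\<^sub>1 c z u v"
      if "c \<in> A" "z \<in> chart_image c" for c z u v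
      unfolding C1_form_lincomb(2)[OF \<eta>(1) \<zeta>(1) that] \<eta>(2)[OF that] \<zeta>(2)[OF that] by simp
  qed
qed

end
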